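(* Assume $\alpha\in\ell^6$ and $(S-1)\alpha\in\ell^3$. Then $$\int_0^{2\pi}(1-\cos\theta)^2(1+\cos\theta)^2\log w(\theta)\frac{d\theta}{2\pi}>-\infty\iff(S^2-1)^2\alpha\in\ell^2.$$
   Context: $\mu$ is a probability measure with infinite support on the unit circle (identified with $[0,2\pi]$ via $e^{i\theta}\mapsto\theta$), with Lebesgue decomposition $d\mu(\theta)=w(\theta)\frac{d\theta}{2\pi}+d\mu_s(\theta)$. $\Phi_n$ are its monic orthogonal polynomials, and its sequence of Verblunsky coefficients is $\alpha=(\alpha_n)_{n\ge0}$, $\alpha_n=-\overline{\Phi_{n+1}(0)}\in\mathbb{D}$. $S$ is the left shift on sequences, $(S\alpha)_n=\alpha_{n+1}$. The integral is well defined in $[-\infty,\infty)$. *)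

theory Defs
  imports "HOL-Probability.Probability"
    "HOL-Computational_Algebra.Polynomial"
begin

definition circle_borel :: "complex measure" where
  "circle_borel = restrict_space borel (sphere 0 1)"

(* The topological (closed) support. *)
definition msupport :: "'a::topological_space measure \<Rightarrow> 'a set" where
  "msupport M = {x \<in> space M. \<forall>U. open U \<and> x \<in> U \<longrightarrow> emeasure M (U \<inter> space M) > 0}"

(* The normalized Lebesgue measure d\<theta>/2\<pi> on [0, 2\<pi>]. *)
definition dtheta :: "real measure" where
  "dtheta = uniform_measure lborel {0..2 * pi}"

(* d\<mu> = w d\<theta>/2\<pi> + d\<mu>s on the circle, with \<mu>s singular; \<theta> corresponds to e^{i\<theta>}. The density w is
   determined by \<mu> only up to null sets. *)
definition lebesgue_decomposition ::
  "complex measure \<Rightarrow> (real \<Rightarrow> real) \<Rightarrow> complex measure \<Rightarrow> bool" where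
  "lebesgue_decomposition \<mu> w \<mu>s \<longleftrightarrow>
     w \<in> borel_measurable borel \<and> (\<forall>\<theta>. 0 \<le> w \<theta>) \<and>
     sets \<mu>s = sets circle_borel \<and>
     (\<exists>N \<in> sets circle_borel. emeasure (distr dtheta circle_borel cis) N = 0 \<and>
        emeasure \<mu>s (space circle_borel - N) = 0) \<and>
     (\<forall>A \<in> sets circle_borel.
        emeasure \<mu> A =
          emeasure (distr (density dtheta (\<lambda>\<theta>. ennreal (w \<theta>))) circle_borel cis) A + emeasure \<mu>s A)"

(* Well defined when \<mu> has infinite support: such a polynomial then exists and is unique. *)
definition monic_OP :: "complex measure \<Rightarrow> nat \<Rightarrow> complex poly" where
  "monic_OP \<mu> n = (THE p. degree p = n \<and> lead_coeff p = 1 \<and>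
     (\<forall>k<n. (\<integral>z. cnj (z ^ k) * poly p z \<partial>\<mu>) = 0))"

definition verblunsky :: "complex measure \<Rightarrow> nat \<Rightarrow> complex" where
  "verblunsky \<mu> n = - cnj (poly (monic_OP \<mu> (Suc n)) 0)"

definition lp_seq :: "nat \<Rightarrow> (nat \<Rightarrow> complex) set" where
  "lp_seq p = {a. summable (\<lambda>n. norm (a n) ^ p)}"

definition lshift :: "(nat \<Rightarrow> complex) \<Rightarrow> nat \<Rightarrow> complex" where
  "lshift a n = a (Suc n)"

(* For an operator T on sequences, this is the operator T - 1. *)
definition minus_id ::
  "((nat \<Rightarrow> complex) \<Rightarrow> nat \<Rightarrow> complex) \<Rightarrow> (nat \<Rightarrow> complex) \<Rightarrow> nat \<Rightarrow> complex" where
  "minus_id T a n = T a n - a n"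

(* The logarithm with log 0 = -\<infinity>; the library has ln 0 = 0. *)
definition ext_ln :: "real \<Rightarrow> ereal" where
  "ext_ln x = (if x \<le> 0 then -\<infinity> else ereal (ln x))"

(* The integral as the difference of the integrals of positive and negative parts. It is the usual
   extended integral when one of the two is finite; in the theorem the positive part always is,
   since log w \<le> w and w is integrable. Note that e2ennreal sends negative values to 0. *)
definition ext_integral :: "'a measure \<Rightarrow> ('a \<Rightarrow> ereal) \<Rightarrow> ereal" where
  "ext_integral M f =
     enn2ereal (\<integral>\<^sup>+x. e2ennreal (f x) \<partial>M) - enn2ereal (\<integral>\<^sup>+x. e2ennreal (- f x) \<partial>M)"

end

theory Submission
  imports Defs "HOL-Complex_Analysis.Complex_Analysis"
begin

text \<open>Let \<open>f = sin\<^sup>4\<close>, let \<open>\<phi>\<^sub>n\<close> be the orthonormal polynomials and \<open>D\<^sub>n\<close> the integral of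
  \<open>f log \<bar>\<phi>\<^sub>n\<bar>\<^sup>2\<close> against \<open>d\<theta> / 2\<pi>\<close>. Since \<open>f log (w \<bar>\<phi>\<^sub>n\<bar>\<^sup>2) \<le> w \<bar>\<phi>\<^sub>n\<bar>\<^sup>2\<close>, the numbers \<open>D\<^sub>n\<close> are
  bounded above if \<open>f log w\<close> has a finite integral. Conversely, the Bernstein--Szego measures
  \<open>\<bar>\<phi>\<^sub>n\<bar>\<^bsup>-2\<^esup> d\<theta> / 2\<pi>\<close> converge weakly to \<open>\<mu>\<close>, and
  \<open>- f log \<bar>\<phi>\<^sub>n\<bar>\<^sup>2 \<le> f (k \<bar>\<phi>\<^sub>n\<bar>\<^bsup>-2\<^esup> - 1 - log k)\<close> for every \<open>k > 0\<close>. In the limit, the integral of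
  \<open>f (1 + log k)\<close> is bounded in terms of \<open>sup D\<^sub>n\<close> and the \<open>\<mu>\<close>-integral of \<open>f k\<close>, first for continuous
  and then for bounded Borel \<open>k\<close>; choosing for \<open>k\<close> a truncation of \<open>1 / w\<close> off a null set that
  carries the singular part bounds the negative part of \<open>f log w\<close>.

  So the integral is finite iff \<open>D\<^sub>n\<close> is bounded above. Now \<open>D\<^bsub>n+1\<^esub> - D\<^sub>n\<close> depends only on
  \<open>\<alpha>\<^sub>n, \<dots>, \<alpha>\<^bsub>n-4\<^esub>\<close>, through two Taylor coefficients of \<open>log (\<Phi>\<^bsub>n+1\<^esub>\<^sup>* / \<Phi>\<^sub>n\<^sup>*)\<close>. Up to telescoping terms
  its quadratic part is \<open>\<bar>\<alpha>\<^sub>n - 2 \<alpha>\<^bsub>n-2\<^esub> + \<alpha>\<^bsub>n-4\<^esub>\<bar>\<^sup>2 / 16\<close>. A quartic monomial \<open>Re (x y cnj u cnj v)\<close> is the mean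
  of the fourth powers of its factors up to \<open>M\<^sup>2 \<delta>\<^sup>2 \<le> M\<^sup>6 + \<delta>\<^sup>3\<close>, where \<open>M\<close> bounds the factors and \<open>\<delta>\<close> their
  differences; the resulting coefficients sum to zero, so the quartic part is a telescoping sum plus
  a summable one. All remaining terms are of order six.\<close>

section \<open>Integrals over the circle\<close>

lemma sets_dtheta [simp, measurable_cong]: "sets dtheta = sets borel"
  by (simp add: dtheta_def)

lemma space_dtheta [simp]: "space dtheta = UNIV"
  by (simp add: dtheta_def)

lemma emeasure_period: "emeasure lborel {0..2 * pi} = ennreal (2 * pi)"
  by simp

lemma prob_space_dtheta: "prob_space dtheta"
  unfolding dtheta_def by (rule prob_space_uniform_measure) simp_all

interpretation dtheta: prob_space dtheta by (rule prob_space_dtheta)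

lemma AE_dtheta_lborel:
  assumes "AE x in lborel. 0 \<le> x \<and> x \<le> 2 * pi \<longrightarrow> P x"
  shows "AE x in dtheta. P x"
  unfolding dtheta_def by (rule AE_uniform_measureI) (use assms in simp_all)

lemma AE_dtheta_interval: "AE x in dtheta. 0 \<le> x \<and> x < 2 * pi"
proof (rule AE_dtheta_lborel)
  have "AE x in lborel. x \<noteq> 2 * pi" by (rule AE_lborel_singleton)
  then show "AE x in lborel. 0 \<le> x \<and> x \<le> 2 * pi \<longrightarrow> 0 \<le> x \<and> x < 2 * pi"
    by eventually_elim auto
qed

lemma integrable_dtheta:
  fixes f :: "real \<Rightarrow> 'b::{banach, second_countable_topology}"
  assumes "continuous_on UNIV f"
  shows "integrable dtheta f"
proof -
  have "compact (f ` {0..2 * pi})"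
    by (intro compact_continuous_image continuous_on_subset[OF assms]) auto
  then obtain B where B: "\<And>x. x \<in> {0..2 * pi} \<Longrightarrow> norm (f x) \<le> B"
    using compact_imp_bounded bounded_iff by (metis image_eqI)
  show ?thesis
  proof (rule dtheta.integrable_const_bound)
    show "AE x in dtheta. norm (f x) \<le> B"
      using AE_dtheta_interval by eventually_elim (use B in auto)
    show "f \<in> borel_measurable dtheta"
      using borel_measurable_continuous_onI[OF assms] by simp
  qed
qed

text \<open>Bridges two integration theories: contour integrals over \<open>circlepath\<close>
  reduce to gauge integrals over an interval, whereas the measures below are handled with the
  Bochner integral.\<close>

lemma integral_dtheta:
  fixes f :: "real \<Rightarrow> complex"
  assumes "continuous_on UNIV f"
  shows "(\<integral>x. f x \<partial>dtheta) = integral {0..2 * pi} f / (2 * pi)"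
proof -
  have meas: "f \<in> borel_measurable lborel"
    using borel_measurable_continuous_onI[OF assms] by simp
  have d: "dtheta = density lborel (\<lambda>x. ennreal (indicator {0..2 * pi} x / (2 * pi)))"
    unfolding dtheta_def uniform_measure_def emeasure_period
    by (intro density_cong AE_I2) (simp_all add: divide_ennreal[symmetric] ennreal_indicator)
  have "(\<integral>x. f x \<partial>dtheta) = (\<integral>x. (indicator {0..2 * pi} x / (2 * pi)) *\<^sub>R f x \<partial>lborel)"
    unfolding d by (subst integral_density) (use meas in auto)
  also have "\<dots> = (1 / (2 * pi)) *\<^sub>R (LINT x:{0..2 * pi}|lborel. f x)"
    unfolding set_lebesgue_integral_def integral_scaleR_right[symmetric] by simp
  also have "(LINT x:{0..2 * pi}|lborel. f x) = integral {0..2 * pi} f"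
  proof (rule set_borel_integral_eq_integral)
    show "set_integrable lborel {0..2 * pi} f"
      by (rule borel_integrable_atLeastAtMost') (rule continuous_on_subset[OF assms], simp)
  qed
  finally show ?thesis by (simp add: scaleR_conv_of_real)
qed

section \<open>Cauchy's formula in terms of \<open>dtheta\<close>\<close>

lemma cis_continuous_comp:
  assumes "continuous_on (sphere 0 1) f"
  shows "continuous_on UNIV (\<lambda>\<theta>. f (cis \<theta>))"
  by (rule continuous_on_compose2[OF assms]) (auto intro!: continuous_intros)

text \<open>On the unit circle \<open>cnj z = 1 / z\<close> and \<open>dz\<close> is
  \<open>\<i> * z\<close> times the angle differential, so Cauchy's formula for derivatives becomes
  a statement about Fourier coefficients of boundary values.\<close>

lemma integral_cis_Cauchy:
  assumes cont: "continuous_on (cball 0 1) f" and hol: "f holomorphic_on ball 0 1"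
  shows "(\<integral>\<theta>. cnj (cis \<theta> ^ k) * f (cis \<theta>) \<partial>dtheta) = (deriv ^^ k) f 0 / fact k"
proof -
  have c: "continuous_on UNIV (\<lambda>\<theta>. f (cis \<theta>))"
    by (rule cis_continuous_comp) (rule continuous_on_subset[OF cont], auto)
  have "((\<lambda>u. f u / (u - 0) ^ Suc k) has_contour_integral (2 * pi * \<i>) / fact k * (deriv ^^ k) f 0) (circlepath 0 1)"
    by (rule Cauchy_has_contour_integral_higher_derivative_circlepath[OF cont hol]) auto
  then have "((\<lambda>t. f (cis t) / cis t ^ Suc k * \<i> * cis t) has_integral (2 * pi * \<i>) / fact k * (deriv ^^ k) f 0) {0..2 * pi}"
    unfolding circlepath_def by (subst (asm) has_contour_integral_part_circlepath_iff) (auto simp: mult_ac)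
  then have "((\<lambda>t. (f (cis t) / cis t ^ Suc k * \<i> * cis t) / \<i>) has_integral ((2 * pi * \<i>) / fact k * (deriv ^^ k) f 0) / \<i>) {0..2 * pi}"
    by (rule has_integral_divide)
  moreover have "(f (cis t) / cis t ^ Suc k * \<i> * cis t) / \<i> = cnj (cis t ^ k) * f (cis t)" for t
  proof -
    have "cnj (cis t) = 1 / cis t" by (simp add: cis_cnj divide_inverse)
    then show ?thesis by (simp add: power_divide mult.left_commute[of \<i>])
  qed
  ultimately have "((\<lambda>t. cnj (cis t ^ k) * f (cis t)) has_integral ((2 * pi * \<i>) / fact k * (deriv ^^ k) f 0) / \<i>) {0..2 * pi}"
    by (simp only:)
  from integral_unique[OF this]
  have "integral {0..2 * pi} (\<lambda>t. cnj (cis t ^ k) * f (cis t)) = (2 * pi) * ((deriv ^^ k) f 0 / fact k)"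
    by (simp add: mult_ac)
  moreover have "continuous_on UNIV (\<lambda>\<theta>. cnj (cis \<theta> ^ k) * f (cis \<theta>))"
    by (intro continuous_intros c)
  ultimately show ?thesis by (subst integral_dtheta) auto
qed

lemma integral_cis_mean_value:
  assumes "continuous_on (cball 0 1) f" "f holomorphic_on ball 0 1"
  shows "(\<integral>\<theta>. f (cis \<theta>) \<partial>dtheta) = f 0"
  using integral_cis_Cauchy[OF assms, of 0] by simp

text \<open>The function \<open>z ^ k * f z\<close> is analytic and vanishes at 0, so its mean over
  the circle vanishes as well.\<close>

lemma integral_cis_mult_power:
  assumes cont: "continuous_on (cball 0 1) f" and hol: "f holomorphic_on ball 0 1" and "k > 0"
  shows "(\<integral>\<theta>. cis \<theta> ^ k * f (cis \<theta>) \<partial>dtheta) = 0"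
proof -
  have "(\<integral>\<theta>. (\<lambda>z. z ^ k * f z) (cis \<theta>) \<partial>dtheta) = (\<lambda>z. z ^ k * f z) 0"
    by (rule integral_cis_mean_value) (intro continuous_intros holomorphic_intros cont hol)+
  with \<open>k > 0\<close> show ?thesis by simp
qed

lemma measurable_cis: "cis \<in> measurable dtheta borel"
  using borel_measurable_continuous_onI[OF continuous_on_cis[OF continuous_on_id]] by simp

lemma cis_measurable_circle: "cis \<in> measurable dtheta circle_borel"
  unfolding circle_borel_def using measurable_cis by (intro measurable_restrict_space2) auto

section \<open>The Szego recursion\<close>

text \<open>The two recursions are coupled, so both polynomials are produced together: the monic one
  and its reversal (see \<open>poly_Phis_circle\<close>). The coefficients \<open>a\<close> are
  arbitrary here and become \<open>verblunsky \<mu>\<close> later.\<close>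

primrec szego :: "(nat \<Rightarrow> complex) \<Rightarrow> nat \<Rightarrow> complex poly \<times> complex poly" where
  "szego a 0 = (1, 1)"
| "szego a (Suc n) = (pCons 0 (fst (szego a n)) - smult (cnj (a n)) (snd (szego a n)),
     snd (szego a n) - smult (a n) (pCons 0 (fst (szego a n))))"

definition Phi :: "(nat \<Rightarrow> complex) \<Rightarrow> nat \<Rightarrow> complex poly" where
  "Phi a n = fst (szego a n)"

definition Phis :: "(nat \<Rightarrow> complex) \<Rightarrow> nat \<Rightarrow> complex poly" where
  "Phis a n = snd (szego a n)"

lemma Phi_0 [simp]: "Phi a 0 = 1" and Phis_0 [simp]: "Phis a 0 = 1"
  by (simp_all add: Phi_def Phis_def)

lemma Phi_Suc: "Phi a (Suc n) = pCons 0 (Phi a n) - smult (cnj (a n)) (Phis a n)"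
  and Phis_Suc: "Phis a (Suc n) = Phis a n - smult (a n) (pCons 0 (Phi a n))"
  by (simp_all add: Phi_def Phis_def)

lemma degree_Phis_le: "degree (Phis a n) \<le> n"
  and degree_Phi_le: "degree (Phi a n) \<le> n"
proof (induction n)
  case (Suc n)
  {
    case 1 show ?case unfolding Phis_Suc
      using Suc by (intro degree_diff_le order_trans[OF degree_smult_le] order_trans[OF degree_pCons_le]) auto
  next
    case 2 show ?case unfolding Phi_Suc
      using Suc by (intro degree_diff_le order_trans[OF degree_smult_le] order_trans[OF degree_pCons_le]) auto
  }
qed auto

lemma coeff_Phi_n [simp]: "coeff (Phi a n) n = 1"
proof (induction n)
  case (Suc n)
  have "coeff (Phis a n) (Suc n) = 0"
    by (rule coeff_eq_0) (use degree_Phis_le[of a n] in auto)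
  then show ?case using Suc by (simp add: Phi_Suc)
qed auto

lemma degree_Phi [simp]: "degree (Phi a n) = n"
  using degree_Phi_le[of a n] le_degree[of "Phi a n" n] by simp

lemma poly_Phis_0 [simp]: "poly (Phis a n) 0 = 1"
  by (induction n) (auto simp: Phis_Suc)

text \<open>Since \<open>z * cnj z = 1\<close>, conjugating the recursion for \<open>Phi\<close> and
  multiplying by \<open>z ^ Suc n\<close> gives the recursion for \<open>Phis\<close>.\<close>

lemma poly_Phis_circle:
  assumes "norm z = 1"
  shows "poly (Phis a n) z = z ^ n * cnj (poly (Phi a n) z)"
proof (induction n)
  case (Suc n)
  have "z * cnj z = 1" using assms by (simp add: complex_norm_square[symmetric])
  then have zn: "z ^ n * cnj z ^ n = 1" by (simp flip: power_mult_distrib)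
  have "z ^ Suc n * cnj (poly (Phi a (Suc n)) z) =
     z ^ n * (z * cnj z) * cnj (poly (Phi a n) z) - a n * z * (z ^ n * cnj (poly (Phis a n) z))"
    by (simp add: Phi_Suc algebra_simps)
  also have "z ^ n * cnj (poly (Phis a n) z) = (z ^ n * cnj z ^ n) * poly (Phi a n) z"
    unfolding Suc by simp
  finally show ?case
    unfolding zn \<open>z * cnj z = 1\<close> by (simp add: Phis_Suc Suc)
qed auto

lemma norm_Phis_circle:
  assumes "norm z = 1"
  shows "norm (poly (Phis a n) z) = norm (poly (Phi a n) z)"
  using assms by (simp add: poly_Phis_circle norm_mult norm_power)

text \<open>One step of the recursion moves the quotient of the two polynomials by a Moebius map of
  the disk. Both claims need one common induction, because the old bound is what keeps the new
  \<open>Phis\<close> from vanishing. Absence of zeros on the closed disk later makes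
  \<open>1 / Phis\<close> and logarithms analytic.\<close>

lemma Phi_Phis_disk:
  assumes a: "\<And>j. norm (a j) < 1" and z: "norm z \<le> 1"
  shows "norm (poly (Phi a n) z) \<le> norm (poly (Phis a n) z) \<and> poly (Phis a n) z \<noteq> 0"
proof (induction n)
  case (Suc n)
  define p q where "p = z * poly (Phi a n) z" and "q = poly (Phis a n) z"
  have pq: "norm p \<le> norm q" "q \<noteq> 0"
  proof -
    have "norm p \<le> 1 * norm (poly (Phi a n) z)"
      unfolding p_def norm_mult by (intro mult_right_mono z) auto
    with Suc show "norm p \<le> norm q" "q \<noteq> 0" by (auto simp: q_def)
  qed
  have eq: "poly (Phi a (Suc n)) z = p - cnj (a n) * q" "poly (Phis a (Suc n)) z = q - a n * p"
    by (auto simp: Phi_Suc Phis_Suc p_def q_def)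
  have "norm (a n * p) < norm q"
  proof -
    have "norm (a n * p) \<le> norm (a n) * norm q"
      unfolding norm_mult using pq by (intro mult_left_mono) auto
    also have "\<dots> < 1 * norm q" using a pq by (intro mult_strict_right_mono) auto
    finally show ?thesis by simp
  qed
  then have "q - a n * p \<noteq> 0" by auto
  moreover have "norm (p - cnj (a n) * q) \<le> norm (q - a n * p)"
  proof (rule power2_le_imp_le)
    \<comment> \<open>The cross terms of the two squares are equal and cancel.\<close>
    have "(norm (q - a n * p))\<^sup>2 - (norm (p - cnj (a n) * q))\<^sup>2 = (1 - (norm (a n))\<^sup>2) * ((norm q)\<^sup>2 - (norm p)\<^sup>2)"
      unfolding cmod_power2 by (simp add: algebra_simps power2_eq_square)
    also have "\<dots> \<ge> 0"
      using a[of n] pq by (intro mult_nonneg_nonneg) (auto simp: abs_square_le_1 power_mono)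
    finally show "(norm (p - cnj (a n) * q))\<^sup>2 \<le> (norm (q - a n * p))\<^sup>2" by simp
  qed auto
  ultimately show ?case unfolding eq by blast
qed auto

section \<open>Running the recursion backwards; orthogonality for abstract moment
  functionals\<close>

lemma inverse_szego:
  shows "smult (1 - a n * cnj (a n)) (pCons 0 (Phi a n)) = Phi a (Suc n) + smult (cnj (a n)) (Phis a (Suc n))"
    and "smult (1 - a n * cnj (a n)) (Phis a n) = Phis a (Suc n) + smult (a n) (Phi a (Suc n))"
  unfolding Phi_Suc Phis_Suc by (simp_all add: algebra_simps smult_diff_right smult_diff_left smult_add_right)

text \<open>This is the squared norm of \<open>Phi a n\<close> in the space of a measure whose
  Verblunsky coefficients are \<open>a\<close>; see \<open>integral_norm2_Phi\<close>.\<close>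

definition Nrm :: "(nat \<Rightarrow> complex) \<Rightarrow> nat \<Rightarrow> real" where
  "Nrm a n = (\<Prod>j<n. 1 - (norm (a j))\<^sup>2)"

lemma Nrm_pos:
  assumes "\<And>j. norm (a j) < 1"
  shows "Nrm a n > 0"
  unfolding Nrm_def using assms by (intro prod_pos) (simp add: abs_square_less_1)

text \<open>\<open>E k p\<close> stands for the integral of \<open>cnj (z ^ k) * poly p z\<close> against a measure on the circle.\<close>
locale moment_functional =
  fixes E :: "nat \<Rightarrow> complex poly \<Rightarrow> complex"
  assumes add: "E k (p + q) = E k p + E k q"
    and smult: "E k (smult c p) = c * E k p"
    and shift: "E (Suc k) (pCons 0 p) = E k p"
begin

lemma diff: "E k (p - q) = E k p - E k q"
  using add[of k "p - q" q] by simp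

text \<open>By \<open>inverse_szego\<close>, level \<open>j\<close> is a combination of the
  polynomials of level \<open>Suc j\<close> after division by the nonzero number
  \<open>1 - a j * cnj (a j)\<close>. So orthogonality passes from one level to all lower ones; for
  a Bernstein--Szego weight only the top level is computed directly.\<close>

lemma orthogonal_downward:
  assumes a: "\<And>j. norm (a j) < 1" and "j \<le> n"
    and "\<And>k. k < n \<Longrightarrow> E k (Phi a n) = 0"
    and "\<And>k. 0 < k \<Longrightarrow> k \<le> n \<Longrightarrow> E k (Phis a n) = 0"
    and "E n (Phi a n) = of_real (Nrm a n)"
  shows "(\<forall>k<j. E k (Phi a j) = 0) \<and> (\<forall>k. 0 < k \<longrightarrow> k \<le> j \<longrightarrow> E k (Phis a j) = 0)
     \<and> E j (Phi a j) = of_real (Nrm a j)"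
  using assms(2)
proof (induction j rule: inc_induct)
  case (step j)
  define r where "r = 1 - a j * cnj (a j)"
  have r: "r = of_real (1 - (norm (a j))\<^sup>2)" "r \<noteq> 0"
  proof -
    show "r = of_real (1 - (norm (a j))\<^sup>2)"
      unfolding r_def of_real_diff complex_norm_square by simp
    moreover have "(norm (a j))\<^sup>2 < 1" using a[of j] by (simp add: abs_square_less_1)
    ultimately show "r \<noteq> 0" by (metis diff_gt_0_iff_gt less_irrefl of_real_eq_0_iff)
  qed
  have Phi: "r * E k (Phi a j) = E (Suc k) (Phi a (Suc j)) + cnj (a j) * E (Suc k) (Phis a (Suc j))" for k
    using arg_cong[OF inverse_szego(1)[of a j], of "E (Suc k)"] by (simp only: add smult shift r_def)
  have Phis: "r * E k (Phis a j) = E k (Phis a (Suc j)) + a j * E k (Phi a (Suc j))" for k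
    using arg_cong[OF inverse_szego(2)[of a j], of "E k"] by (simp only: add smult shift r_def)
  have "E k (Phi a j) = 0" if "k < j" for k
    using Phi[of k] step.IH that r(2) by simp
  moreover have "E k (Phis a j) = 0" if "0 < k" "k \<le> j" for k
    using Phis[of k] step.IH that r(2) by simp
  moreover have "r * E j (Phi a j) = r * of_real (Nrm a j)"
    using Phi[of j] step.IH by (simp add: Nrm_def r(1) mult.commute)
  ultimately show ?case using r(2) by simp
qed (use assms in auto)

text \<open>The polynomials \<open>Phi a j\<close> with \<open>j \<le> n\<close> form a triangular
  basis. Both functionals vanish on all of them except the constant, where they agree.\<close>

lemma moments_eq:
  assumes F: "moment_functional F"
    and "E 0 1 = F 0 1"
    and "\<And>j. 0 < j \<Longrightarrow> j \<le> n \<Longrightarrow> E 0 (Phi a j) = 0"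
    and "\<And>j. 0 < j \<Longrightarrow> j \<le> n \<Longrightarrow> F 0 (Phi a j) = 0"
    and "degree p \<le> n"
  shows "E 0 p = F 0 p"
  using assms(5)
proof (induction "degree p" arbitrary: p rule: less_induct)
  case less
  interpret F: moment_functional F by (rule F)
  show ?case
  proof (cases "degree p")
    case 0
    then obtain c where "p = [:c:]" by (rule degree_eq_zeroE)
    then have "p = smult c 1" by (simp add: one_pCons)
    then show ?thesis using assms(2) by (simp only: smult F.smult)
  next
    case (Suc m)
    define d where "d = degree p"
    define q where "q = p - smult (lead_coeff p) (Phi a d)"
    have "degree q < degree p"
    proof (rule le_neq_implies_less)
      have "degree q \<le> d" unfolding q_def d_def
        by (intro degree_diff_le order_trans[OF degree_smult_le]) auto
      then show "degree q \<le> degree p" by (simp add: d_def)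
      have "coeff q d = 0" by (simp add: q_def d_def)
      \<comment> \<open>Equality of the degrees would make the leading coefficient of
        \<open>q\<close> zero, hence \<open>q = 0\<close>, against
        \<open>degree p = Suc m\<close>.\<close>
      show "degree q \<noteq> degree p"
        using \<open>coeff q d = 0\<close> Suc d_def by (metis degree_0 leading_coeff_0_iff nat.distinct(1))
    qed
    then have IH: "E 0 q = F 0 q" using less by auto
    have p: "p = q + smult (lead_coeff p) (Phi a d)" by (simp add: q_def)
    have "E 0 (Phi a d) = 0" "F 0 (Phi a d) = 0"
      using assms(3,4)[of d] Suc less.prems by (auto simp: d_def)
    then show ?thesis
      by (subst (1 2) p) (simp add: add smult F.add F.smult IH)
  qed
qed

end

section \<open>Nontrivial measures on the circle\<close>

lemma cnj_mult_circle: "norm z = 1 \<Longrightarrow> cnj z * z = 1" for z :: complex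
  by (simp add: mult.commute complex_norm_square[symmetric])

lemma cnj_power_mult_power:
  fixes z :: complex
  assumes "norm z = 1" "k \<le> n"
  shows "cnj (z ^ k) * z ^ n = z ^ (n - k)"
proof -
  have "z ^ n = z ^ k * z ^ (n - k)" using assms(2) by (simp flip: power_add)
  then have "cnj (z ^ k) * z ^ n = (cnj z * z) ^ k * z ^ (n - k)" by (simp add: power_mult_distrib)
  then show ?thesis using cnj_mult_circle[OF assms(1)] by simp
qed

locale circle_measure = prob_space \<mu> for \<mu> :: "complex measure" +
  assumes sets_\<mu>: "sets \<mu> = sets circle_borel"
    and inf_supp: "infinite (msupport \<mu>)"
begin

lemma sets_\<mu>_cong [measurable_cong]: "sets \<mu> = sets (restrict_space borel (sphere 0 1))"
  by (simp add: sets_\<mu> circle_borel_def)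

lemma space_\<mu>: "space \<mu> = sphere 0 1"
  using sets_eq_imp_space_eq[OF sets_\<mu>_cong] by (simp add: space_restrict_space)

lemma measurable_circle:
  assumes "f \<in> measurable borel N"
  shows "f \<in> measurable \<mu> N"
proof -
  have "f \<in> measurable (restrict_space borel (sphere 0 1)) N"
    using assms by (rule measurable_restrict_space1)
  then show ?thesis using measurable_cong_sets[OF sets_\<mu>_cong refl] by blast
qed

lemma integrable_circle:
  fixes f :: "complex \<Rightarrow> 'b::{banach, second_countable_topology}"
  assumes "continuous_on (sphere 0 1) f"
  shows "integrable \<mu> f"
proof -
  have "compact (f ` sphere 0 1)"
    by (intro compact_continuous_image assms) auto
  then obtain B where B: "\<And>x. x \<in> sphere 0 1 \<Longrightarrow> norm (f x) \<le> B"
    using compact_imp_bounded bounded_iff by (metis image_eqI)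
  show ?thesis
  proof (rule integrable_const_bound)
    show "AE x in \<mu>. norm (f x) \<le> B" by (rule AE_I2) (use B space_\<mu> in auto)
    have "f \<in> borel_measurable (restrict_space borel (sphere 0 1))"
      by (rule borel_measurable_continuous_on_restrict[OF assms])
    then show "f \<in> borel_measurable \<mu>"
      using measurable_cong_sets[OF sets_\<mu>_cong refl] by blast
  qed
qed

definition E :: "nat \<Rightarrow> complex poly \<Rightarrow> complex" where
  "E k p = (\<integral>z. cnj (z ^ k) * poly p z \<partial>\<mu>)"

lemma norm_circle: "z \<in> space \<mu> \<Longrightarrow> norm z = 1"
  by (simp add: space_\<mu>)

lemma integrable_E: "integrable \<mu> (\<lambda>z. cnj (z ^ k) * poly p z)"
  by (intro integrable_circle continuous_intros)

sublocale E: moment_functional E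
proof
  fix k p q c
  show "E k (p + q) = E k p + E k q"
    unfolding E_def by (subst Bochner_Integration.integral_add[symmetric, OF integrable_E integrable_E]) (simp add: algebra_simps)
  show "E k (smult c p) = c * E k p"
    unfolding E_def by (subst integral_mult_right_zero[symmetric]) (simp add: algebra_simps)
  show "E (Suc k) (pCons 0 p) = E k p"
    unfolding E_def
  proof (rule Bochner_Integration.integral_cong[OF refl])
    fix z assume "z \<in> space \<mu>"
    then have "cnj z * z = 1" by (intro cnj_mult_circle norm_circle)
    moreover have "cnj (z ^ Suc k) * poly (pCons 0 p) z = (cnj z * z) * (cnj (z ^ k) * poly p z)"
      by simp
    ultimately show "cnj (z ^ Suc k) * poly (pCons 0 p) z = cnj (z ^ k) * poly p z" by simp
  qed
qed

lemma E_0_1 [simp]: "E 0 1 = 1"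
  by (simp add: E_def prob_space)

lemma integral_cnj_poly:
  "(\<integral>z. cnj (poly q z) * poly p z \<partial>\<mu>) = (\<Sum>i\<le>degree q. cnj (coeff q i) * E i p)"
proof -
  have "(\<integral>z. cnj (poly q z) * poly p z \<partial>\<mu>)
     = (\<integral>z. (\<Sum>i\<le>degree q. cnj (coeff q i) * (cnj (z ^ i) * poly p z)) \<partial>\<mu>)"
    by (subst poly_altdef) (simp add: sum_distrib_left mult_ac)
  also have "\<dots> = (\<Sum>i\<le>degree q. \<integral>z. cnj (coeff q i) * (cnj (z ^ i) * poly p z) \<partial>\<mu>)"
    by (intro Bochner_Integration.integral_sum integrable_mult_right integrable_E)
  finally show ?thesis by (simp add: E_def)
qed

text \<open>The powers below \<open>n\<close> contribute nothing. For \<open>degree q < n\<close>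
  the formula still holds, with \<open>coeff q n = 0\<close>.\<close>

lemma integral_cnj_poly_orthogonal:
  assumes "\<And>k. k < n \<Longrightarrow> E k p = 0" "degree q \<le> n"
  shows "(\<integral>z. cnj (poly q z) * poly p z \<partial>\<mu>) = cnj (coeff q n) * E n p"
proof -
  have "(\<Sum>i\<le>degree q. cnj (coeff q i) * E i p) = (\<Sum>i\<le>n. cnj (coeff q i) * E i p)"
    using assms(2) by (intro sum.mono_neutral_left) (auto simp: coeff_eq_0)
  also have "\<dots> = cnj (coeff q n) * E n p"
    using assms(1) by (subst sum.remove[of _ n]) (auto intro!: sum.neutral)
  finally show ?thesis by (simp add: integral_cnj_poly)
qed

lemma integral_cnj_self:
  "(\<integral>z. cnj (poly p z) * poly p z \<partial>\<mu>) = of_real (\<integral>z. (norm (poly p z))\<^sup>2 \<partial>\<mu>)"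
proof -
  have "cnj (poly p z) * poly p z = complex_of_real ((norm (poly p z))\<^sup>2)" for z
    by (metis complex_norm_square mult.commute)
  then show ?thesis by (simp only: integral_complex_of_real)
qed

text \<open>If the integral were zero, \<open>p\<close> would vanish almost everywhere and every
  point of the support would be a root of \<open>p\<close>. This is where infinite support
  enters.\<close>

lemma norm2_pos:
  assumes "p \<noteq> 0"
  shows "(\<integral>z. (norm (poly p z))\<^sup>2 \<partial>\<mu>) > 0"
proof (rule ccontr)
  assume "\<not> ?thesis"
  then have 0: "(\<integral>z. (norm (poly p z))\<^sup>2 \<partial>\<mu>) = 0"
    using Bochner_Integration.integral_nonneg[where M=\<mu> and f="\<lambda>z. (norm (poly p z))\<^sup>2"] by (simp add: not_less order_antisym)
  have "AE z in \<mu>. (norm (poly p z))\<^sup>2 = 0"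
  proof (subst integral_nonneg_eq_0_iff_AE[symmetric])
    show "integrable \<mu> (\<lambda>z. (norm (poly p z))\<^sup>2)" by (intro integrable_circle continuous_intros)
  qed (use 0 in auto)
  then have ae: "AE z in \<mu>. poly p z = 0" by simp
  have "msupport \<mu> \<subseteq> {z. poly p z = 0}"
  proof
    fix x assume x: "x \<in> msupport \<mu>"
    show "x \<in> {z. poly p z = 0}"
    proof (rule ccontr)
      assume nz: "x \<notin> {z. poly p z = 0}"
      define U where "U = - {z. poly p z = 0}"
      have "closed {z. poly p z = 0}"
        by (rule finite_imp_closed) (rule poly_roots_finite[OF assms])
      then have "open U" unfolding U_def by (rule open_Compl)
      moreover have "x \<in> U" using nz by (simp add: U_def)
      ultimately have "emeasure \<mu> (U \<inter> space \<mu>) > 0"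
        using x unfolding msupport_def by blast
      moreover have "U \<inter> space \<mu> \<in> sets \<mu>"
        unfolding sets_\<mu>_cong sets_restrict_space space_\<mu> using \<open>open U\<close> by (auto simp: Int_commute)
      moreover have "{z \<in> space \<mu>. \<not> poly p z = 0} = U \<inter> space \<mu>" by (auto simp: U_def)
      ultimately have "\<not> (AE z in \<mu>. poly p z = 0)"
        using AE_iff_measurable[where N="U \<inter> space \<mu>" and M=\<mu> and P="\<lambda>z. poly p z = 0"] by (metis less_irrefl)
      then show False using ae by blast
    qed
  qed
  then show False using inf_supp poly_roots_finite[OF assms] finite_subset by blast
qed

definition monic_orth :: "nat \<Rightarrow> complex poly \<Rightarrow> bool" where
  "monic_orth n p \<longleftrightarrow> degree p = n \<and> lead_coeff p = 1 \<and> (\<forall>k<n. E k p = 0)"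

text \<open>The difference of two candidates has no coefficient of order \<open>n\<close>, so it is
  orthogonal to itself. This gives the uniqueness behind the definite description in
  \<open>monic_OP\<close>.\<close>

lemma monic_orth_unique:
  assumes "monic_orth n p" "monic_orth n q"
  shows "p = q"
proof (rule ccontr)
  assume "p \<noteq> q"
  define d where "d = p - q"
  have "d \<noteq> 0" using \<open>p \<noteq> q\<close> by (simp add: d_def)
  have orth: "E k d = 0" if "k < n" for k
    using assms that unfolding d_def E.diff monic_orth_def by simp
  have deg: "degree d \<le> n"
    using assms unfolding d_def monic_orth_def by (intro degree_diff_le) auto
  have "coeff d n = 0" using assms by (auto simp: d_def monic_orth_def)
  then have "(\<integral>z. cnj (poly d z) * poly d z \<partial>\<mu>) = 0"
    by (subst integral_cnj_poly_orthogonal[OF orth deg]) auto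
  with norm2_pos[OF \<open>d \<noteq> 0\<close>] show False unfolding integral_cnj_self by simp
qed

lemma monic_OP_eqI:
  assumes "monic_orth n p"
  shows "monic_OP \<mu> n = p"
proof -
  have "monic_OP \<mu> n = (THE q. monic_orth n q)"
    by (simp only: monic_OP_def monic_orth_def E_def)
  then show ?thesis using assms monic_orth_unique by (simp add: the_equality)
qed

section \<open>Verblunsky coefficients and the orthogonality of
  \<open>Phi \<alpha> n\<close>\<close>

abbreviation "\<alpha> \<equiv> verblunsky \<mu>"

text \<open>On the circle \<open>cnj (z ^ k) * z ^ n\<close> is \<open>z ^ (n - k)\<close>, so
  reversal turns moments of \<open>Phis\<close> into conjugated moments of
  \<open>Phi\<close>.\<close>

lemma E_Phis:
  assumes "k \<le> n"
  shows "E k (Phis a n) = cnj (E (n - k) (Phi a n))"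
  unfolding E_def Bochner_Integration.integral_cnj[symmetric]
proof (rule Bochner_Integration.integral_cong[OF refl])
  fix z assume "z \<in> space \<mu>"
  then have z: "norm z = 1" by (rule norm_circle)
  have "cnj (z ^ k) * poly (Phis a n) z = (cnj (z ^ k) * z ^ n) * cnj (poly (Phi a n) z)"
    by (simp add: poly_Phis_circle[OF z])
  then show "cnj (z ^ k) * poly (Phis a n) z = cnj (cnj (z ^ (n - k)) * poly (Phi a n) z)"
    unfolding cnj_power_mult_power[OF z assms] by simp
qed

text \<open>The case \<open>k = Suc n\<close> lies just outside the range of \<open>E_Phis\<close>;
  it enters the norm of the next polynomial.\<close>

lemma E_Suc_Phis: "E (Suc n) (Phis a n) = cnj (E 0 (pCons 0 (Phi a n)))"
  unfolding E_def Bochner_Integration.integral_cnj[symmetric]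
proof (rule Bochner_Integration.integral_cong[OF refl])
  fix z assume "z \<in> space \<mu>"
  then have z: "norm z = 1" by (rule norm_circle)
  have "cnj (z ^ Suc n) * poly (Phis a n) z = cnj z * (cnj (z ^ n) * z ^ n) * cnj (poly (Phi a n) z)"
    by (simp add: poly_Phis_circle[OF z])
  then show "cnj (z ^ Suc n) * poly (Phis a n) z = cnj (cnj (z ^ 0) * poly (pCons 0 (Phi a n)) z)"
    unfolding cnj_power_mult_power[OF z order_refl] by simp
qed

text \<open>Szego's theorem. The next orthogonal polynomial is found as a combination of
  \<open>pCons 0 (Phi \<alpha> n)\<close> and \<open>Phis \<alpha> n\<close>; its value at 0
  identifies the unknown factor as \<open>cnj (\<alpha> n)\<close>. Positivity of the norm is
  carried along because it is divided by and because it yields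
  \<open>norm (\<alpha> n) < 1\<close>.\<close>

lemma orth_Phi: "(\<forall>k<n. E k (Phi \<alpha> n) = 0) \<and> E n (Phi \<alpha> n) = of_real (Nrm \<alpha> n) \<and> Nrm \<alpha> n > 0
    \<and> (\<forall>j<n. norm (\<alpha> j) < 1)"
proof (induction n)
  case 0
  then show ?case by (simp add: Nrm_def)
next
  case (Suc n)
  \<comment> \<open>The value for which \<open>p\<close> is orthogonal to the constants.\<close>
  define c where "c = E 0 (pCons 0 (Phi \<alpha> n)) / Nrm \<alpha> n"
  define p where "p = pCons 0 (Phi \<alpha> n) - smult c (Phis \<alpha> n)"
  have Phis0: "E 0 (Phis \<alpha> n) = of_real (Nrm \<alpha> n)" using Suc by (simp add: E_Phis)
  have "E k p = 0" if "k < Suc n" for k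
  proof (cases k)
    case 0
    then show ?thesis unfolding p_def E.diff E.smult using Suc by (simp add: Phis0 c_def)
  next
    case (Suc k')
    then show ?thesis unfolding p_def E.diff E.smult using Suc.IH that by (simp add: E.shift E_Phis)
  qed
  moreover have "degree p \<le> Suc n"
    unfolding p_def using degree_Phis_le[of \<alpha> n]
    by (intro degree_diff_le order_trans[OF degree_smult_le] order_trans[OF degree_pCons_le]) auto
  moreover have "coeff p (Suc n) = 1"
    unfolding p_def using degree_Phis_le[of \<alpha> n] by (simp add: coeff_eq_0)
  ultimately have mo: "monic_orth (Suc n) p"
    unfolding monic_orth_def using le_degree[of p "Suc n"] by fastforce
  then have "monic_OP \<mu> (Suc n) = p" by (rule monic_OP_eqI)
  then have "\<alpha> n = - cnj (poly p 0)" by (simp add: verblunsky_def)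
  \<comment> \<open>Since \<open>Phis\<close> equals 1 at 0, the value of \<open>p\<close> there is
    \<open>- c\<close>.\<close>
  then have c: "c = cnj (\<alpha> n)" by (simp add: p_def)
  then have p: "p = Phi \<alpha> (Suc n)" by (simp add: p_def Phi_Suc)
  have E1: "E (Suc n) (Phi \<alpha> (Suc n)) = of_real (Nrm \<alpha> (Suc n))"
  proof -
    have "E (Suc n) (Phis \<alpha> n) = cnj (E 0 (pCons 0 (Phi \<alpha> n)))" by (rule E_Suc_Phis)
    also have "\<dots> = cnj (c * of_real (Nrm \<alpha> n))" using Suc.IH by (simp add: c_def)
    finally have "E (Suc n) p = of_real (Nrm \<alpha> n) - c * cnj c * of_real (Nrm \<alpha> n)"
      unfolding p_def E.diff E.smult E.shift using Suc.IH by simp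
    also have "\<dots> = of_real (Nrm \<alpha> (Suc n))"
      unfolding c by (simp add: Nrm_def algebra_simps complex_norm_square flip: of_real_power)
    finally show ?thesis by (simp add: p)
  qed
  \<comment> \<open>The norm of \<open>p\<close> is computed as \<open>Nrm \<alpha> (Suc n)\<close>;
    as \<open>p\<close> is nonzero, this number is positive, and so is its last factor.\<close>
  have "of_real (\<integral>z. (norm (poly p z))\<^sup>2 \<partial>\<mu>) = cnj (coeff p (Suc n)) * E (Suc n) p"
    unfolding integral_cnj_self[symmetric]
    by (rule integral_cnj_poly_orthogonal) (use mo in \<open>auto simp: monic_orth_def\<close>)
  also have "\<dots> = of_real (Nrm \<alpha> (Suc n))" using mo by (simp add: p E1)
  finally have "(\<integral>z. (norm (poly p z))\<^sup>2 \<partial>\<mu>) = Nrm \<alpha> (Suc n)"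
    by (simp only: of_real_eq_iff)
  moreover have "p \<noteq> 0" using mo by (auto simp: monic_orth_def)
  ultimately have N: "Nrm \<alpha> (Suc n) > 0" using norm2_pos[of p] by simp
  have "Nrm \<alpha> (Suc n) = Nrm \<alpha> n * (1 - (norm (\<alpha> n))\<^sup>2)" by (simp add: Nrm_def)
  with N Suc.IH have "(norm (\<alpha> n))\<^sup>2 < 1" by (simp add: zero_less_mult_iff)
  then have "norm (\<alpha> n) < 1" by (simp add: abs_square_less_1)
  then show ?case using Suc.IH mo E1 N by (auto simp: p[symmetric] monic_orth_def less_Suc_eq)
qed

lemma norm_alpha: "norm (\<alpha> n) < 1"
  using orth_Phi[of "Suc n"] by auto

lemma integral_norm2_Phi: "(\<integral>z. (norm (poly (Phi \<alpha> n) z))\<^sup>2 \<partial>\<mu>) = Nrm \<alpha> n"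
proof -
  have "of_real (\<integral>z. (norm (poly (Phi \<alpha> n) z))\<^sup>2 \<partial>\<mu>) = cnj (coeff (Phi \<alpha> n) n) * E n (Phi \<alpha> n)"
    unfolding integral_cnj_self[symmetric]
    by (rule integral_cnj_poly_orthogonal) (use orth_Phi[of n] in auto)
  also have "\<dots> = of_real (Nrm \<alpha> n)" using orth_Phi[of n] by simp
  finally show ?thesis by (simp only: of_real_eq_iff)
qed

end

section \<open>Bernstein--Szego approximation\<close>

text \<open>Trigonometric polynomials: multiplying by a power of \<open>z\<close> clears the
  negative exponents. Only values on the circle matter.\<close>

definition laurent :: "(complex \<Rightarrow> complex) \<Rightarrow> bool" where
  "laurent g \<longleftrightarrow> (\<exists>N P. \<forall>z. norm z = 1 \<longrightarrow> g z * z ^ N = poly P z)"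

lemma laurent_const: "laurent (\<lambda>_. c)"
  unfolding laurent_def by (rule exI[of _ 0], rule exI[of _ "[:c:]"]) simp

lemma laurent_add:
  assumes "laurent f" "laurent g"
  shows "laurent (\<lambda>z. f z + g z)"
proof -
  from assms(1) obtain N P where 1: "\<And>z. norm z = 1 \<Longrightarrow> f z * z ^ N = poly P z"
    unfolding laurent_def by blast
  from assms(2) obtain M Q where 2: "\<And>z. norm z = 1 \<Longrightarrow> g z * z ^ M = poly Q z"
    unfolding laurent_def by blast
  have "(f z + g z) * z ^ (N + M) = poly (P * monom 1 M + Q * monom 1 N) z" if "norm z = 1" for z
    unfolding poly_add poly_mult poly_monom 1[OF that, symmetric] 2[OF that, symmetric] by (simp add: power_add algebra_simps)
  then show ?thesis unfolding laurent_def by blast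
qed

lemma laurent_mult:
  assumes "laurent f" "laurent g"
  shows "laurent (\<lambda>z. f z * g z)"
proof -
  from assms(1) obtain N P where 1: "\<And>z. norm z = 1 \<Longrightarrow> f z * z ^ N = poly P z"
    unfolding laurent_def by blast
  from assms(2) obtain M Q where 2: "\<And>z. norm z = 1 \<Longrightarrow> g z * z ^ M = poly Q z"
    unfolding laurent_def by blast
  have "(f z * g z) * z ^ (N + M) = poly (P * Q) z" if "norm z = 1" for z
    unfolding poly_mult 1[OF that, symmetric] 2[OF that, symmetric] by (simp add: power_add mult_ac)
  then show ?thesis unfolding laurent_def by blast
qed

lemma laurent_id: "laurent (\<lambda>z. z)"
  unfolding laurent_def by (rule exI[of _ 0], rule exI[of _ "[:0, 1:]"]) simp

lemma laurent_cnj: "laurent (\<lambda>z. cnj z)"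
  unfolding laurent_def
  by (rule exI[of _ 1], rule exI[of _ "[:1:]"]) (simp add: mult.commute complex_norm_square[symmetric])

text \<open>A real linear form on the plane is a combination of \<open>z\<close> and
  \<open>cnj z\<close>, and both are trigonometric polynomials on the circle. Stone--Weierstrass
  thereby provides trigonometric approximations.\<close>

lemma laurent_real_polynomial_function:
  assumes "real_polynomial_function g"
  shows "laurent (\<lambda>z. of_real (g z))"
  using assms
proof (induction rule: real_polynomial_function.induct)
  case (linear f)
  interpret bounded_linear f by fact
  define c d :: complex where "c = of_real (f 1) / 2 - \<i> * of_real (f \<i>) / 2" and "d = of_real (f 1) / 2 + \<i> * of_real (f \<i>) / 2"
  have "(\<lambda>z. of_real (f z)) = (\<lambda>z. c * z + d * cnj z)"
  proof
    fix z
    have "z = Re z *\<^sub>R 1 + Im z *\<^sub>R \<i>" by (simp add: complex_eq_iff)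
    then have "f z = Re z * f 1 + Im z * f \<i>" by (metis add scaleR real_scaleR_def)
    then show "of_real (f z) = c * z + d * cnj z"
      unfolding c_def d_def by (simp add: complex_eq_iff algebra_simps)
  qed
  then show ?case
    by (simp only:) (intro laurent_add laurent_mult laurent_const laurent_id laurent_cnj)
next
  case (const c)
  show ?case by (rule laurent_const)
next
  case (add f g)
  then show ?case unfolding of_real_add by (intro laurent_add)
next
  case (mult f g)
  then show ?case unfolding of_real_mult by (intro laurent_mult)
qed

section \<open>The Bernstein--Szego weights and their moments\<close>

context circle_measure
begin

text \<open>The density of the Bernstein--Szego measure, which is
  \<open>1 / \<bar>\<phi>\<^sub>n\<bar>\<^sup>2\<close> for the orthonormal polynomial
  \<open>\<phi>\<^sub>n\<close>.\<close>

definition wn :: "nat \<Rightarrow> real \<Rightarrow> real" where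
  "wn n \<theta> = Nrm \<alpha> n / (norm (poly (Phi \<alpha> n) (cis \<theta>)))\<^sup>2"

definition F :: "nat \<Rightarrow> nat \<Rightarrow> complex poly \<Rightarrow> complex" where
  "F n k p = (\<integral>\<theta>. cnj (cis \<theta> ^ k) * poly p (cis \<theta>) * of_real (wn n \<theta>) \<partial>dtheta)"

lemma Phis_disk_nz:
  assumes "norm z \<le> 1"
  shows "poly (Phis \<alpha> n) z \<noteq> 0"
  using Phi_Phis_disk[of \<alpha>, OF norm_alpha assms] by blast

lemma Phi_circle_nz: "poly (Phi \<alpha> n) (cis \<theta>) \<noteq> 0"
proof -
  have "norm (poly (Phis \<alpha> n) (cis \<theta>)) \<noteq> 0" using Phis_disk_nz[of "cis \<theta>"] by simp
  then show ?thesis unfolding norm_Phis_circle[OF norm_cis] by simp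
qed

lemma wn_pos: "wn n \<theta> > 0"
  unfolding wn_def by (intro divide_pos_pos Nrm_pos[of \<alpha>, OF norm_alpha]) (simp add: Phi_circle_nz)

lemma continuous_poly_cis: "continuous_on UNIV (\<lambda>\<theta>. poly p (cis \<theta>))"
  by (rule cis_continuous_comp) (intro continuous_intros)

lemma continuous_wn: "continuous_on UNIV (wn n)"
  unfolding wn_def using Phi_circle_nz by (intro continuous_intros continuous_poly_cis) auto

lemma integrable_F: "integrable dtheta (\<lambda>\<theta>. cnj (cis \<theta> ^ k) * poly p (cis \<theta>) * of_real (wn n \<theta>))"
  by (intro integrable_dtheta continuous_intros continuous_poly_cis continuous_wn)

lemma moment_functional_F: "moment_functional (F n)"
proof
  fix k p q c
  show "F n k (p + q) = F n k p + F n k q"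
    unfolding F_def by (subst Bochner_Integration.integral_add[symmetric, OF integrable_F integrable_F]) (simp add: algebra_simps)
  show "F n k (smult c p) = c * F n k p"
    unfolding F_def by (subst integral_mult_right_zero[symmetric]) (simp add: algebra_simps)
  show "F n (Suc k) (pCons 0 p) = F n k p"
    unfolding F_def
  proof (rule Bochner_Integration.integral_cong[OF refl])
    fix \<theta>
    have "cnj (cis \<theta>) * cis \<theta> = 1" by (intro cnj_mult_circle) simp
    moreover have "cnj (cis \<theta> ^ Suc k) * poly (pCons 0 p) (cis \<theta>) * of_real (wn n \<theta>)
       = (cnj (cis \<theta>) * cis \<theta>) * (cnj (cis \<theta> ^ k) * poly p (cis \<theta>) * of_real (wn n \<theta>))"
      by simp
    ultimately show "cnj (cis \<theta> ^ Suc k) * poly (pCons 0 p) (cis \<theta>) * of_real (wn n \<theta>)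
       = cnj (cis \<theta> ^ k) * poly p (cis \<theta>) * of_real (wn n \<theta>)" by simp
  qed
qed

text \<open>One factor of the squared modulus cancels, and the conjugate of \<open>Phi\<close> that
  remains is \<open>Phis\<close> up to a power of \<open>z\<close>. What is left is the boundary
  value of an analytic function, so its moments follow from the mean value property.\<close>

lemma wn_Phi: "poly (Phi \<alpha> n) (cis \<theta>) * of_real (wn n \<theta>) = of_real (Nrm \<alpha> n) * (cis \<theta> ^ n * (1 / poly (Phis \<alpha> n) (cis \<theta>)))"
proof -
  define P where "P = poly (Phi \<alpha> n) (cis \<theta>)"
  have "P \<noteq> 0" using Phi_circle_nz by (simp add: P_def)
  moreover have "poly (Phis \<alpha> n) (cis \<theta>) = cis \<theta> ^ n * cnj P"
    unfolding P_def by (intro poly_Phis_circle) simp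
  moreover have "complex_of_real (wn n \<theta>) = of_real (Nrm \<alpha> n) / (P * cnj P)"
    unfolding wn_def P_def[symmetric] of_real_divide complex_norm_square by simp
  ultimately show ?thesis by (simp add: P_def[symmetric] field_simps)
qed

lemma wn_Phis: "poly (Phis \<alpha> n) (cis \<theta>) * of_real (wn n \<theta>) = of_real (Nrm \<alpha> n) * cnj (1 / poly (Phis \<alpha> n) (cis \<theta>))"
proof -
  define P where "P = poly (Phis \<alpha> n) (cis \<theta>)"
  have PP: "norm (poly (Phi \<alpha> n) (cis \<theta>)) = norm P" unfolding P_def by (simp add: norm_Phis_circle)
  then have "P \<noteq> 0" using Phi_circle_nz by auto
  moreover have "complex_of_real (wn n \<theta>) = of_real (Nrm \<alpha> n) / (P * cnj P)"
    unfolding wn_def PP of_real_divide complex_norm_square by simp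
  ultimately show ?thesis by (simp add: P_def[symmetric] field_simps)
qed

lemma inverse_Phis_analytic:
  "continuous_on (cball 0 1) (\<lambda>z. 1 / poly (Phis \<alpha> n) z)"
  "(\<lambda>z. 1 / poly (Phis \<alpha> n) z) holomorphic_on ball 0 1"
proof -
  have nz: "poly (Phis \<alpha> n) z \<noteq> 0" if "z \<in> cball 0 1" for z
    using Phis_disk_nz[of z] that by simp
  show "continuous_on (cball 0 1) (\<lambda>z. 1 / poly (Phis \<alpha> n) z)"
    by (rule continuous_on_divide) (use nz in \<open>auto intro: continuous_on_poly continuous_on_id\<close>)
  have "poly (Phis \<alpha> n) holomorphic_on ball 0 1"
    by (intro holomorphic_intros)
  then show "(\<lambda>z. 1 / poly (Phis \<alpha> n) z) holomorphic_on ball 0 1"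
    by (intro holomorphic_on_divide holomorphic_on_const) (use nz in auto)
qed

lemma F_Phi:
  assumes "k \<le> n"
  shows "F n k (Phi \<alpha> n) = (if k < n then 0 else of_real (Nrm \<alpha> n))"
proof -
  define Q where "Q z = 1 / poly (Phis \<alpha> n) z" for z
  have Q: "continuous_on (cball 0 1) Q" "Q holomorphic_on ball 0 1" "Q 0 = 1"
    using inverse_Phis_analytic[of n] by (simp_all add: Q_def[abs_def])
  have "F n k (Phi \<alpha> n) = (\<integral>\<theta>. of_real (Nrm \<alpha> n) * (cis \<theta> ^ (n - k) * Q (cis \<theta>)) \<partial>dtheta)"
    unfolding F_def
  proof (rule Bochner_Integration.integral_cong[OF refl])
    fix \<theta>
    have "cnj (cis \<theta> ^ k) * poly (Phi \<alpha> n) (cis \<theta>) * of_real (wn n \<theta>)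
       = cnj (cis \<theta> ^ k) * (of_real (Nrm \<alpha> n) * (cis \<theta> ^ n * Q (cis \<theta>)))"
      unfolding Q_def wn_Phi[symmetric] by (rule mult.assoc)
    also have "\<dots> = of_real (Nrm \<alpha> n) * ((cnj (cis \<theta> ^ k) * cis \<theta> ^ n) * Q (cis \<theta>))"
      by (simp only: mult_ac)
    also have "cnj (cis \<theta> ^ k) * cis \<theta> ^ n = cis \<theta> ^ (n - k)"
      by (rule cnj_power_mult_power[OF _ assms]) (rule norm_cis)
    finally show "cnj (cis \<theta> ^ k) * poly (Phi \<alpha> n) (cis \<theta>) * of_real (wn n \<theta>)
       = of_real (Nrm \<alpha> n) * (cis \<theta> ^ (n - k) * Q (cis \<theta>))" .
  qed
  also have "\<dots> = of_real (Nrm \<alpha> n) * (\<integral>\<theta>. cis \<theta> ^ (n - k) * Q (cis \<theta>) \<partial>dtheta)"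
    by simp
  also have "(\<integral>\<theta>. cis \<theta> ^ (n - k) * Q (cis \<theta>) \<partial>dtheta) = (if k < n then 0 else 1)"
  proof (cases "k < n")
    case True
    then show ?thesis using integral_cis_mult_power[OF Q(1,2), of "n - k"] by simp
  next
    case False
    then show ?thesis using integral_cis_mean_value[OF Q(1,2)] Q(3) by simp
  qed
  finally show ?thesis by simp
qed

lemma F_Phis:
  assumes "0 < k"
  shows "F n k (Phis \<alpha> n) = 0"
proof -
  have "F n k (Phis \<alpha> n) = (\<integral>\<theta>. of_real (Nrm \<alpha> n) * cnj (cis \<theta> ^ k * (1 / poly (Phis \<alpha> n) (cis \<theta>))) \<partial>dtheta)"
    unfolding F_def mult.assoc wn_Phis
    by (rule Bochner_Integration.integral_cong[OF refl]) (simp add: mult.left_commute)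
  also have "\<dots> = of_real (Nrm \<alpha> n) * cnj (\<integral>\<theta>. cis \<theta> ^ k * (1 / poly (Phis \<alpha> n) (cis \<theta>)) \<partial>dtheta)"
    unfolding Bochner_Integration.integral_cnj[symmetric] by (rule integral_mult_right_zero)
  also have "(\<integral>\<theta>. cis \<theta> ^ k * (1 / poly (Phis \<alpha> n) (cis \<theta>)) \<partial>dtheta) = 0"
    by (rule integral_cis_mult_power[OF inverse_Phis_analytic assms])
  finally show ?thesis by simp
qed

lemma F_orthogonal:
  assumes "j \<le> n"
  shows "(\<forall>k<j. F n k (Phi \<alpha> j) = 0) \<and> F n j (Phi \<alpha> j) = of_real (Nrm \<alpha> j)"
proof -
  interpret F: moment_functional "F n" by (rule moment_functional_F)
  have "(\<forall>k<j. F n k (Phi \<alpha> j) = 0) \<and> (\<forall>k. 0 < k \<longrightarrow> k \<le> j \<longrightarrow> F n k (Phis \<alpha> j) = 0)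
     \<and> F n j (Phi \<alpha> j) = of_real (Nrm \<alpha> j)"
    by (rule F.orthogonal_downward[of \<alpha>, OF norm_alpha assms]) (simp_all add: F_Phi F_Phis)
  then show ?thesis by blast
qed

lemma F_0_1: "F n 0 1 = 1"
  using F_orthogonal[of 0 n] by (simp add: Nrm_def)

lemma moments_BS_0:
  assumes "degree p \<le> n"
  shows "E 0 p = F n 0 p"
proof (rule E.moments_eq[OF moment_functional_F _ _ _ assms])
  show "E 0 (Phi \<alpha> j) = 0" if "0 < j" for j using orth_Phi[of j] that by blast
  show "F n 0 (Phi \<alpha> j) = 0" if "0 < j" "j \<le> n" for j using F_orthogonal[of j n] that by blast
qed (simp add: F_0_1)

lemma E_1: "E k 1 = cnj (E 0 (monom 1 k))"
  unfolding E_def Bochner_Integration.integral_cnj[symmetric] by (simp add: poly_monom)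

lemma F_1: "F n k 1 = cnj (F n 0 (monom 1 k))"
  unfolding F_def Bochner_Integration.integral_cnj[symmetric] by (simp add: poly_monom)

text \<open>Writing \<open>p\<close> as a constant plus \<open>z\<close> times \<open>q\<close>
  lowers \<open>k\<close> by the shift property. The constant contributes a negative moment, which
  is the conjugate of a positive one and so is covered by \<open>moments_BS_0\<close>.\<close>

lemma moments_BS:
  assumes "degree p \<le> n" "k \<le> n"
  shows "E k p = F n k p"
  using assms
proof (induction k arbitrary: p)
  case 0
  then show ?case by (intro moments_BS_0)
next
  case (Suc k)
  interpret F: moment_functional "F n" by (rule moment_functional_F)
  obtain a q where p: "p = pCons a q" by (rule pCons_cases)
  then have p': "p = smult a 1 + pCons 0 q" by (simp add: one_pCons)
  have "degree q \<le> n" using Suc.prems p by (auto simp: degree_pCons_eq_if split: if_splits)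
  then have "E k q = F n k q" using Suc by simp
  moreover have "E (Suc k) 1 = F n (Suc k) 1"
    unfolding E_1 F_1 using Suc.prems by (subst moments_BS_0[of _ n]) (auto simp: degree_monom_eq)
  ultimately show ?case unfolding p' E.add E.smult E.shift F.add F.smult F.shift by simp
qed

text \<open>A trigonometric polynomial involves finitely many moments, so the integrals agree
  exactly from some \<open>n\<close> on.\<close>

lemma laurent_integral_eq:
  assumes "laurent g"
  shows "\<forall>\<^sub>F n in sequentially. (\<integral>\<theta>. g (cis \<theta>) * of_real (wn n \<theta>) \<partial>dtheta) = (\<integral>z. g z \<partial>\<mu>)"
proof -
  obtain N P where P: "\<And>z. norm z = 1 \<Longrightarrow> g z * z ^ N = poly P z"
    using assms unfolding laurent_def by blast
  have g: "g z = cnj (z ^ N) * poly P z" if "norm z = 1" for z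
    using cnj_power_mult_power[OF that, of N N] P[OF that, symmetric] by (simp add: mult.left_commute)
  have 1: "(\<integral>z. g z \<partial>\<mu>) = E N P"
    unfolding E_def by (rule Bochner_Integration.integral_cong[OF refl]) (rule g, rule norm_circle)
  have 2: "(\<integral>\<theta>. g (cis \<theta>) * of_real (wn n \<theta>) \<partial>dtheta) = F n N P" for n
    unfolding F_def by (rule Bochner_Integration.integral_cong[OF refl]) (simp add: g)
  show ?thesis
    unfolding 1 2 using eventually_ge_at_top[of "max N (degree P)"]
    by eventually_elim (subst moments_BS, auto)
qed

lemma integral_wn: "(\<integral>\<theta>. wn n \<theta> \<partial>dtheta) = 1"
proof -
  have "of_real (\<integral>\<theta>. wn n \<theta> \<partial>dtheta) = F n 0 1" unfolding F_def by simp
  then show ?thesis by (simp add: F_0_1)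
qed

text \<open>Uniform approximation by a trigonometric polynomial costs \<open>e / 3\<close> on either
  side because both measures have mass one, and for the polynomial itself the integrals eventually
  coincide.\<close>

lemma BS_convergence:
  fixes h :: "complex \<Rightarrow> real"
  assumes "continuous_on (sphere 0 1) h"
  shows "(\<lambda>n. \<integral>\<theta>. h (cis \<theta>) * wn n \<theta> \<partial>dtheta) \<longlonglongrightarrow> (\<integral>z. h z \<partial>\<mu>)"
proof (rule tendstoI)
  fix e :: real assume "e > 0"
  obtain g where g: "real_polynomial_function g" and hg: "\<And>z. z \<in> sphere 0 1 \<Longrightarrow> \<bar>h z - g z\<bar> < e / 3"
    using Stone_Weierstrass_real_polynomial_function[OF _ assms, of "e / 3"] \<open>e > 0\<close> by auto
  have gc: "continuous_on (sphere 0 1) g"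
    using g continuous_on_polymonial_function real_polynomial_function_eq by blast
  note int = integrable_dtheta[OF continuous_on_mult[OF cis_continuous_comp continuous_wn]]
  have mu: "\<bar>(\<integral>z. h z \<partial>\<mu>) - (\<integral>z. g z \<partial>\<mu>)\<bar> \<le> e / 3"
  proof -
    have "\<bar>\<integral>z. h z - g z \<partial>\<mu>\<bar> \<le> (\<integral>z. \<bar>h z - g z\<bar> \<partial>\<mu>)" by (rule integral_abs_bound)
    also have "\<dots> \<le> (\<integral>z. e / 3 \<partial>\<mu>)"
      by (intro integral_mono integrable_circle continuous_intros assms gc) (use hg in \<open>auto simp: space_\<mu> intro: less_imp_le\<close>)
    finally show ?thesis using integrable_circle[OF assms] integrable_circle[OF gc] by (simp add: prob_space)
  qed
  have dt: "\<bar>(\<integral>\<theta>. h (cis \<theta>) * wn n \<theta> \<partial>dtheta) - (\<integral>\<theta>. g (cis \<theta>) * wn n \<theta> \<partial>dtheta)\<bar> \<le> e / 3" for n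
  proof -
    have "\<bar>\<integral>\<theta>. h (cis \<theta>) * wn n \<theta> - g (cis \<theta>) * wn n \<theta> \<partial>dtheta\<bar> \<le> (\<integral>\<theta>. \<bar>h (cis \<theta>) * wn n \<theta> - g (cis \<theta>) * wn n \<theta>\<bar> \<partial>dtheta)"
      by (rule integral_abs_bound)
    also have "\<dots> \<le> (\<integral>\<theta>. e / 3 * wn n \<theta> \<partial>dtheta)"
    proof (rule integral_mono)
      show "integrable dtheta (\<lambda>\<theta>. \<bar>h (cis \<theta>) * wn n \<theta> - g (cis \<theta>) * wn n \<theta>\<bar>)"
        by (rule integrable_abs, rule Bochner_Integration.integrable_diff, rule int[OF assms], rule int[OF gc])
      show "integrable dtheta (\<lambda>\<theta>. e / 3 * wn n \<theta>)"
        by (intro integrable_mult_right integrable_dtheta continuous_wn)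
      fix \<theta>
      have "\<bar>h (cis \<theta>) * wn n \<theta> - g (cis \<theta>) * wn n \<theta>\<bar> = \<bar>h (cis \<theta>) - g (cis \<theta>)\<bar> * wn n \<theta>"
        using wn_pos[of n \<theta>] by (simp add: abs_mult flip: left_diff_distrib)
      also have "\<dots> \<le> e / 3 * wn n \<theta>"
        using hg[of "cis \<theta>"] wn_pos[of n \<theta>] by (intro mult_right_mono) auto
      finally show "\<bar>h (cis \<theta>) * wn n \<theta> - g (cis \<theta>) * wn n \<theta>\<bar> \<le> e / 3 * wn n \<theta>" .
    qed
    finally show ?thesis using int[OF assms, of n] int[OF gc, of n] by (simp add: integral_wn)
  qed
  have "\<forall>\<^sub>F n in sequentially. (\<integral>\<theta>. g (cis \<theta>) * wn n \<theta> \<partial>dtheta) = (\<integral>z. g z \<partial>\<mu>)"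
    using laurent_integral_eq[OF laurent_real_polynomial_function[OF g]]
    unfolding of_real_mult[symmetric] integral_complex_of_real of_real_eq_iff .
  then show "\<forall>\<^sub>F n in sequentially. dist (\<integral>\<theta>. h (cis \<theta>) * wn n \<theta> \<partial>dtheta) (\<integral>z. h z \<partial>\<mu>) < e"
  proof eventually_elim
    case (elim n)
    then show ?case using mu dt[of n] \<open>e > 0\<close> unfolding dist_real_def by linarith
  qed
qed

end

section \<open>Approximating Borel functions by continuous ones\<close>

text \<open>Lifts the Lebesgue decomposition, which is given on sets, to nonnegative integrals by
  the usual induction over simple functions and monotone limits.\<close>

lemma nn_integral_add_measure:
  assumes sets: "sets A = sets M" "sets B = sets M"
    and eq: "\<And>X. X \<in> sets M \<Longrightarrow> emeasure M X = emeasure A X + emeasure B X"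
    and f: "f \<in> borel_measurable M"
  shows "(\<integral>\<^sup>+x. f x \<partial>M) = (\<integral>\<^sup>+x. f x \<partial>A) + (\<integral>\<^sup>+x. f x \<partial>B)"
proof -
  have meas: "borel_measurable A = borel_measurable M" "borel_measurable B = borel_measurable M"
    by (rule measurable_cong_sets[OF sets(1) refl], rule measurable_cong_sets[OF sets(2) refl])
  show ?thesis
    using f
  proof (induction rule: borel_measurable_induct)
    case (cong f g)
    have "integral\<^sup>N N f = integral\<^sup>N N g" if "space N = space M" for N
      by (rule nn_integral_cong) (simp add: cong that)
    from this[OF refl] this[OF sets_eq_imp_space_eq[OF sets(1)]] this[OF sets_eq_imp_space_eq[OF sets(2)]]
    show ?case using cong by simp
  next
    case (set X)
    then show ?case by (simp add: sets eq)
  next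
    case (mult u c)
    have *: "u \<in> borel_measurable A" "u \<in> borel_measurable B"
      using \<open>u \<in> borel_measurable M\<close> meas by auto
    show ?case
      using \<open>u \<in> borel_measurable M\<close> * mult.IH by (simp only: nn_integral_cmult distrib_left)
  next
    case (add u v)
    have *: "u \<in> borel_measurable A" "u \<in> borel_measurable B" "v \<in> borel_measurable A" "v \<in> borel_measurable B"
      using \<open>u \<in> borel_measurable M\<close> \<open>v \<in> borel_measurable M\<close> meas by auto
    have "(\<integral>\<^sup>+x. v x + u x \<partial>M) = integral\<^sup>N M v + integral\<^sup>N M u"
      using \<open>u \<in> borel_measurable M\<close> \<open>v \<in> borel_measurable M\<close> by (intro nn_integral_add)
    also have "\<dots> = (integral\<^sup>N A v + integral\<^sup>N B v) + (integral\<^sup>N A u + integral\<^sup>N B u)"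
      by (simp only: add.IH)
    also have "\<dots> = (integral\<^sup>N A v + integral\<^sup>N A u) + (integral\<^sup>N B v + integral\<^sup>N B u)"
      by (simp only: add_ac)
    finally show ?case by (simp only: nn_integral_add *)
  next
    case (seq U)
    have UM: "U i \<in> borel_measurable M" for i using seq.hyps by blast
    then have U: "U i \<in> borel_measurable A" "U i \<in> borel_measurable B" for i
      using meas by auto
    have inc: "incseq (\<lambda>i. integral\<^sup>N N (U i))" for N
      using \<open>incseq U\<close> by (auto simp: incseq_def le_fun_def intro!: nn_integral_mono)
    have "(\<integral>\<^sup>+x. (SUP i. U i) x \<partial>M) = (SUP i. integral\<^sup>N M (U i))"
      unfolding SUP_apply by (rule nn_integral_monotone_convergence_SUP[OF \<open>incseq U\<close> UM])
    also have "\<dots> = (SUP i. integral\<^sup>N A (U i) + integral\<^sup>N B (U i))"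
      by (simp only: seq.IH)
    also have "\<dots> = (SUP i. integral\<^sup>N A (U i)) + (SUP i. integral\<^sup>N B (U i))"
      by (rule ennreal_SUP_add[OF inc inc])
    also have "(SUP i. integral\<^sup>N A (U i)) = (\<integral>\<^sup>+x. (SUP i. U i) x \<partial>A)"
      unfolding SUP_apply by (rule nn_integral_monotone_convergence_SUP[OF \<open>incseq U\<close> U(1), symmetric])
    also have "(SUP i. integral\<^sup>N B (U i)) = (\<integral>\<^sup>+x. (SUP i. U i) x \<partial>B)"
      unfolding SUP_apply by (rule nn_integral_monotone_convergence_SUP[OF \<open>incseq U\<close> U(2), symmetric])
    finally show ?case .
  qed
qed

text \<open>Inner and outer regularity, each used with error \<open>e / 2\<close>.\<close>

lemma regular_sandwich:
  fixes M :: "'a::euclidean_space measure"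
  assumes "prob_space M" and sets: "sets M = sets borel" and "B \<in> sets borel" and "0 < e"
  obtains K U where "compact K" "open U" "K \<subseteq> B" "B \<subseteq> U" "measure M (U - K) \<le> e"
proof -
  interpret prob_space M by fact
  have fin: "emeasure M (space M) \<noteq> \<infinity>" by (simp add: emeasure_space_1)
  have Bfin: "emeasure M B \<noteq> \<infinity>" by (simp add: emeasure_finite)
  have e: "0 < e / 2" using \<open>0 < e\<close> by simp
  obtain K where K: "K \<subseteq> B" "compact K" and MK: "emeasure M B < emeasure M K + ennreal (e / 2)"
    using SUP_approx_ennreal[OF e _ inner_regular[OF sets fin \<open>B \<in> sets borel\<close>] Bfin] by fastforce
  obtain U where U: "B \<subseteq> U" "open U" and MU: "emeasure M U < emeasure M B + ennreal (e / 2)"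
    using INF_approx_ennreal[OF e outer_regular[OF sets fin \<open>B \<in> sets borel\<close>]] Bfin by fastforce
  have KU: "K \<in> sets M" "U \<in> sets M" using K U by (auto simp: sets borel_compact)
  have "measure M B < measure M K + e / 2"
    using MK e unfolding emeasure_eq_measure by (simp flip: ennreal_plus add: ennreal_less_iff)
  moreover have "measure M U < measure M B + e / 2"
    using MU e unfolding emeasure_eq_measure by (simp flip: ennreal_plus add: ennreal_less_iff)
  moreover have "measure M (U - K) = measure M U - measure M K"
    using KU K U by (intro finite_measure_Diff) auto
  ultimately show ?thesis using K U that[of K U] by linarith
qed

lemma continuous_approx_indicator:
  fixes M1 M2 :: "'a::euclidean_space measure"
  assumes M1: "prob_space M1" "sets M1 = sets borel" and M2: "prob_space M2" "sets M2 = sets borel"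
    and B: "B \<in> sets borel" and "0 < e"
  shows "\<exists>h::'a \<Rightarrow> real. continuous_on UNIV h \<and> (\<forall>z. 0 \<le> h z \<and> h z \<le> 1) \<and>
     (\<integral>z. \<bar>h z - indicator B z\<bar> \<partial>M1) \<le> e \<and> (\<integral>z. \<bar>h z - indicator B z\<bar> \<partial>M2) \<le> e"
proof -
  obtain K1 U1 where 1: "compact K1" "open U1" "K1 \<subseteq> B" "B \<subseteq> U1" "measure M1 (U1 - K1) \<le> e"
    using regular_sandwich[OF M1 B \<open>0 < e\<close>] by blast
  obtain K2 U2 where 2: "compact K2" "open U2" "K2 \<subseteq> B" "B \<subseteq> U2" "measure M2 (U2 - K2) \<le> e"
    using regular_sandwich[OF M2 B \<open>0 < e\<close>] by blast
  \<comment> \<open>One compact and one open set that work for both measures. The Urysohn function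
    between them can differ from the indicator only on \<open>U - K\<close>.\<close>
  define K U where "K = K1 \<union> K2" and "U = U1 \<inter> U2"
  have KU: "compact K" "open U" "K \<subseteq> B" "B \<subseteq> U" using 1 2 by (auto simp: K_def U_def)
  have "closed K" "closed (- U)" "K \<inter> (- U) = {}" using KU by (auto simp: compact_imp_closed)
  then obtain h :: "'a \<Rightarrow> real" where h: "continuous_on UNIV h" "\<And>x. h x \<in> closed_segment 1 0"
    "\<And>x. x \<in> K \<Longrightarrow> h x = 1" "\<And>x. x \<in> - U \<Longrightarrow> h x = 0"
    using Urysohn[of K "- U" "1::real" 0] by metis
  have h01: "0 \<le> h z" "h z \<le> 1" for z
    using h(2)[of z] by (auto simp: closed_segment_eq_real_ivl)
  have bound: "(\<integral>z. \<bar>h z - indicator B z\<bar> \<partial>M) \<le> e"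
    if M: "prob_space M" "sets M = sets borel" and m: "measure M (V - L) \<le> e"
      and VL: "compact L" "open V" "U \<subseteq> V" "L \<subseteq> K" for M V L
  proof -
    interpret prob_space M by fact
    have VLs: "V - L \<in> sets M" using VL by (auto simp: M borel_compact)
    have meas: "h \<in> borel_measurable M" "indicator B \<in> borel_measurable M"
      using borel_measurable_continuous_onI[OF h(1)] B by (auto simp: M measurable_cong_sets[OF M(2) refl])
    have pt: "\<bar>h z - indicator B z\<bar> \<le> indicator (V - L) z" for z
      using h01[of z] h(3)[of z] h(4)[of z] KU VL by (auto simp: indicator_def)
    have "(\<integral>z. \<bar>h z - indicator B z\<bar> \<partial>M) \<le> (\<integral>z. indicator (V - L) z \<partial>M)"
    proof (rule integral_mono)
      show "integrable M (\<lambda>z. indicator (V - L) z :: real)"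
      proof (rule integrable_const_bound[of _ 1])
        show "AE z in M. norm (indicator (V - L) z :: real) \<le> 1"
          by (rule AE_I2) (simp add: indicator_def)
      qed (use VLs in measurable)
      show "integrable M (\<lambda>z. \<bar>h z - indicator B z\<bar>)"
      proof (rule integrable_const_bound[of _ 1])
        show "AE z in M. norm \<bar>h z - indicator B z\<bar> \<le> 1"
          using h01 by (intro AE_I2) (auto simp: indicator_def)
      qed (use meas in measurable)
    qed (rule pt)
    also have "\<dots> = measure M (V - L)" using VLs by simp
    finally show ?thesis using m by linarith
  qed
  have "(\<integral>z. \<bar>h z - indicator B z\<bar> \<partial>M1) \<le> e"
    by (rule bound[OF M1 1(5) 1(1,2)]) (auto simp: K_def U_def)
  moreover have "(\<integral>z. \<bar>h z - indicator B z\<bar> \<partial>M2) \<le> e"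
    by (rule bound[OF M2 2(5) 2(1,2)]) (auto simp: K_def U_def)
  ultimately show ?thesis using h(1) h01 by blast
qed

text \<open>The sum is \<open>d\<close> times the number of levels among
  \<open>d, 2 d, \<dots>, n d\<close> that do not exceed \<open>v\<close>; for positive
  \<open>d\<close> this rounds \<open>v\<close> down to a multiple of \<open>d\<close>.\<close>

lemma staircase:
  fixes v d :: real
  assumes "0 \<le> d" "0 \<le> v" "v \<le> real n * d"
  shows "\<bar>v - (\<Sum>i<n. d * (if real (Suc i) * d \<le> v then 1 else 0))\<bar> \<le> d"
proof -
  have full: "(\<Sum>i<m. d * (if real (Suc i) * d \<le> v then 1 else 0)) = real m * d" if "real m * d \<le> v" for m
  proof -
    have "real (Suc i) * d \<le> v" if "i < m" for i
    proof -
      have "real (Suc i) * d \<le> real m * d" using that assms(1) by (intro mult_right_mono) auto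
      then show ?thesis using \<open>real m * d \<le> v\<close> by linarith
    qed
    then have "(\<Sum>i<m. d * (if real (Suc i) * d \<le> v then 1 else 0)) = (\<Sum>i<m. d)"
      by (intro sum.cong) auto
    then show ?thesis by simp
  qed
  show ?thesis using assms(3)
  proof (induction n)
    case 0
    then show ?case using assms by simp
  next
    case (Suc n)
    show ?case
    proof (cases "real (Suc n) * d \<le> v")
      case True
      then show ?thesis using Suc.prems full[of "Suc n"] assms by simp
    next
      case False
      then have eq: "(\<Sum>i<Suc n. d * (if real (Suc i) * d \<le> v then 1 else 0)) = (\<Sum>i<n. d * (if real (Suc i) * d \<le> v then 1 else 0))"
        by simp
      show ?thesis
      proof (cases "v \<le> real n * d")
        case True
        then show ?thesis unfolding eq by (rule Suc.IH)
      next
        case F: False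
        then have "(\<Sum>i<n. d * (if real (Suc i) * d \<le> v then 1 else 0)) = real n * d"
          by (intro full) simp
        then show ?thesis unfolding eq using F False by (simp add: algebra_simps abs_le_iff)
      qed
    qed
  qed
qed

text \<open>The staircase writes \<open>k\<close>, up to \<open>d\<close>, as a combination of
  indicators of superlevel sets, and each indicator is replaced by a continuous function that is
  close to it in both measures.\<close>

lemma continuous_approx_borel:
  fixes M1 M2 :: "'a::euclidean_space measure" and k :: "'a \<Rightarrow> real"
  assumes M1: "prob_space M1" "sets M1 = sets borel" and M2: "prob_space M2" "sets M2 = sets borel"
    and k: "k \<in> borel_measurable borel" "\<And>z. 1 \<le> k z" "\<And>z. k z \<le> C" and "0 < e"
  obtains h :: "'a \<Rightarrow> real" where "continuous_on UNIV h" "\<And>z. 1 \<le> h z" "\<And>z. h z \<le> C"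
    "(\<integral>z. \<bar>h z - k z\<bar> \<partial>M1) \<le> e" "(\<integral>z. \<bar>h z - k z\<bar> \<partial>M2) \<le> e"
proof -
  \<comment> \<open>Half of the error is left to the staircase, the other half to the
    \<open>n\<close> indicators.\<close>
  define d where "d = e / 2"
  have d: "0 < d" using \<open>0 < e\<close> by (simp add: d_def)
  obtain n :: nat where n: "C / d \<le> real n" using real_arch_simple by blast
  then have n: "C \<le> real n * d" using d by (simp add: field_simps)
  \<comment> \<open>Chosen so that \<open>n * d * r \<le> d\<close>; the added 1 keeps the
    denominator positive.\<close>
  define r where "r = d / (real n * d + 1)"
  have nd: "0 \<le> real n * d" using d by simp
  have r: "0 < r" unfolding r_def using nd d by (intro divide_pos_pos) linarith+
  have rn: "real n * d * r \<le> d"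
  proof -
    have x_le: "x / (x + 1) \<le> 1" if "0 \<le> x" for x :: real using that by simp
    have "real n * d * r = d * (real n * d / (real n * d + 1))" by (simp add: r_def)
    also have "\<dots> \<le> d * 1" using x_le[OF nd] d by (intro mult_left_mono) auto
    finally show ?thesis by simp
  qed
  define S where "S i = {z. real (Suc i) * d \<le> k z}" for i
  have S: "S i \<in> sets borel" for i unfolding S_def using k(1) by measurable
  have "\<forall>i. \<exists>h::'a \<Rightarrow> real. continuous_on UNIV h \<and> (\<forall>z. 0 \<le> h z \<and> h z \<le> 1) \<and>
     (\<integral>z. \<bar>h z - indicator (S i) z\<bar> \<partial>M1) \<le> r \<and> (\<integral>z. \<bar>h z - indicator (S i) z\<bar> \<partial>M2) \<le> r"
    using continuous_approx_indicator[OF M1 M2 S r] by blast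
  then obtain g :: "nat \<Rightarrow> 'a \<Rightarrow> real" where g: "\<And>i. continuous_on UNIV (g i)" "\<And>i z. 0 \<le> g i z" "\<And>i z. g i z \<le> 1"
     and g1: "\<And>i. (\<integral>z. \<bar>g i z - indicator (S i) z\<bar> \<partial>M1) \<le> r"
     and g2: "\<And>i. (\<integral>z. \<bar>g i z - indicator (S i) z\<bar> \<partial>M2) \<le> r"
    by metis
  \<comment> \<open>Clamping to the range from 1 to \<open>C\<close> cannot increase the distance to
    \<open>k\<close>, whose values lie there.\<close>
  define h where "h z = min C (max 1 (\<Sum>i<n. d * g i z))" for z
  have C1: "1 \<le> C" using k(2,3) order_trans by blast
  have hc: "continuous_on UNIV h" unfolding h_def by (intro continuous_intros g)
  have pt: "\<bar>h z - k z\<bar> \<le> d + (\<Sum>i<n. d * \<bar>g i z - indicator (S i) z\<bar>)" for z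
  proof -
    have "\<bar>h z - k z\<bar> \<le> \<bar>(\<Sum>i<n. d * g i z) - k z\<bar>"
      unfolding h_def using k(2,3)[of z] by (auto simp: min_def max_def)
    also have "\<dots> \<le> \<bar>k z - (\<Sum>i<n. d * indicator (S i) z)\<bar> + \<bar>(\<Sum>i<n. d * g i z) - (\<Sum>i<n. d * indicator (S i) z)\<bar>"
      by linarith
    also have "(\<Sum>i<n. d * indicator (S i) z) = (\<Sum>i<n. d * (if real (Suc i) * d \<le> k z then 1 else 0))"
      by (intro sum.cong) (auto simp: S_def indicator_def)
    also have "\<bar>k z - \<dots>\<bar> \<le> d"
      by (rule staircase) (use d k(2,3)[of z] n in linarith)+
    also have "\<bar>(\<Sum>i<n. d * g i z) - (\<Sum>i<n. d * (if real (Suc i) * d \<le> k z then 1 else 0))\<bar>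
       = \<bar>\<Sum>i<n. d * (g i z - indicator (S i) z)\<bar>"
      unfolding sum_subtractf[symmetric]
      by (intro arg_cong[where f=abs] sum.cong) (auto simp: S_def indicator_def algebra_simps)
    also have "\<dots> \<le> (\<Sum>i<n. \<bar>d * (g i z - indicator (S i) z)\<bar>)" by (rule sum_abs)
    also have "\<dots> = (\<Sum>i<n. d * \<bar>g i z - indicator (S i) z\<bar>)" using d by (simp add: abs_mult)
    finally show ?thesis by simp
  qed
  have bound: "(\<integral>z. \<bar>h z - k z\<bar> \<partial>M) \<le> e"
    if M: "prob_space M" "sets M = sets borel" and gM: "\<And>i. (\<integral>z. \<bar>g i z - indicator (S i) z\<bar> \<partial>M) \<le> r" for M
  proof -
    interpret prob_space M by fact
    have meas: "h \<in> borel_measurable M" "k \<in> borel_measurable M" "g i \<in> borel_measurable M"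
       "indicator (S i) \<in> borel_measurable M" for i
      unfolding measurable_cong_sets[OF M(2) refl]
      using borel_measurable_continuous_onI[OF hc] borel_measurable_continuous_onI[OF g(1)] k(1) S by auto
    have int_g: "integrable M (\<lambda>z. \<bar>g i z - indicator (S i) z\<bar>)" for i
    proof (rule integrable_const_bound[of _ 1])
      show "AE z in M. norm \<bar>g i z - indicator (S i) z\<bar> \<le> 1"
        using g(2,3) by (intro AE_I2) (auto simp: indicator_def)
    qed (use meas in measurable)
    have "(\<integral>z. \<bar>h z - k z\<bar> \<partial>M) \<le> (\<integral>z. d + (\<Sum>i<n. d * \<bar>g i z - indicator (S i) z\<bar>) \<partial>M)"
    proof (rule integral_mono)
      show "integrable M (\<lambda>z. \<bar>h z - k z\<bar>)"
      proof (rule integrable_const_bound[of _ C])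
        show "AE z in M. norm \<bar>h z - k z\<bar> \<le> C"
        proof (rule AE_I2)
          fix z
          show "norm \<bar>h z - k z\<bar> \<le> C" unfolding h_def using k(2,3)[of z] C1 by (simp add: abs_le_iff min_def max_def)
        qed
      qed (use meas in measurable)
      show "integrable M (\<lambda>z. d + (\<Sum>i<n. d * \<bar>g i z - indicator (S i) z\<bar>))"
        by (intro Bochner_Integration.integrable_add Bochner_Integration.integrable_sum integrable_mult_right int_g) simp
    qed (rule pt)
    also have "\<dots> = d + (\<Sum>i<n. d * (\<integral>z. \<bar>g i z - indicator (S i) z\<bar> \<partial>M))"
      by (simp add: int_g prob_space)
    also have "\<dots> \<le> d + (\<Sum>i<n. d * r)"
      using gM d by (intro add_left_mono sum_mono mult_left_mono) auto
    also have "\<dots> \<le> e" using rn by (simp add: d_def algebra_simps)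
    finally show ?thesis .
  qed
  show ?thesis
  proof
    show "continuous_on UNIV h" by (rule hc)
    show "1 \<le> h z" "h z \<le> C" for z using C1 by (auto simp: h_def)
  qed (rule bound[OF M1 g1] bound[OF M2 g2])+
qed

section \<open>The entropy integral\<close>

text \<open>In \<open>ereal\<close> the product of 0 and \<open>-\<infinity>\<close> is 0, so a zero
  of the density costs nothing where the weight vanishes and infinitely much elsewhere. In the last
  branch \<open>ennreal\<close> cuts negative values off at 0.\<close>

lemma ext_ln_neg_part:
  assumes "0 \<le> a"
  shows "e2ennreal (- (ereal a * ext_ln x)) =
    (if x \<le> 0 then if a = 0 then 0 else top else ennreal (- (a * ln x)))"
  using assms by (auto simp: ext_ln_def zero_ereal_def[symmetric])

text \<open>Since \<open>ln x \<le> x - 1\<close>, the positive part of the entropy integrand is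
  dominated by the integrable density.\<close>

lemma ext_ln_pos_part:
  assumes "0 \<le> a" "a \<le> 1"
  shows "e2ennreal (ereal a * ext_ln x) \<le> ennreal x"
proof (cases "x \<le> 0")
  case True
  then show ?thesis using assms by (cases "a = 0") (auto simp: ext_ln_def zero_ereal_def[symmetric] e2ennreal_neg)
next
  case False
  have "a * ln x \<le> x"
  proof (cases "ln x \<ge> 0")
    case True
    then have "a * ln x \<le> 1 * ln x" using assms by (intro mult_right_mono) auto
    also have "\<dots> \<le> x" using ln_le_minus_one[of x] False by simp
    finally show ?thesis .
  next
    case F: False
    then have "a * ln x \<le> 0" using assms by (simp add: mult_nonneg_nonpos)
    then show ?thesis using False by simp
  qed
  then show ?thesis using False by (simp add: ext_ln_def ennreal_leI)
qed

lemma entropy_weight: "(1 - cos \<theta>)\<^sup>2 * (1 + cos \<theta>)\<^sup>2 = sin \<theta> ^ 4" for \<theta> :: real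
proof -
  have "(1 - cos \<theta>)\<^sup>2 * (1 + cos \<theta>)\<^sup>2 = (1 - (cos \<theta>)\<^sup>2)\<^sup>2"
    by (simp add: power2_eq_square algebra_simps)
  also have "1 - (cos \<theta>)\<^sup>2 = (sin \<theta>)\<^sup>2" by (simp add: sin_squared_eq)
  finally show ?thesis by simp
qed

lemma sin4: "0 \<le> sin \<theta> ^ 4" "sin \<theta> ^ 4 \<le> 1" for \<theta> :: real
proof -
  have "\<bar>sin \<theta>\<bar> ^ 4 \<le> 1" by (rule power_le_one) auto
  then show "sin \<theta> ^ 4 \<le> 1" by simp
qed simp

text \<open>This is \<open>Arg2pi\<close>, which vanishes on the nonnegative reals; in this form, continuity off them
  yields Borel measurability.\<close>
definition circle_angle :: "complex \<Rightarrow> real" where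
  "circle_angle z = indicator (- \<real>\<^sub>\<ge>\<^sub>0) z *\<^sub>R Arg2pi z"

lemma circle_angle_measurable [measurable]: "circle_angle \<in> borel_measurable borel"
  unfolding circle_angle_def[abs_def]
proof (rule borel_measurable_continuous_on_indicator)
  show "- \<real>\<^sub>\<ge>\<^sub>0 \<in> sets (borel :: complex measure)"
    by (intro borel_open open_Compl closed_nonneg_Reals_complex)
  show "continuous_on (- \<real>\<^sub>\<ge>\<^sub>0) Arg2pi"
    by (intro continuous_at_imp_continuous_on ballI continuous_at_Arg2pi) simp
qed

lemma circle_angle_cis:
  assumes "0 \<le> \<theta>" "\<theta> < 2 * pi"
  shows "circle_angle (cis \<theta>) = \<theta>"
proof -
  have A: "Arg2pi (cis \<theta>) = \<theta>"
    by (rule Arg2pi_unique[of 1]) (use assms in \<open>auto simp: cis_conv_exp\<close>)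
  show ?thesis
  proof (cases "cis \<theta> \<in> \<real>\<^sub>\<ge>\<^sub>0")
    case True
    then have "Arg2pi (cis \<theta>) = 0" by (simp add: Arg2pi_eq_0 complex_nonneg_Reals_iff complex_is_Real_iff)
    then show ?thesis using A True by (simp add: circle_angle_def)
  next
    case False
    then show ?thesis using A by (simp add: circle_angle_def)
  qed
qed

section \<open>Consequences of an upper bound for \<open>D\<close>\<close>

context circle_measure
begin

definition D :: "nat \<Rightarrow> real" where
  "D n = (\<integral>\<theta>. sin \<theta> ^ 4 * ln (1 / wn n \<theta>) \<partial>dtheta)"

lemma continuous_ln_wn: "continuous_on UNIV (\<lambda>\<theta>. sin \<theta> ^ 4 * ln (1 / wn n \<theta>))"
proof -
  have "1 / wn n \<theta> \<noteq> 0" "wn n \<theta> \<noteq> 0" for \<theta> using wn_pos[of n \<theta>] by auto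
  then show ?thesis by (intro continuous_intros continuous_wn) auto
qed

text \<open>The inequality \<open>ln t \<le> t - 1\<close> for \<open>t = h * wn n\<close> gives
  \<open>1 + ln h \<le> h * wn n + ln (1 / wn n)\<close>. Integrated against
  \<open>sin \<theta> ^ 4\<close>, the last term becomes \<open>D n \<le> C\<close>, and the term
  with \<open>wn n\<close> converges to a \<open>\<mu>\<close>-integral because
  \<open>Im (cis \<theta>) = sin \<theta>\<close>.\<close>

lemma entropy_bound_continuous:
  fixes h :: "complex \<Rightarrow> real"
  assumes C: "\<And>n. D n \<le> C" and h: "continuous_on UNIV h" "\<And>z. 1 \<le> h z"
  shows "- C \<le> (\<integral>z. Im z ^ 4 * h z \<partial>\<mu>) - (\<integral>\<theta>. sin \<theta> ^ 4 * (1 + ln (h (cis \<theta>))) \<partial>dtheta)"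
proof -
  have hc: "continuous_on UNIV (\<lambda>\<theta>. h (cis \<theta>))"
    by (rule cis_continuous_comp) (rule continuous_on_subset[OF h(1)], simp)
  have h0: "h z \<noteq> 0" for z using h(2)[of z] by auto
  have c2: "continuous_on UNIV (\<lambda>\<theta>. sin \<theta> ^ 4 * (1 + ln (h (cis \<theta>))))"
    by (intro continuous_intros hc) (simp add: h0)
  have "(\<lambda>n. \<integral>\<theta>. (\<lambda>z. Im z ^ 4 * h z) (cis \<theta>) * wn n \<theta> \<partial>dtheta) \<longlonglongrightarrow> (\<integral>z. (\<lambda>z. Im z ^ 4 * h z) z \<partial>\<mu>)"
    by (rule BS_convergence) (intro continuous_intros continuous_on_subset[OF h(1)], simp)
  then have lim: "(\<lambda>n. (\<integral>\<theta>. sin \<theta> ^ 4 * h (cis \<theta>) * wn n \<theta> \<partial>dtheta) - (\<integral>\<theta>. sin \<theta> ^ 4 * (1 + ln (h (cis \<theta>))) \<partial>dtheta))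
      \<longlonglongrightarrow> (\<integral>z. Im z ^ 4 * h z \<partial>\<mu>) - (\<integral>\<theta>. sin \<theta> ^ 4 * (1 + ln (h (cis \<theta>))) \<partial>dtheta)"
    by (intro tendsto_intros) simp
  have "- C \<le> (\<integral>\<theta>. sin \<theta> ^ 4 * h (cis \<theta>) * wn n \<theta> \<partial>dtheta) - (\<integral>\<theta>. sin \<theta> ^ 4 * (1 + ln (h (cis \<theta>))) \<partial>dtheta)" for n
  proof -
    have c1: "continuous_on UNIV (\<lambda>\<theta>. sin \<theta> ^ 4 * h (cis \<theta>) * wn n \<theta>)"
      by (intro continuous_intros hc continuous_wn)
    have "(\<integral>\<theta>. sin \<theta> ^ 4 * (1 + ln (h (cis \<theta>))) \<partial>dtheta) \<le> (\<integral>\<theta>. sin \<theta> ^ 4 * h (cis \<theta>) * wn n \<theta> + sin \<theta> ^ 4 * ln (1 / wn n \<theta>) \<partial>dtheta)"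
    proof (rule integral_mono)
      show "integrable dtheta (\<lambda>\<theta>. sin \<theta> ^ 4 * (1 + ln (h (cis \<theta>))))" by (rule integrable_dtheta[OF c2])
      show "integrable dtheta (\<lambda>\<theta>. sin \<theta> ^ 4 * h (cis \<theta>) * wn n \<theta> + sin \<theta> ^ 4 * ln (1 / wn n \<theta>))"
        by (rule Bochner_Integration.integrable_add[OF integrable_dtheta[OF c1] integrable_dtheta[OF continuous_ln_wn]])
      fix \<theta>
      have hp: "h (cis \<theta>) > 0" using h(2)[of "cis \<theta>"] by linarith
      have "ln (h (cis \<theta>) * wn n \<theta>) \<le> h (cis \<theta>) * wn n \<theta> - 1"
        using hp wn_pos[of n \<theta>] by (intro ln_le_minus_one) simp
      moreover have "ln (h (cis \<theta>) * wn n \<theta>) = ln (h (cis \<theta>)) + ln (wn n \<theta>)"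
        using hp wn_pos[of n \<theta>] by (simp add: ln_mult)
      moreover have "ln (1 / wn n \<theta>) = - ln (wn n \<theta>)" using wn_pos[of n \<theta>] by (simp add: ln_div)
      ultimately have "1 + ln (h (cis \<theta>)) \<le> h (cis \<theta>) * wn n \<theta> + ln (1 / wn n \<theta>)" by linarith
      from mult_left_mono[OF this sin4(1)[of \<theta>]]
      show "sin \<theta> ^ 4 * (1 + ln (h (cis \<theta>))) \<le> sin \<theta> ^ 4 * h (cis \<theta>) * wn n \<theta> + sin \<theta> ^ 4 * ln (1 / wn n \<theta>)"
        by (simp only: distrib_left mult.assoc)
    qed
    also have "\<dots> = (\<integral>\<theta>. sin \<theta> ^ 4 * h (cis \<theta>) * wn n \<theta> \<partial>dtheta) + D n"
      unfolding D_def by (rule Bochner_Integration.integral_add[OF integrable_dtheta[OF c1] integrable_dtheta[OF continuous_ln_wn]])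
    finally show ?thesis using C[of n] by linarith
  qed
  then show ?thesis by (intro LIMSEQ_le_const[OF lim]) blast
qed

lemma measurable_id_\<mu>: "(\<lambda>z. z) \<in> measurable \<mu> borel"
  by (rule measurable_circle) simp

text \<open>Approximates \<open>k\<close> by a continuous function in the mean for
  \<open>\<mu>\<close> and for \<open>dtheta\<close> at once. Each of the two integrals moves by at
  most \<open>e / 2\<close>: the weights are at most 1, and \<open>ln\<close> is Lipschitz with
  constant 1 on the values that occur.\<close>

lemma entropy_bound_borel:
  fixes k :: "complex \<Rightarrow> real"
  assumes C: "\<And>n. D n \<le> C" and k: "k \<in> borel_measurable borel" "\<And>z. 1 \<le> k z" "\<And>z. k z \<le> B"
  shows "- C \<le> (\<integral>z. Im z ^ 4 * k z \<partial>\<mu>) - (\<integral>\<theta>. sin \<theta> ^ 4 * (1 + ln (k (cis \<theta>))) \<partial>dtheta)"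
proof (rule field_le_epsilon)
  fix e :: real assume "0 < e"
  \<comment> \<open>Both measures are pushed to the Borel sets of the plane, where the approximation
    lemma applies.\<close>
  define M1 M2 where "M1 = distr \<mu> borel (\<lambda>z. z)" and "M2 = distr dtheta borel cis"
  have M1: "prob_space M1" "sets M1 = sets borel"
    unfolding M1_def by (auto intro!: prob_space_distr measurable_id_\<mu>)
  have M2: "prob_space M2" "sets M2 = sets borel"
    unfolding M2_def by (auto intro!: dtheta.prob_space_distr measurable_cis)
  have "\<exists>h. continuous_on UNIV h \<and> (\<forall>z. 1 \<le> h z) \<and> (\<forall>z. h z \<le> B)
      \<and> (\<integral>z. \<bar>h z - k z\<bar> \<partial>M1) \<le> e / 2 \<and> (\<integral>z. \<bar>h z - k z\<bar> \<partial>M2) \<le> e / 2"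
    by (rule continuous_approx_borel[OF M1 M2 k half_gt_zero[OF \<open>0 < e\<close>]]) blast
  then obtain h where h: "continuous_on UNIV h" "\<And>z. 1 \<le> h z" "\<And>z. h z \<le> B"
    and e1: "(\<integral>z. \<bar>h z - k z\<bar> \<partial>M1) \<le> e / 2" and e2: "(\<integral>z. \<bar>h z - k z\<bar> \<partial>M2) \<le> e / 2"
    by blast
  have hb: "h \<in> borel_measurable borel" by (rule borel_measurable_continuous_onI[OF h(1)])
  have B1: "1 \<le> B" using k(2,3) order_trans by blast
  have e1': "(\<integral>z. \<bar>h z - k z\<bar> \<partial>\<mu>) \<le> e / 2"
    using e1 unfolding M1_def by (subst (asm) integral_distr[OF measurable_id_\<mu>]) (use hb k(1) in measurable)
  have e2': "(\<integral>\<theta>. \<bar>h (cis \<theta>) - k (cis \<theta>)\<bar> \<partial>dtheta) \<le> e / 2"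
    using e2 unfolding M2_def by (subst (asm) integral_distr[OF measurable_cis]) (use hb k(1) in measurable)
  have Im1: "\<bar>Im z ^ 4\<bar> \<le> 1" if "z \<in> space \<mu>" for z
  proof -
    have "\<bar>Im z\<bar> \<le> 1" using abs_Im_le_cmod[of z] norm_circle[OF that] by simp
    then have "\<bar>Im z\<bar> ^ 4 \<le> 1" by (intro power_le_one) auto
    then show ?thesis by simp
  qed
  have int\<mu>: "integrable \<mu> (\<lambda>z. Im z ^ 4 * g z)" "integrable \<mu> g"
    if g: "g \<in> borel_measurable borel" "\<And>z. \<bar>g z\<bar> \<le> B" for g :: "complex \<Rightarrow> real"
  proof -
    have gm: "g \<in> borel_measurable \<mu>" by (rule measurable_circle[OF g(1)])
    show "integrable \<mu> g"
      by (rule integrable_const_bound[of _ B]) (use g gm in auto)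
    have m4: "(\<lambda>z. Im z ^ 4) \<in> borel_measurable \<mu>"
      by (rule measurable_circle) measurable
    show "integrable \<mu> (\<lambda>z. Im z ^ 4 * g z)"
    proof (rule integrable_const_bound[of _ B])
      show "AE z in \<mu>. norm (Im z ^ 4 * g z) \<le> B"
      proof (rule AE_I2)
        fix z assume "z \<in> space \<mu>"
        then have "\<bar>Im z ^ 4\<bar> * \<bar>g z\<bar> \<le> 1 * B" using Im1 g(2) by (intro mult_mono) auto
        then show "norm (Im z ^ 4 * g z) \<le> B" by (simp add: abs_mult)
      qed
    qed (use m4 gm in measurable)
  qed
  have intd: "integrable dtheta (\<lambda>\<theta>. sin \<theta> ^ 4 * (1 + ln (g (cis \<theta>))))"
    if g: "g \<in> borel_measurable borel" "\<And>z. 1 \<le> g z" "\<And>z. g z \<le> B" for g :: "complex \<Rightarrow> real"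
  proof (rule dtheta.integrable_const_bound[of _ "1 + ln B"])
    have gm: "(\<lambda>\<theta>. g (cis \<theta>)) \<in> borel_measurable dtheta"
      using measurable_compose[OF measurable_cis g(1)] by simp
    have sm: "sin \<in> borel_measurable dtheta" by simp
    show "(\<lambda>\<theta>. sin \<theta> ^ 4 * (1 + ln (g (cis \<theta>)))) \<in> borel_measurable dtheta"
      using gm sm by measurable
    show "AE \<theta> in dtheta. norm (sin \<theta> ^ 4 * (1 + ln (g (cis \<theta>)))) \<le> 1 + ln B"
    proof (rule AE_I2)
      fix \<theta> :: real
      have "0 \<le> ln (g (cis \<theta>))" "ln (g (cis \<theta>)) \<le> ln B"
        using g(2,3)[of "cis \<theta>"] by auto
      then have "sin \<theta> ^ 4 * (1 + ln (g (cis \<theta>))) \<le> 1 * (1 + ln B)"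
        using sin4[of \<theta>] by (intro mult_mono) auto
      then show "norm (sin \<theta> ^ 4 * (1 + ln (g (cis \<theta>)))) \<le> 1 + ln B"
        using \<open>0 \<le> ln (g (cis \<theta>))\<close> by (simp add: abs_mult)
    qed
  qed
  have habs: "\<bar>h z\<bar> \<le> B" "\<bar>k z\<bar> \<le> B" "\<bar>h z - k z\<bar> \<le> B" for z
    using h(2,3)[of z] k(2,3)[of z] by auto
  have hk: "(\<lambda>z. \<bar>h z - k z\<bar>) \<in> borel_measurable borel" using hb k(1) by measurable
  have 1: "(\<integral>z. Im z ^ 4 * h z \<partial>\<mu>) \<le> (\<integral>z. Im z ^ 4 * k z \<partial>\<mu>) + e / 2"
  proof -
    have "(\<integral>z. Im z ^ 4 * h z \<partial>\<mu>) \<le> (\<integral>z. Im z ^ 4 * k z + \<bar>h z - k z\<bar> \<partial>\<mu>)"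
    proof (rule integral_mono)
      show "integrable \<mu> (\<lambda>z. Im z ^ 4 * h z)" by (rule int\<mu>(1)[OF hb habs(1)])
      show "integrable \<mu> (\<lambda>z. Im z ^ 4 * k z + \<bar>h z - k z\<bar>)"
        by (rule Bochner_Integration.integrable_add[OF int\<mu>(1)[OF k(1) habs(2)] int\<mu>(2)[OF hk]]) (simp add: habs(3))
      fix z assume "z \<in> space \<mu>"
      then have "\<bar>Im z ^ 4\<bar> * \<bar>h z - k z\<bar> \<le> 1 * \<bar>h z - k z\<bar>" by (intro mult_right_mono Im1) auto
      then have "\<bar>Im z ^ 4 * (h z - k z)\<bar> \<le> \<bar>h z - k z\<bar>" by (simp add: abs_mult)
      then show "Im z ^ 4 * h z \<le> Im z ^ 4 * k z + \<bar>h z - k z\<bar>"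
        unfolding right_diff_distrib by linarith
    qed
    also have "\<dots> = (\<integral>z. Im z ^ 4 * k z \<partial>\<mu>) + (\<integral>z. \<bar>h z - k z\<bar> \<partial>\<mu>)"
      by (rule Bochner_Integration.integral_add[OF int\<mu>(1)[OF k(1) habs(2)] int\<mu>(2)[OF hk]]) (simp add: habs(3))
    finally show ?thesis using e1' by linarith
  qed
  have 2: "(\<integral>\<theta>. sin \<theta> ^ 4 * (1 + ln (k (cis \<theta>))) \<partial>dtheta) \<le> (\<integral>\<theta>. sin \<theta> ^ 4 * (1 + ln (h (cis \<theta>))) \<partial>dtheta) + e / 2"
  proof -
    have hkd: "integrable dtheta (\<lambda>\<theta>. \<bar>h (cis \<theta>) - k (cis \<theta>)\<bar>)"
      by (rule dtheta.integrable_const_bound[of _ B])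
         (use habs(3) measurable_compose[OF measurable_cis hk] in auto)
    have "(\<integral>\<theta>. sin \<theta> ^ 4 * (1 + ln (k (cis \<theta>))) \<partial>dtheta) \<le> (\<integral>\<theta>. sin \<theta> ^ 4 * (1 + ln (h (cis \<theta>))) + \<bar>h (cis \<theta>) - k (cis \<theta>)\<bar> \<partial>dtheta)"
    proof (rule integral_mono)
      show "integrable dtheta (\<lambda>\<theta>. sin \<theta> ^ 4 * (1 + ln (k (cis \<theta>))))" by (rule intd[OF k])
      show "integrable dtheta (\<lambda>\<theta>. sin \<theta> ^ 4 * (1 + ln (h (cis \<theta>))) + \<bar>h (cis \<theta>) - k (cis \<theta>)\<bar>)"
        by (rule Bochner_Integration.integrable_add[OF intd[OF hb h(2,3)] hkd])
      fix \<theta>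
      define x y where "x = h (cis \<theta>)" and "y = k (cis \<theta>)"
      have xy: "1 \<le> x" "1 \<le> y" using h k by (auto simp: x_def y_def)
      \<comment> \<open>The Lipschitz estimate for \<open>ln\<close> on numbers that are at least
        1.\<close>
      have "ln (y / x) \<le> y / x - 1" using xy by (intro ln_le_minus_one) auto
      also have "y / x - 1 = (y - x) / x" using xy by (simp add: field_simps)
      also have "\<dots> \<le> \<bar>x - y\<bar> / 1" using xy by (intro frac_le) auto
      finally have "ln y - ln x \<le> \<bar>x - y\<bar>" using xy by (simp add: ln_div)
      then have "sin \<theta> ^ 4 * (ln y - ln x) \<le> sin \<theta> ^ 4 * \<bar>x - y\<bar>" by (intro mult_left_mono sin4)
      also have "\<dots> \<le> 1 * \<bar>x - y\<bar>" by (intro mult_right_mono sin4) simp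
      finally have "sin \<theta> ^ 4 * (ln y - ln x) \<le> 1 * \<bar>x - y\<bar>" .
      then show "sin \<theta> ^ 4 * (1 + ln (k (cis \<theta>))) \<le> sin \<theta> ^ 4 * (1 + ln (h (cis \<theta>))) + \<bar>h (cis \<theta>) - k (cis \<theta>)\<bar>"
        unfolding x_def[symmetric] y_def[symmetric] by (simp add: right_diff_distrib distrib_left)
    qed
    also have "\<dots> = (\<integral>\<theta>. sin \<theta> ^ 4 * (1 + ln (h (cis \<theta>))) \<partial>dtheta) + (\<integral>\<theta>. \<bar>h (cis \<theta>) - k (cis \<theta>)\<bar> \<partial>dtheta)"
      by (rule Bochner_Integration.integral_add[OF intd[OF hb h(2,3)] hkd])
    finally show ?thesis using e2' by linarith
  qed
  show "- C \<le> (\<integral>z. Im z ^ 4 * k z \<partial>\<mu>) - (\<integral>\<theta>. sin \<theta> ^ 4 * (1 + ln (k (cis \<theta>))) \<partial>dtheta) + e"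
    using entropy_bound_continuous[OF C h(1,2)] 1 2 by linarith
qed

end

section \<open>Finite entropy is equivalent to an upper bound for \<open>D\<close>\<close>

lemma borel_subset_circle:
  assumes "N \<in> sets circle_borel"
  shows "N \<in> sets borel"
  using assms unfolding circle_borel_def by (auto simp: sets_restrict_space intro: sets.Int borel_closed)

locale decomposed_measure = circle_measure +
  fixes w :: "real \<Rightarrow> real" and \<mu>s :: "complex measure"
  assumes decomp: "lebesgue_decomposition \<mu> w \<mu>s"
begin

lemma w_measurable [measurable]: "w \<in> borel_measurable borel" and w_nonneg: "0 \<le> w \<theta>"
  and sets_\<mu>s: "sets \<mu>s = sets circle_borel"
  using decomp unfolding lebesgue_decomposition_def by blast+

lemma nn_integral_decomp:
  assumes g: "g \<in> borel_measurable borel"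
  shows "(\<integral>\<^sup>+z. g z \<partial>\<mu>) = (\<integral>\<^sup>+\<theta>. ennreal (w \<theta>) * g (cis \<theta>) \<partial>dtheta) + (\<integral>\<^sup>+z. g z \<partial>\<mu>s)"
proof -
  define M where "M = density dtheta (\<lambda>\<theta>. ennreal (w \<theta>))"
  have cM: "cis \<in> measurable M circle_borel"
    using cis_measurable_circle by (simp add: M_def)
  have g': "g \<in> borel_measurable circle_borel"
    unfolding circle_borel_def using g by (rule measurable_restrict_space1)
  have "(\<integral>\<^sup>+z. g z \<partial>\<mu>) = (\<integral>\<^sup>+z. g z \<partial>distr M circle_borel cis) + (\<integral>\<^sup>+z. g z \<partial>\<mu>s)"
  proof (rule nn_integral_add_measure)
    show "emeasure \<mu> X = emeasure (distr M circle_borel cis) X + emeasure \<mu>s X" if "X \<in> sets \<mu>" for X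
      using decomp that unfolding lebesgue_decomposition_def M_def sets_\<mu> by blast
  qed (simp_all add: sets_\<mu> sets_\<mu>s measurable_circle[OF g])
  also have "(\<integral>\<^sup>+z. g z \<partial>distr M circle_borel cis) = (\<integral>\<^sup>+\<theta>. g (cis \<theta>) \<partial>M)"
    by (rule nn_integral_distr[OF cM]) (simp add: g')
  also have "\<dots> = (\<integral>\<^sup>+\<theta>. ennreal (w \<theta>) * g (cis \<theta>) \<partial>dtheta)"
    unfolding M_def
  proof (rule nn_integral_density)
    have "w \<in> borel_measurable dtheta" using w_measurable by simp
    then show "(\<lambda>\<theta>. ennreal (w \<theta>)) \<in> borel_measurable dtheta" by measurable
    show "(\<lambda>\<theta>. g (cis \<theta>)) \<in> borel_measurable dtheta"
      using measurable_compose[OF measurable_cis g] by simp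
  qed
  finally show ?thesis .
qed

lemma total_mass: "(\<integral>\<^sup>+\<theta>. ennreal (w \<theta>) \<partial>dtheta) + emeasure \<mu>s (space \<mu>s) = 1"
  using nn_integral_decomp[of "\<lambda>_. 1"] by (simp add: emeasure_space_1)

definition Pos :: ennreal where
  "Pos = (\<integral>\<^sup>+\<theta>. e2ennreal (ereal (sin \<theta> ^ 4) * ext_ln (w \<theta>)) \<partial>dtheta)"

definition Neg :: ennreal where
  "Neg = (\<integral>\<^sup>+\<theta>. e2ennreal (- (ereal (sin \<theta> ^ 4) * ext_ln (w \<theta>))) \<partial>dtheta)"

lemma Pos_finite: "Pos < top"
proof -
  have "Pos \<le> (\<integral>\<^sup>+\<theta>. ennreal (w \<theta>) \<partial>dtheta)"
    unfolding Pos_def by (intro nn_integral_mono ext_ln_pos_part sin4)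
  also have "\<dots> \<le> 1" using total_mass by (metis le_iff_add)
  finally show ?thesis by (simp add: order_le_less_trans)
qed

text \<open>The positive part is finite, so the difference is \<open>-\<infinity>\<close> exactly
  when the negative part is infinite.\<close>

lemma integral_neg_infinity_iff:
  "ext_integral dtheta (\<lambda>\<theta>. ereal ((1 - cos \<theta>)\<^sup>2 * (1 + cos \<theta>)\<^sup>2) * ext_ln (w \<theta>)) > -\<infinity> \<longleftrightarrow> Neg < top"
proof -
  have "ext_integral dtheta (\<lambda>\<theta>. ereal ((1 - cos \<theta>)\<^sup>2 * (1 + cos \<theta>)\<^sup>2) * ext_ln (w \<theta>)) = enn2ereal Pos - enn2ereal Neg"
    unfolding ext_integral_def Pos_def Neg_def entropy_weight ..
  moreover have "enn2ereal Pos - enn2ereal Neg > -\<infinity> \<longleftrightarrow> Neg < top"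
    using Pos_finite by (cases Pos; cases Neg) (auto simp: enn2ereal_ennreal)
  ultimately show ?thesis by simp
qed

text \<open>With \<open>s = sin \<theta> ^ 4\<close> in the unit interval,
  \<open>s * ln (w / wn n) \<le> w / wn n\<close>, and the right-hand side has integral at most that
  of \<open>\<bar>\<phi>\<^sub>n\<bar>\<^sup>2\<close> against \<open>\<mu>\<close>, which is 1.
  What remains of the logarithm is the negative part of the entropy.\<close>

lemma D_le_Neg:
  assumes "Neg < top"
  shows "D n \<le> 1 + enn2real Neg"
proof -
  define g where "g z = ennreal ((norm (poly (Phi \<alpha> n) z))\<^sup>2 / Nrm \<alpha> n)" for z
  have gm: "g \<in> borel_measurable borel"
    unfolding g_def by (intro measurable_compose[OF _ measurable_ennreal] borel_measurable_continuous_onI continuous_intros)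
      (use Nrm_pos[of \<alpha> n, OF norm_alpha] in auto)
  have Np: "Nrm \<alpha> n > 0" by (rule Nrm_pos[of \<alpha>, OF norm_alpha])
  have "(\<integral>\<^sup>+z. g z \<partial>\<mu>) = ennreal (\<integral>z. (norm (poly (Phi \<alpha> n) z))\<^sup>2 / Nrm \<alpha> n \<partial>\<mu>)"
    unfolding g_def
  proof (rule nn_integral_eq_integral)
    show "integrable \<mu> (\<lambda>z. (norm (poly (Phi \<alpha> n) z))\<^sup>2 / Nrm \<alpha> n)"
      by (intro integrable_circle continuous_intros) (use Np in auto)
    show "AE z in \<mu>. 0 \<le> (norm (poly (Phi \<alpha> n) z))\<^sup>2 / Nrm \<alpha> n"
      using Np by (intro AE_I2) simp
  qed
  also have "\<dots> = 1" using Np by (simp add: integral_norm2_Phi)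
  finally have "(\<integral>\<^sup>+\<theta>. ennreal (w \<theta>) * g (cis \<theta>) \<partial>dtheta) + (\<integral>\<^sup>+z. g z \<partial>\<mu>s) = 1"
    using nn_integral_decomp[OF gm] by simp
  \<comment> \<open>The contribution of the singular part is nonnegative and is dropped.\<close>
  then have wg: "(\<integral>\<^sup>+\<theta>. ennreal (w \<theta>) * g (cis \<theta>) \<partial>dtheta) \<le> 1" by (metis le_iff_add)
  have gw: "g (cis \<theta>) = ennreal (1 / wn n \<theta>)" for \<theta>
    using Np by (simp add: g_def wn_def)
  have wm: "w \<in> borel_measurable dtheta" "sin \<in> borel_measurable dtheta" by (simp_all add: w_measurable)
  have negm: "(\<lambda>\<theta>. e2ennreal (- (ereal (sin \<theta> ^ 4) * ext_ln (w \<theta>)))) \<in> borel_measurable dtheta"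
    unfolding ext_ln_neg_part[OF sin4(1)] using wm by measurable
  have wgm: "(\<lambda>\<theta>. ennreal (w \<theta>) * g (cis \<theta>)) \<in> borel_measurable dtheta"
    using wm measurable_compose[OF measurable_cis gm] by measurable
  have "(\<integral>\<^sup>+\<theta>. ennreal (sin \<theta> ^ 4 * ln (1 / wn n \<theta>)) \<partial>dtheta)
      \<le> (\<integral>\<^sup>+\<theta>. ennreal (w \<theta>) * g (cis \<theta>) + e2ennreal (- (ereal (sin \<theta> ^ 4) * ext_ln (w \<theta>))) \<partial>dtheta)"
  proof (rule nn_integral_mono)
    fix \<theta>
    define s v u where "s = sin \<theta> ^ 4" and "v = w \<theta>" and "u = wn n \<theta>"
    have s: "0 \<le> s" "s \<le> 1" and v: "0 \<le> v" and u: "0 < u"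
      using sin4[of \<theta>] w_nonneg wn_pos by (auto simp: s_def v_def u_def)
    \<comment> \<open>At \<open>v = 0\<close> the right-hand side is infinite unless
      \<open>s = 0\<close>, in which case the left-hand side is 0.\<close>
    have "ennreal (s * ln (1 / u)) \<le> ennreal v * ennreal (1 / u) + (if v \<le> 0 then if s = 0 then 0 else top else ennreal (- (s * ln v)))"
    proof (cases "v = 0")
      case True
      then show ?thesis by auto
    next
      case False
      then have v: "0 < v" using v by simp
      have "s * ln (v / u) \<le> v / u"
      proof (cases "ln (v / u) \<ge> 0")
        case True
        then have "s * ln (v / u) \<le> 1 * ln (v / u)" using s by (intro mult_right_mono) auto
        also have "\<dots> \<le> v / u" using ln_le_minus_one[of "v / u"] u v by simp
        finally show ?thesis .
      next
        case F: False
        then have "s * ln (v / u) \<le> 0" using s by (simp add: mult_nonneg_nonpos)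
        then show ?thesis using u v by (meson divide_pos_pos less_imp_le order_trans)
      qed
      then have "s * ln (1 / u) \<le> v / u + (- (s * ln v))"
        using u v by (simp add: ln_div algebra_simps)
      then have "ennreal (s * ln (1 / u)) \<le> ennreal (v / u + max 0 (- (s * ln v)))"
        by (intro ennreal_leI) linarith
      also have "\<dots> = ennreal (v / u) + ennreal (max 0 (- (s * ln v)))"
        using u v by (intro ennreal_plus) auto
      also have "ennreal (max 0 (- (s * ln v))) = ennreal (- (s * ln v))"
        by (cases "- (s * ln v) \<ge> 0") (auto simp: max_def ennreal_neg)
      also have "ennreal (v / u) = ennreal v * ennreal (1 / u)"
        using u v by (simp add: ennreal_mult[symmetric])
      finally show ?thesis using v by simp
    qed
    then show "ennreal (sin \<theta> ^ 4 * ln (1 / wn n \<theta>)) \<le> ennreal (w \<theta>) * g (cis \<theta>) + e2ennreal (- (ereal (sin \<theta> ^ 4) * ext_ln (w \<theta>)))"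
      unfolding ext_ln_neg_part[OF sin4(1)] gw s_def v_def u_def .
  qed
  also have "\<dots> = (\<integral>\<^sup>+\<theta>. ennreal (w \<theta>) * g (cis \<theta>) \<partial>dtheta) + Neg"
    unfolding Neg_def by (rule nn_integral_add[OF wgm negm])
  also have "\<dots> \<le> 1 + Neg" using wg by (rule add_right_mono)
  finally have up: "(\<integral>\<^sup>+\<theta>. ennreal (sin \<theta> ^ 4 * ln (1 / wn n \<theta>)) \<partial>dtheta) \<le> 1 + Neg" .
  have "D n = enn2real (\<integral>\<^sup>+\<theta>. ennreal (sin \<theta> ^ 4 * ln (1 / wn n \<theta>)) \<partial>dtheta)
     - enn2real (\<integral>\<^sup>+\<theta>. ennreal (- (sin \<theta> ^ 4 * ln (1 / wn n \<theta>))) \<partial>dtheta)"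
    unfolding D_def by (rule real_lebesgue_integral_def[OF integrable_dtheta[OF continuous_ln_wn]])
  also have "\<dots> \<le> enn2real (\<integral>\<^sup>+\<theta>. ennreal (sin \<theta> ^ 4 * ln (1 / wn n \<theta>)) \<partial>dtheta)"
    by simp
  also have "\<dots> \<le> enn2real (1 + Neg)"
    using up assms by (intro enn2real_mono) (auto simp: less_top)
  also have "\<dots> = 1 + enn2real Neg"
    using assms by (simp add: enn2real_plus)
  finally show ?thesis .
qed

text \<open>This is \<open>max 1 (min (1 / v) (exp j))\<close>, written so that \<open>v = 0\<close> needs no special treatment.\<close>
definition trunc :: "nat \<Rightarrow> real \<Rightarrow> real" where
  "trunc j v = max 1 (exp (real j) / max 1 (v * exp (real j)))"

lemma trunc_bounds: "1 \<le> trunc j v" "0 \<le> v \<Longrightarrow> trunc j v \<le> exp (real j)"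
proof -
  show "1 \<le> trunc j v" by (simp add: trunc_def)
  have "exp (real j) / max 1 (v * exp (real j)) \<le> exp (real j) / 1"
    by (rule divide_left_mono) auto
  then show "trunc j v \<le> exp (real j)" by (simp add: trunc_def)
qed

text \<open>Where the outer maximum equals 1 the product is \<open>v\<close>, and otherwise it is at
  most 1. The bound is independent of \<open>j\<close>, which keeps the
  \<open>\<mu>\<close>-integrals of the test functions bounded.\<close>

lemma trunc_mult_le: "0 \<le> v \<Longrightarrow> v * trunc j v \<le> 1 + v"
proof -
  assume v: "0 \<le> v"
  have "v * (exp (real j) / max 1 (v * exp (real j))) \<le> 1"
    by (simp add: divide_le_eq)
  then show ?thesis using v by (auto simp: trunc_def max_def)
qed

lemma trunc_0: "trunc j 0 = exp (real j)"
  by (simp add: trunc_def)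

lemma trunc_large:
  assumes "0 < v" "1 \<le> v * exp (real j)"
  shows "ln (trunc j v) = max 0 (- ln v)"
proof -
  have "trunc j v = max 1 (1 / v)" using assms by (simp add: trunc_def)
  then show ?thesis using assms by (auto simp: max_def ln_div)
qed

text \<open>\<open>entropy_bound_borel\<close> is applied to truncations of \<open>1 / w\<close>.
  This bounds the integrals of \<open>sin \<theta> ^ 4 * ln (trunc j (w \<theta>))\<close> uniformly
  in \<open>j\<close>, and Fatou's lemma transfers the bound to the negative part.\<close>

lemma Neg_finite:
  assumes C: "\<And>n. D n \<le> C"
  shows "Neg < top"
proof -
  obtain N where N: "N \<in> sets circle_borel" "emeasure (distr dtheta circle_borel cis) N = 0"
    "emeasure \<mu>s (space circle_borel - N) = 0"
    using decomp unfolding lebesgue_decomposition_def by blast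
  have Nb: "N \<in> sets borel" by (rule borel_subset_circle[OF N(1)])
  have aeN: "AE \<theta> in dtheta. cis \<theta> \<notin> N"
  proof (rule AE_I)
    show "{\<theta> \<in> space dtheta. \<not> cis \<theta> \<notin> N} \<subseteq> cis -` N \<inter> space dtheta" by auto
    show "emeasure dtheta (cis -` N \<inter> space dtheta) = 0"
      using N(2) emeasure_distr[OF cis_measurable_circle N(1)] by simp
    show "cis -` N \<inter> space dtheta \<in> sets dtheta"
      by (rule measurable_sets[OF cis_measurable_circle N(1)])
  qed
  have spaces: "space \<mu>s = space circle_borel" by (rule sets_eq_imp_space_eq[OF sets_\<mu>s])
  have aes: "AE z in \<mu>s. z \<in> N"
  proof (rule AE_I)
    show "{z \<in> space \<mu>s. z \<notin> N} \<subseteq> space circle_borel - N" by (auto simp: spaces)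
    show "space circle_borel - N \<in> sets \<mu>s" unfolding sets_\<mu>s using N(1) by (intro sets.compl_sets)
  qed (rule N(3))
  \<comment> \<open>On \<open>N\<close> the value is 1. For \<open>dtheta\<close> this changes
    nothing, since \<open>N\<close> is null, but the singular part lives on \<open>N\<close> and so
    contributes no more than its mass.\<close>
  define k where "k j z = (if z \<in> N then 1 else trunc j (w (circle_angle z)))" for j z
  have km: "k j \<in> borel_measurable borel" for j
  proof -
    have "(\<lambda>z. w (circle_angle z)) \<in> borel_measurable borel"
      by (rule measurable_compose[OF circle_angle_measurable w_measurable])
    then have "(\<lambda>z. trunc j (w (circle_angle z))) \<in> borel_measurable borel"
      unfolding trunc_def by measurable
    then show ?thesis unfolding k_def using Nb by measurable
  qed
  have kb: "1 \<le> k j z" "k j z \<le> exp (real j)" for j z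
    using trunc_bounds w_nonneg by (auto simp: k_def)
  have kae: "AE \<theta> in dtheta. k j (cis \<theta>) = trunc j (w \<theta>)" for j
    using aeN AE_dtheta_interval by eventually_elim (simp add: k_def circle_angle_cis)
  \<comment> \<open>The bound is 1, from \<open>w * trunc j w \<le> 1 + w\<close>, plus the total
    mass 1 of the absolutely continuous and singular parts.\<close>
  have k\<mu>: "(\<integral>\<^sup>+z. ennreal (k j z) \<partial>\<mu>) \<le> 2" for j
  proof -
    have "(\<integral>\<^sup>+z. ennreal (k j z) \<partial>\<mu>) = (\<integral>\<^sup>+\<theta>. ennreal (w \<theta>) * ennreal (k j (cis \<theta>)) \<partial>dtheta) + (\<integral>\<^sup>+z. ennreal (k j z) \<partial>\<mu>s)"
      by (rule nn_integral_decomp) (rule measurable_compose[OF km measurable_ennreal])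
    also have "(\<integral>\<^sup>+z. ennreal (k j z) \<partial>\<mu>s) = (\<integral>\<^sup>+z. 1 \<partial>\<mu>s)"
      by (rule nn_integral_cong_AE) (use aes in eventually_elim, simp add: k_def)
    also have "\<dots> = emeasure \<mu>s (space \<mu>s)" by simp
    also have "(\<integral>\<^sup>+\<theta>. ennreal (w \<theta>) * ennreal (k j (cis \<theta>)) \<partial>dtheta) \<le> (\<integral>\<^sup>+\<theta>. 1 + ennreal (w \<theta>) \<partial>dtheta)"
    proof (rule nn_integral_mono_AE)
      show "AE \<theta> in dtheta. ennreal (w \<theta>) * ennreal (k j (cis \<theta>)) \<le> 1 + ennreal (w \<theta>)"
        using kae[of j]
      proof eventually_elim
        case (elim \<theta>)
        have "ennreal (w \<theta>) * ennreal (trunc j (w \<theta>)) = ennreal (w \<theta> * trunc j (w \<theta>))"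
          using w_nonneg trunc_bounds(1)[of j "w \<theta>"] by (intro ennreal_mult[symmetric]) auto
        also have "\<dots> \<le> ennreal (1 + w \<theta>)" by (intro ennreal_leI trunc_mult_le w_nonneg)
        also have "\<dots> = 1 + ennreal (w \<theta>)" using w_nonneg[of \<theta>] by simp
        finally show ?case by (simp add: elim)
      qed
    qed
    also have "(\<integral>\<^sup>+\<theta>. 1 + ennreal (w \<theta>) \<partial>dtheta) = 1 + (\<integral>\<^sup>+\<theta>. ennreal (w \<theta>) \<partial>dtheta)"
    proof -
      have "w \<in> borel_measurable dtheta" using w_measurable by simp
      then have "(\<lambda>\<theta>. ennreal (w \<theta>)) \<in> borel_measurable dtheta" by measurable
      then show ?thesis by (subst nn_integral_add) (simp_all add: dtheta.emeasure_space_1[unfolded space_dtheta])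
    qed
    finally have "(\<integral>\<^sup>+z. ennreal (k j z) \<partial>\<mu>) \<le> 1 + ((\<integral>\<^sup>+\<theta>. ennreal (w \<theta>) \<partial>dtheta) + emeasure \<mu>s (space \<mu>s))"
      by (simp add: add.assoc add_mono)
    then show ?thesis unfolding total_mass by simp
  qed
  define I where "I j = (\<integral>\<^sup>+\<theta>. ennreal (sin \<theta> ^ 4 * ln (trunc j (w \<theta>))) \<partial>dtheta)" for j
  \<comment> \<open>In the Borel bound the \<open>\<mu>\<close>-integral is at most 2, and the
    integral of \<open>sin \<theta> ^ 4\<close> is nonnegative and is discarded.\<close>
  have I: "I j \<le> ennreal (C + 2)" for j
  proof -
    have kd: "(\<lambda>\<theta>. k j (cis \<theta>)) \<in> borel_measurable dtheta"
      using measurable_compose[OF measurable_cis km] by simp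
    have sd: "sin \<in> borel_measurable dtheta" by simp
    have lnk: "0 \<le> ln (k j z)" "ln (k j z) \<le> real j" for z
    proof -
      show "0 \<le> ln (k j z)" using kb(1)[of j z] by simp
      have "ln (k j z) \<le> ln (exp (real j))" using kb[of j z] by (intro ln_mono) auto
      then show "ln (k j z) \<le> real j" by simp
    qed
    have sl: "0 \<le> sin \<theta> ^ 4 * ln (k j (cis \<theta>))" "sin \<theta> ^ 4 * ln (k j (cis \<theta>)) \<le> 1 * real j" for \<theta>
      by (rule mult_nonneg_nonneg[OF sin4(1) lnk(1)], rule mult_mono[OF sin4(2) lnk(2) zero_le_one lnk(1)])
    have int1: "integrable dtheta (\<lambda>\<theta>. sin \<theta> ^ 4 * ln (k j (cis \<theta>)))"
    proof (rule dtheta.integrable_const_bound[of _ "real j"])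
      show "AE \<theta> in dtheta. norm (sin \<theta> ^ 4 * ln (k j (cis \<theta>))) \<le> real j"
        using sl by (intro AE_I2) simp
    qed (use kd sd in measurable)
    have int0: "integrable dtheta (\<lambda>\<theta>. sin \<theta> ^ 4)" by (intro integrable_dtheta continuous_intros)
    have "(\<integral>\<theta>. sin \<theta> ^ 4 * (1 + ln (k j (cis \<theta>))) \<partial>dtheta) = (\<integral>\<theta>. sin \<theta> ^ 4 \<partial>dtheta) + (\<integral>\<theta>. sin \<theta> ^ 4 * ln (k j (cis \<theta>)) \<partial>dtheta)"
      unfolding distrib_left mult_1_right by (rule Bochner_Integration.integral_add[OF int0 int1])
    moreover have "0 \<le> (\<integral>\<theta>. sin \<theta> ^ 4 \<partial>dtheta)" by (rule Bochner_Integration.integral_nonneg) (rule sin4)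
    moreover have "(\<integral>z. Im z ^ 4 * k j z \<partial>\<mu>) \<le> 2"
    proof -
      have k\<mu>m: "k j \<in> borel_measurable \<mu>" by (rule measurable_circle[OF km])
      have intk: "integrable \<mu> (k j)"
      proof (rule integrable_const_bound[of _ "exp (real j)"])
        show "AE z in \<mu>. norm (k j z) \<le> exp (real j)"
        proof (rule AE_I2)
          fix z show "norm (k j z) \<le> exp (real j)" using kb[of j z] by simp
        qed
      qed (rule k\<mu>m)
      have "(\<integral>z. Im z ^ 4 * k j z \<partial>\<mu>) \<le> (\<integral>z. k j z \<partial>\<mu>)"
      proof (rule integral_mono_AE')
        show "integrable \<mu> (k j)" by (rule intk)
        show "AE z in \<mu>. Im z ^ 4 * k j z \<le> k j z"
        proof (rule AE_I2)
          fix z assume "z \<in> space \<mu>"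
          then have "\<bar>Im z\<bar> \<le> 1" using abs_Im_le_cmod[of z] norm_circle[of z] by simp
          then have "\<bar>Im z\<bar> ^ 4 \<le> 1" by (intro power_le_one) auto
          then have "Im z ^ 4 * k j z \<le> 1 * k j z" using kb(1)[of j z] by (intro mult_right_mono) auto
          then show "Im z ^ 4 * k j z \<le> k j z" by simp
        qed
        show "AE z in \<mu>. 0 \<le> k j z"
        proof (rule AE_I2)
          fix z show "0 \<le> k j z" using kb(1)[of j z] by simp
        qed
      qed
      also have "\<dots> = enn2real (\<integral>\<^sup>+z. ennreal (k j z) \<partial>\<mu>)"
      proof (rule integral_eq_nn_integral[OF k\<mu>m], rule AE_I2)
        fix z show "0 \<le> k j z" using kb(1)[of j z] by simp
      qed
      also have "\<dots> \<le> enn2real 2" using k\<mu>[of j] by (intro enn2real_mono) auto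
      also have "enn2real 2 = 2" by (simp add: enn2real_numeral)
      finally show ?thesis .
    qed
    ultimately have le: "(\<integral>\<theta>. sin \<theta> ^ 4 * ln (k j (cis \<theta>)) \<partial>dtheta) \<le> C + 2"
      using entropy_bound_borel[OF C km kb, of j] by linarith
    have "I j = (\<integral>\<^sup>+\<theta>. ennreal (sin \<theta> ^ 4 * ln (k j (cis \<theta>))) \<partial>dtheta)"
      unfolding I_def by (rule nn_integral_cong_AE) (use kae[of j] in eventually_elim, simp)
    also have "\<dots> = ennreal (\<integral>\<theta>. sin \<theta> ^ 4 * ln (k j (cis \<theta>)) \<partial>dtheta)"
    proof (rule nn_integral_eq_integral[OF int1], rule AE_I2)
      fix \<theta> show "0 \<le> sin \<theta> ^ 4 * ln (k j (cis \<theta>))" by (rule sl(1))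
    qed
    also have "\<dots> \<le> ennreal (C + 2)" by (rule ennreal_leI[OF le])
    finally show ?thesis .
  qed
  have "Neg \<le> (\<integral>\<^sup>+\<theta>. liminf (\<lambda>j. ennreal (sin \<theta> ^ 4 * ln (trunc j (w \<theta>)))) \<partial>dtheta)"
    unfolding Neg_def ext_ln_neg_part[OF sin4(1)]
  proof (rule nn_integral_mono)
    fix \<theta>
    define s v where "s = sin \<theta> ^ 4" and "v = w \<theta>"
    have s: "0 \<le> s" and v: "0 \<le> v" using sin4 w_nonneg by (auto simp: s_def v_def)
    have "(if v \<le> 0 then if s = 0 then 0 else top else ennreal (- (s * ln v))) \<le> liminf (\<lambda>j. ennreal (s * ln (trunc j v)))"
    proof (cases "v = 0")
      case True
      show ?thesis
      proof (cases "s = 0")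
        case True
        then show ?thesis using \<open>v = 0\<close> by simp
      next
        case False
        then have "0 < s" using s by simp
        \<comment> \<open>At a zero of \<open>w\<close> the truncation is
          \<open>exp (real j)\<close>, so the expression equals \<open>s * j\<close> and exceeds
          every natural number.\<close>
        have "of_nat m \<le> liminf (\<lambda>j. ennreal (s * ln (trunc j v)))" for m
        proof (rule Liminf_bounded)
          show "\<forall>\<^sub>F j in sequentially. of_nat m \<le> ennreal (s * ln (trunc j v))"
            using eventually_ge_at_top[of "nat \<lceil>real m / s\<rceil>"]
          proof eventually_elim
            case (elim j)
            then have "real m / s \<le> real j" by linarith
            then have "real m \<le> s * real j" using \<open>0 < s\<close> by (simp add: field_simps)
            then show ?case unfolding \<open>v = 0\<close> trunc_0 ln_exp
              by (simp add: ennreal_of_nat_eq_real_of_nat ennreal_leI)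
          qed
        qed
        then have "\<not> liminf (\<lambda>j. ennreal (s * ln (trunc j v))) < top"
          using ennreal_Ex_less_of_nat by (meson not_le)
        then show ?thesis using True False by (simp add: less_top[symmetric])
      qed
    next
      case False
      then have v0: "0 < v" using v by simp
      have "ennreal (- (s * ln v)) \<le> liminf (\<lambda>j. ennreal (s * ln (trunc j v)))"
      proof (rule Liminf_bounded)
        show "\<forall>\<^sub>F j in sequentially. ennreal (- (s * ln v)) \<le> ennreal (s * ln (trunc j v))"
          using eventually_ge_at_top[of "nat \<lceil>- ln v\<rceil>"]
        proof eventually_elim
          case (elim j)
          then have "0 \<le> ln v + real j" by linarith
          then have "1 \<le> exp (ln v + real j)" by simp
          then have "1 \<le> v * exp (real j)" using v0 by (simp add: exp_add)
          then have "ln (trunc j v) = max 0 (- ln v)" by (rule trunc_large[OF v0])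
          then have "- ln v \<le> ln (trunc j v)" by simp
          from mult_left_mono[OF this s] show ?case by (intro ennreal_leI) simp
        qed
      qed
      then show ?thesis using v0 by simp
    qed
    then show "(if w \<theta> \<le> 0 then if sin \<theta> ^ 4 = 0 then 0 else top else ennreal (- (sin \<theta> ^ 4 * ln (w \<theta>))))
        \<le> liminf (\<lambda>j. ennreal (sin \<theta> ^ 4 * ln (trunc j (w \<theta>))))"
      unfolding s_def v_def .
  qed
  also have "\<dots> \<le> liminf I"
    unfolding I_def
  proof (rule nn_integral_liminf)
    fix j
    have wm: "w \<in> borel_measurable dtheta" "sin \<in> borel_measurable dtheta" by (simp_all add: w_measurable)
    then show "(\<lambda>\<theta>. ennreal (sin \<theta> ^ 4 * ln (trunc j (w \<theta>)))) \<in> borel_measurable dtheta"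
      unfolding trunc_def by measurable
  qed
  also have "\<dots> \<le> ennreal (C + 2)"
    using I by (intro order_trans[OF Liminf_le_Limsup Limsup_bounded]) auto
  also have "\<dots> < top" by simp
  finally show ?thesis .
qed

theorem entropy_finite_iff:
  "ext_integral dtheta (\<lambda>\<theta>. ereal ((1 - cos \<theta>)\<^sup>2 * (1 + cos \<theta>)\<^sup>2) * ext_ln (w \<theta>)) > -\<infinity>
    \<longleftrightarrow> (\<exists>C. \<forall>n. D n \<le> C)"
  unfolding integral_neg_infinity_iff using D_le_Neg Neg_finite by blast

end

section \<open>Estimates for a single step\<close>

text \<open>First-order expansion at \<open>r\<close>. Taking real parts makes increments of
  conjugated and unconjugated factors enter the linear term in the same way, so it depends only on
  their sum.\<close>

lemma quartic_Taylor:
  fixes r d1 d2 d3 d4 :: complex and M D :: real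
  assumes r: "norm r \<le> M" and d: "norm d1 \<le> D" "norm d2 \<le> D" "norm d3 \<le> D" "norm d4 \<le> D"
    and DM: "D \<le> 2 * M"
  shows "\<bar>Re ((r + d1) * (r + d2) * cnj (r + d3) * cnj (r + d4))
           - (norm r ^ 4 + (norm r)\<^sup>2 * Re (cnj r * (d1 + d2 + d3 + d4)))\<bar> \<le> 18 * (M\<^sup>2 * D\<^sup>2)"
proof -
  \<comment> \<open>The products of the first two and of the last two factors, the latter before
    conjugation, are sorted by degree in the increments as \<open>A0 + A1 + A2\<close> and
    \<open>A0 + B1 + B2\<close>; \<open>R\<close> collects everything of total degree at least
    two.\<close>
  define A0 A1 A2 B1 B2 where "A0 = r * r" and "A1 = r * (d1 + d2)" and "A2 = d1 * d2"
    and "B1 = r * (d3 + d4)" and "B2 = d3 * d4"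
  define R where "R = A2 * cnj A0 + A0 * cnj B2 + A1 * cnj B1 + A1 * cnj B2 + A2 * cnj B1 + A2 * cnj B2"
  have M0: "0 \<le> M" and D0: "0 \<le> D"
    using r d(1) norm_ge_zero order_trans by blast+
  have split: "(r + d1) * (r + d2) * cnj (r + d3) * cnj (r + d4)
      = A0 * cnj A0 + (A1 * cnj A0 + A0 * cnj B1) + R"
    unfolding A0_def A1_def A2_def B1_def B2_def R_def by (simp add: algebra_simps)
  have "Re (A0 * cnj A0) = norm r ^ 4"
  proof -
    have "A0 * cnj A0 = of_real ((norm A0)\<^sup>2)"
      by (rule complex_norm_square[symmetric])
    then show ?thesis by (simp only: Re_complex_of_real) (simp add: A0_def norm_mult power2_eq_square power4_eq_xxxx)
  qed
  moreover have "Re (A1 * cnj A0 + A0 * cnj B1) = (norm r)\<^sup>2 * Re (cnj r * (d1 + d2 + d3 + d4))"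
  proof -
    have "A1 * cnj A0 = of_real ((norm r)\<^sup>2) * (cnj r * (d1 + d2))"
      unfolding A1_def A0_def complex_norm_square by (simp add: algebra_simps)
    moreover have "A0 * cnj B1 = of_real ((norm r)\<^sup>2) * cnj (cnj r * (d3 + d4))"
      unfolding B1_def A0_def complex_norm_square by (simp add: algebra_simps)
    ultimately show ?thesis
      by (simp del: complex_cnj_mult add: algebra_simps)
  qed
  moreover have "norm R \<le> 18 * (M\<^sup>2 * D\<^sup>2)"
  proof -
    have A0: "norm A0 \<le> M\<^sup>2"
      unfolding A0_def norm_mult power2_eq_square by (intro mult_mono r) (auto simp: M0)
    have A2: "norm A2 \<le> D\<^sup>2" "norm B2 \<le> D\<^sup>2"
      unfolding A2_def B2_def norm_mult power2_eq_square by (intro mult_mono d; auto simp: D0)+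
    have A1: "norm A1 \<le> M * (2 * D)" "norm B1 \<le> M * (2 * D)"
      unfolding A1_def B1_def norm_mult
      using norm_triangle_ineq[of d1 d2] norm_triangle_ineq[of d3 d4] d
      by (intro mult_mono r; auto simp: M0)+
    have "norm R \<le> norm (A2 * cnj A0) + norm (A0 * cnj B2) + norm (A1 * cnj B1)
        + norm (A1 * cnj B2) + norm (A2 * cnj B1) + norm (A2 * cnj B2)"
      unfolding R_def by (intro norm_triangle_mono order_refl)
    \<comment> \<open>The second-order terms count six, as \<open>A1 * cnj B1\<close> alone counts
      four. By \<open>D \<le> 2 * M\<close> the third-order terms add eight and the fourth-order
      term four, which makes 18.\<close>
    also have "\<dots> \<le> D\<^sup>2 * M\<^sup>2 + M\<^sup>2 * D\<^sup>2 + (M * (2 * D)) * (M * (2 * D))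
        + (M * (2 * D)) * D\<^sup>2 + D\<^sup>2 * (M * (2 * D)) + D\<^sup>2 * D\<^sup>2"
      unfolding norm_mult complex_mod_cnj
      by (intro add_mono mult_mono A0 A1 A2) (auto simp: M0 D0)
    also have "\<dots> = 6 * (M\<^sup>2 * D\<^sup>2) + (4 * M * D\<^sup>2) * D + D\<^sup>2 * D * D"
      by (simp add: power2_eq_square algebra_simps)
    also have "(4 * M * D\<^sup>2) * D \<le> (4 * M * D\<^sup>2) * (2 * M)"
      by (intro mult_left_mono DM) (auto simp: M0)
    also have "D\<^sup>2 * D * D \<le> D\<^sup>2 * (2 * M) * (2 * M)"
      by (intro mult_mono DM order_refl) (auto simp: M0 D0)
    finally show ?thesis by (simp add: power2_eq_square algebra_simps)
  qed
  moreover have "\<bar>Re R\<bar> \<le> norm R" by (rule abs_Re_le_cmod)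
  ultimately show ?thesis unfolding split by simp
qed

text \<open>The monomial and the mean of the fourth powers have the same linearization at
  \<open>r\<close>, because the linear term in \<open>quartic_Taylor\<close> is symmetric in the
  four increments.\<close>

lemma quartic_mean:
  fixes r x y u v :: complex and M D :: real
  assumes r: "norm r \<le> M" and d: "norm (x - r) \<le> D" "norm (y - r) \<le> D" "norm (u - r) \<le> D" "norm (v - r) \<le> D"
    and DM: "D \<le> 2 * M"
  shows "\<bar>Re (x * y * cnj u * cnj v) - (norm x ^ 4 + norm y ^ 4 + norm u ^ 4 + norm v ^ 4) / 4\<bar>
           \<le> 36 * (M\<^sup>2 * D\<^sup>2)"
proof -
  have p4: "Re (z * z * cnj z * cnj z) = norm z ^ 4" for z :: complex
  proof -
    have "z * z * cnj z * cnj z = of_real ((norm (z * z))\<^sup>2)"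
      using complex_norm_square[of "z * z"] by (simp add: mult_ac)
    then show ?thesis by (simp only: Re_complex_of_real) (simp add: norm_mult power2_eq_square power4_eq_xxxx)
  qed
  \<comment> \<open>The linearization of the fourth power of the norm at \<open>r\<close>.\<close>
  define L where "L z = norm r ^ 4 + (norm r)\<^sup>2 * Re (cnj r * (z - r)) * 4" for z
  have one: "\<bar>norm z ^ 4 - L z\<bar> \<le> 18 * (M\<^sup>2 * D\<^sup>2)" if "norm (z - r) \<le> D" for z
    using quartic_Taylor[OF r that that that that DM] p4[of z]
    unfolding L_def by (simp add: algebra_simps)
  have "\<bar>Re (x * y * cnj u * cnj v) - (L x + L y + L u + L v) / 4\<bar> \<le> 18 * (M\<^sup>2 * D\<^sup>2)"
  proof -
    have "(L x + L y + L u + L v) / 4 =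
        norm r ^ 4 + (norm r)\<^sup>2 * Re (cnj r * ((x - r) + (y - r) + (u - r) + (v - r)))"
      unfolding L_def by (simp add: algebra_simps add_divide_distrib diff_divide_distrib)
    moreover have "r + (z - r) = z" for z by simp
    ultimately show ?thesis using quartic_Taylor[OF r d DM] by (simp only:)
  qed
  moreover have "\<bar>A - (n1 + n2 + n3 + n4) / 4\<bar> \<le> 2 * K"
    if "\<bar>n1 - l1\<bar> \<le> K" "\<bar>n2 - l2\<bar> \<le> K" "\<bar>n3 - l3\<bar> \<le> K" "\<bar>n4 - l4\<bar> \<le> K"
      "\<bar>A - (l1 + l2 + l3 + l4) / 4\<bar> \<le> K" for A K n1 n2 n3 n4 l1 l2 l3 l4 :: real
    using that unfolding abs_le_iff by (simp add: field_simps)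
  note this[OF one[OF d(1)] one[OF d(2)] one[OF d(3)] one[OF d(4)]]
  ultimately show ?thesis by fastforce
qed

section \<open>Bookkeeping for bounds by monomials in \<open>M\<close>\<close>

lemma norm_mult_le_monomial:
  fixes x y :: complex
  assumes "norm x \<le> c * M ^ i" "norm y \<le> d * M ^ j"
  shows "norm (x * y) \<le> (c * d) * M ^ (i + j)"
proof -
  have "norm x * norm y \<le> (c * M ^ i) * (d * M ^ j)"
    using assms by (intro mult_mono) (auto intro: order_trans[OF norm_ge_zero])
  then show ?thesis by (simp add: norm_mult power_add algebra_simps)
qed

lemma norm_add_le_monomial:
  fixes x y :: complex
  assumes "norm x \<le> c * M ^ i" "norm y \<le> d * M ^ i"
  shows "norm (x + y) \<le> (c + d) * M ^ i"
  using norm_triangle_le[of x y "c * M ^ i + d * M ^ i"] assms by (simp add: algebra_simps)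

lemma monomial_weaken:
  fixes x :: complex and M :: real
  assumes "norm x \<le> c * M ^ j" "i \<le> j" "0 \<le> M" "M \<le> 1" "0 \<le> c" "c \<le> d"
  shows "norm x \<le> d * M ^ i"
proof -
  have "c * M ^ j \<le> d * M ^ i"
    using assms by (intro mult_mono power_decreasing) auto
  with assms(1) show ?thesis by linarith
qed

text \<open>With \<open>a1, a2, \<dots>\<close> the coefficients \<open>\<alpha>\<close> at \<open>n - 1, n - 2, \<dots>\<close>, these are the Taylor
  coefficients at \<open>0\<close> of \<open>\<Phi>\<^sub>n / \<Phi>\<^sub>n\<^sup>*\<close> of orders 1, 2, 3 (the one of order 0 is \<open>- cnj a1\<close>), and
  \<open>h2, h4\<close> are those of \<open>log (\<Phi>\<^bsub>n+1\<^esub>\<^sup>* / \<Phi>\<^sub>n\<^sup>*)\<close> of orders 2 and 4.\<close>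

definition b1 :: "complex \<Rightarrow> complex \<Rightarrow> complex" where
  "b1 a1 a2 = - ((1 - a1 * cnj a1) * cnj a2)"

definition b2 :: "complex \<Rightarrow> complex \<Rightarrow> complex \<Rightarrow> complex" where
  "b2 a1 a2 a3 = (1 - a1 * cnj a1) * (b1 a2 a3 + a1 * (cnj a2)\<^sup>2)"

definition b3 :: "complex \<Rightarrow> complex \<Rightarrow> complex \<Rightarrow> complex \<Rightarrow> complex" where
  "b3 a1 a2 a3 a4 = (1 - a1 * cnj a1) * b2 a2 a3 a4
     + a1 * (b1 a1 a2 * b1 a2 a3 - b2 a1 a2 a3 * cnj a2)"

definition h2 :: "complex \<Rightarrow> complex \<Rightarrow> complex \<Rightarrow> complex" where
  "h2 a0 a1 a2 = - (a0 * b1 a1 a2 + a0\<^sup>2 * (cnj a1)\<^sup>2 / 2)"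

definition h4 :: "complex \<Rightarrow> complex \<Rightarrow> complex \<Rightarrow> complex \<Rightarrow> complex \<Rightarrow> complex" where
  "h4 a0 a1 a2 a3 a4 = - (a0 * b3 a1 a2 a3 a4
     + a0\<^sup>2 * ((b1 a1 a2)\<^sup>2 - 2 * cnj a1 * b2 a1 a2 a3) / 2
     + a0 ^ 3 * (cnj a1)\<^sup>2 * b1 a1 a2 + a0 ^ 4 * (cnj a1) ^ 4 / 4)"

text \<open>The part of degree three of \<open>b3\<close>, whose part of degree one is
  \<open>- cnj a4\<close>.\<close>

definition cubic3 :: "complex \<Rightarrow> complex \<Rightarrow> complex \<Rightarrow> complex \<Rightarrow> complex" where
  "cubic3 a1 a2 a3 a4 = (a1 * cnj a1 + a2 * cnj a2 + a3 * cnj a3) * cnj a4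
      + a2 * (cnj a3)\<^sup>2 + 2 * a1 * cnj a2 * cnj a3"

context
  fixes a0 a1 a2 a3 a4 :: complex and M :: real
  assumes M: "M \<le> 1"
    and a: "norm a0 \<le> M" "norm a1 \<le> M" "norm a2 \<le> M" "norm a3 \<le> M" "norm a4 \<le> M"
begin

private lemma M0: "0 \<le> M" using a(1) norm_ge_zero order_trans by blast

private lemma ab:
  "norm a0 \<le> 1 * M ^ 1" "norm a1 \<le> 1 * M ^ 1" "norm a2 \<le> 1 * M ^ 1" "norm a3 \<le> 1 * M ^ 1"
  "norm (cnj a1) \<le> 1 * M ^ 1" "norm (cnj a2) \<le> 1 * M ^ 1" "norm (cnj a3) \<le> 1 * M ^ 1" "norm (cnj a4) \<le> 1 * M ^ 1"
  using a by auto

private lemma minus: "norm (- x) \<le> c * M ^ i" if "norm x \<le> c * M ^ i" for x :: complex and c i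
  using that by simp

text \<open>All monomials of \<open>b3\<close> have odd degree in the coefficients and their
  conjugates, so once degrees one and three are removed the remainder starts at degree five.\<close>

lemma quintic_b3:
  "norm (b3 a1 a2 a3 a4 - (- cnj a4 + cubic3 a1 a2 a3 a4)) \<le> 20 * M ^ 5"
proof -
  define s1 s2 s3 where "s1 = a1 * cnj a1" and "s2 = a2 * cnj a2" and "s3 = a3 * cnj a3"
  define c1 c2 c3 c4 where "c1 = cnj a1" and "c2 = cnj a2" and "c3 = cnj a3" and "c4 = cnj a4"
  \<comment> \<open>\<open>f\<close> is \<open>b2 a1 a2 a3 + cnj a3\<close> and \<open>f'\<close> is
    \<open>b2 a2 a3 a4 + cnj a4\<close>: the linear part is removed, which leaves order
    three.\<close>
  define f where "f = (s1 + s2 + - s1 * s2) * c3 + (1 + -s1) * (a1 * (c2 * c2))"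
  define f' where "f' = (s2 + s3 + - s2 * s3) * c4 + (1 + -s2) * (a2 * (c3 * c3))"
  have ab': "norm a1 \<le> 1 * M ^ 1" "norm a2 \<le> 1 * M ^ 1" "norm c2 \<le> 1 * M ^ 1" "norm c3 \<le> 1 * M ^ 1" "norm c4 \<le> 1 * M ^ 1"
    using ab by (auto simp: c1_def c2_def c3_def c4_def)
  have s: "norm s1 \<le> 1 * M ^ 2" "norm s2 \<le> 1 * M ^ 2" "norm s3 \<le> 1 * M ^ 2"
    using norm_mult_le_monomial[OF ab(2,5)] norm_mult_le_monomial[OF ab(3,6)] norm_mult_le_monomial[OF ab(4,7)]
    by (simp_all add: s1_def s2_def s3_def numeral_2_eq_2)
  have one: "norm (1::complex) \<le> 1 * M ^ 0" by simp
  have s': "norm s \<le> 1 * M ^ 0" if "norm s \<le> 1 * M ^ 2" for s :: complex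
    by (rule monomial_weaken[OF that]) (use M M0 in auto)
  have r: "norm (1 + -s1) \<le> 2 * M ^ 0" "norm (1 + -s2) \<le> 2 * M ^ 0"
    using norm_add_le_monomial[OF one minus[OF s'[OF s(1)]]] norm_add_le_monomial[OF one minus[OF s'[OF s(2)]]] by auto
  have f: "norm f \<le> 5 * M ^ 3" "norm f' \<le> 5 * M ^ 3"
  proof -
    have A: "norm (s1 + s2 + - s1 * s2) \<le> (1 + 1 + 1 * 1) * M ^ 2"
    proof (rule norm_add_le_monomial[OF norm_add_le_monomial[OF s(1,2)]])
      show "norm (- s1 * s2) \<le> (1 * 1) * M ^ 2"
        using norm_mult_le_monomial[OF minus[OF s'[OF s(1)]] s(2)] by (simp add: power2_eq_square)
    qed
    have B: "norm (s2 + s3 + - s2 * s3) \<le> (1 + 1 + 1 * 1) * M ^ 2"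
    proof (rule norm_add_le_monomial[OF norm_add_le_monomial[OF s(2,3)]])
      show "norm (- s2 * s3) \<le> (1 * 1) * M ^ 2"
        using norm_mult_le_monomial[OF minus[OF s'[OF s(2)]] s(3)] by (simp add: power2_eq_square)
    qed
    have C: "norm ((1 + -s1) * (a1 * (c2 * c2))) \<le> 2 * M ^ 3"
      using norm_mult_le_monomial[OF r(1) norm_mult_le_monomial[OF ab'(1) norm_mult_le_monomial[OF ab'(3,3)]]]
      by (simp add: numeral_3_eq_3)
    have D: "norm ((1 + -s2) * (a2 * (c3 * c3))) \<le> 2 * M ^ 3"
      using norm_mult_le_monomial[OF r(2) norm_mult_le_monomial[OF ab'(2) norm_mult_le_monomial[OF ab'(4,4)]]]
      by (simp add: numeral_3_eq_3)
    have E: "norm ((s1 + s2 + - s1 * s2) * c3) \<le> 3 * M ^ 3"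
      using norm_mult_le_monomial[OF A ab'(4)] by simp
    have F: "norm ((s2 + s3 + - s2 * s3) * c4) \<le> 3 * M ^ 3"
      using norm_mult_le_monomial[OF B ab'(5)] by simp
    show "norm f \<le> 5 * M ^ 3" "norm f' \<le> 5 * M ^ 3"
      using norm_add_le_monomial[OF E C] norm_add_le_monomial[OF F D] by (simp_all add: f_def f'_def)
  qed
  have e: "norm (s2 * c3) \<le> 1 * M ^ 3" "norm (s1 * c2) \<le> 1 * M ^ 3"
    using norm_mult_le_monomial[OF s(2) ab'(4)] norm_mult_le_monomial[OF s(1) ab'(3)] by simp_all
  have eq: "b3 a1 a2 a3 a4 - (- cnj a4 + cubic3 a1 a2 a3 a4)
    = - (s2 * (s3 * c4)) + - (s2 * (a2 * (c3 * c3))) + - (s1 * f')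
     + - (a1 * (c2 * (s2 * c3))) + - (a1 * (c3 * (s1 * c2))) + a1 * ((s1 * c2) * (s2 * c3)) + - (a1 * (f * c2))"
    unfolding b3_def b2_def b1_def cubic3_def f_def f'_def s1_def s2_def s3_def c1_def c2_def c3_def c4_def
    by (simp add: algebra_simps power2_eq_square)
  have t1: "norm (s2 * (s3 * c4)) \<le> 1 * M ^ 5"
    using norm_mult_le_monomial[OF s(2) norm_mult_le_monomial[OF s(3) ab'(5)]] by simp
  have t2: "norm (s2 * (a2 * (c3 * c3))) \<le> 1 * M ^ 5"
    using norm_mult_le_monomial[OF s(2) norm_mult_le_monomial[OF ab'(2) norm_mult_le_monomial[OF ab'(4,4)]]] by (simp add: numeral_eq_Suc)
  have t3: "norm (s1 * f') \<le> 5 * M ^ 5"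
    using norm_mult_le_monomial[OF s(1) f(2)] by simp
  have t4: "norm (a1 * (c2 * (s2 * c3))) \<le> 1 * M ^ 5"
    using norm_mult_le_monomial[OF ab'(1) norm_mult_le_monomial[OF ab'(3) e(1)]] by (simp add: numeral_eq_Suc)
  have t5: "norm (a1 * (c3 * (s1 * c2))) \<le> 1 * M ^ 5"
    using norm_mult_le_monomial[OF ab'(1) norm_mult_le_monomial[OF ab'(4) e(2)]] by (simp add: numeral_eq_Suc)
  have "norm (a1 * ((s1 * c2) * (s2 * c3))) \<le> 1 * M ^ 7"
    using norm_mult_le_monomial[OF ab'(1) norm_mult_le_monomial[OF e(2) e(1)]] by (simp add: numeral_eq_Suc)
  then have t6: "norm (a1 * ((s1 * c2) * (s2 * c3))) \<le> 1 * M ^ 5"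
    by (rule monomial_weaken) (use M M0 in auto)
  have t7: "norm (a1 * (f * c2)) \<le> 5 * M ^ 5"
    using norm_mult_le_monomial[OF ab'(1) norm_mult_le_monomial[OF f(1) ab'(3)]] by (simp add: numeral_eq_Suc)
  have "norm (b3 a1 a2 a3 a4 - (- cnj a4 + cubic3 a1 a2 a3 a4)) \<le> (1+1+5+1+1+1+5) * M ^ 5"
    unfolding eq
    by (intro norm_add_le_monomial minus t1 t2 t3 t4 t5 t6 t7)
  also have "\<dots> \<le> 20 * M ^ 5" using M0 by simp
  finally show ?thesis .
qed

text \<open>All monomials of \<open>h4\<close> have even degree, so without the parts of degree two
  and four the remainder has order six. Its first term is \<open>a0\<close> times the remainder from
  \<open>quintic_b3\<close>.\<close>

lemma sextic_h4:
  "norm (h4 a0 a1 a2 a3 a4 - (a0 * cnj a4 - a0 * cubic3 a1 a2 a3 a4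
      - a0\<^sup>2 * cnj a1 * cnj a3 - a0\<^sup>2 * (cnj a2)\<^sup>2 / 2)) \<le> 40 * M ^ 6"
proof -
  define c1 c2 c3 where "c1 = cnj a1" and "c2 = cnj a2" and "c3 = cnj a3"
  define s1 s2 where "s1 = a1 * c1" and "s2 = a2 * c2"
  define f where "f = (s1 + s2 + - s1 * s2) * c3 + (1 + -s1) * (a1 * (c2 * c2))"
  define g where "g = b3 a1 a2 a3 a4 - (- cnj a4 + cubic3 a1 a2 a3 a4)"
  have ab': "norm a1 \<le> 1 * M ^ 1" "norm a2 \<le> 1 * M ^ 1" "norm c1 \<le> 1 * M ^ 1" "norm c2 \<le> 1 * M ^ 1" "norm c3 \<le> 1 * M ^ 1"
    using ab by (auto simp: c1_def c2_def c3_def)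
  have s: "norm s1 \<le> 1 * M ^ 2" "norm s2 \<le> 1 * M ^ 2"
    using norm_mult_le_monomial[OF ab(2,5)] norm_mult_le_monomial[OF ab(3,6)]
    by (simp_all add: s1_def s2_def c1_def c2_def numeral_2_eq_2)
  have one: "norm (1::complex) \<le> 1 * M ^ 0" by simp
  have s': "norm s \<le> 1 * M ^ 0" if "norm s \<le> 1 * M ^ 2" for s :: complex
    by (rule monomial_weaken[OF that]) (use M M0 in auto)
  have r: "norm (1 + -s1) \<le> 2 * M ^ 0"
    using norm_add_le_monomial[OF one minus[OF s'[OF s(1)]]] by auto
  have f: "norm f \<le> 5 * M ^ 3"
  proof -
    have A: "norm (s1 + s2 + - s1 * s2) \<le> (1 + 1 + 1 * 1) * M ^ 2"
    proof (rule norm_add_le_monomial[OF norm_add_le_monomial[OF s(1,2)]])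
      show "norm (- s1 * s2) \<le> (1 * 1) * M ^ 2"
        using norm_mult_le_monomial[OF minus[OF s'[OF s(1)]] s(2)] by (simp add: power2_eq_square)
    qed
    have C: "norm ((1 + -s1) * (a1 * (c2 * c2))) \<le> 2 * M ^ 3"
      using norm_mult_le_monomial[OF r norm_mult_le_monomial[OF ab'(1) norm_mult_le_monomial[OF ab'(4,4)]]]
      by (simp add: numeral_3_eq_3)
    have E: "norm ((s1 + s2 + - s1 * s2) * c3) \<le> 3 * M ^ 3"
      using norm_mult_le_monomial[OF A ab'(5)] by simp
    show ?thesis using norm_add_le_monomial[OF E C] by (simp add: f_def)
  qed
  have e: "norm (s1 * c2) \<le> 1 * M ^ 3"
    using norm_mult_le_monomial[OF s(1) ab'(4)] by simp
  have aa: "norm (a0 * a0) \<le> 1 * M ^ 2"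
    using norm_mult_le_monomial[OF ab(1,1)] by (simp add: numeral_2_eq_2)
  have cc: "norm (c1 * c1) \<le> 1 * M ^ 2"
    using norm_mult_le_monomial[OF ab'(3,3)] by (simp add: numeral_2_eq_2)
  have eq: "h4 a0 a1 a2 a3 a4 - (a0 * cnj a4 - a0 * cubic3 a1 a2 a3 a4
      - a0\<^sup>2 * cnj a1 * cnj a3 - a0\<^sup>2 * (cnj a2)\<^sup>2 / 2)
    = - (a0 * g) + a0 * a0 * (c1 * f) + a0 * a0 * (c2 * (s1 * c2)) + - (a0 * a0 * ((s1 * c2) * ((s1 * c2) * (1/2))))
      + a0 * (a0 * a0 * ((c1 * c1) * c2)) + - (a0 * (a0 * a0 * ((c1 * c1) * (s1 * c2))))
      + - (a0 * a0 * (a0 * a0 * ((c1 * c1) * ((c1 * c1) * (1/4)))))"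
    unfolding h4_def g_def b2_def b1_def f_def s1_def s2_def c1_def c2_def c3_def
    by (simp add: field_simps power2_eq_square power3_eq_cube power4_eq_xxxx)
  have g: "norm g \<le> 20 * M ^ 5" unfolding g_def by (rule quintic_b3)
  have t1: "norm (a0 * g) \<le> 20 * M ^ 6"
    using norm_mult_le_monomial[OF ab(1) g] by (simp add: numeral_eq_Suc)
  have t2: "norm (a0 * a0 * (c1 * f)) \<le> 5 * M ^ 6"
    using norm_mult_le_monomial[OF aa norm_mult_le_monomial[OF ab'(3) f]] by (simp add: numeral_eq_Suc)
  have t3: "norm (a0 * a0 * (c2 * (s1 * c2))) \<le> 1 * M ^ 6"
    using norm_mult_le_monomial[OF aa norm_mult_le_monomial[OF ab'(4) e]] by (simp add: numeral_eq_Suc)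
  have half: "norm (1/2::complex) \<le> 1 * M ^ 0" "norm (1/4::complex) \<le> 1 * M ^ 0" by auto
  have "norm (a0 * a0 * ((s1 * c2) * ((s1 * c2) * (1/2)))) \<le> 1 * M ^ 8"
    using norm_mult_le_monomial[OF aa norm_mult_le_monomial[OF e norm_mult_le_monomial[OF e half(1)]]] by (simp add: numeral_eq_Suc)
  then have t4: "norm (a0 * a0 * ((s1 * c2) * ((s1 * c2) * (1/2)))) \<le> 1 * M ^ 6"
    by (rule monomial_weaken) (use M M0 in auto)
  have t5: "norm (a0 * (a0 * a0 * ((c1 * c1) * c2))) \<le> 1 * M ^ 6"
    using norm_mult_le_monomial[OF ab(1) norm_mult_le_monomial[OF aa norm_mult_le_monomial[OF cc ab'(4)]]] by (simp add: numeral_eq_Suc)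
  have "norm (a0 * (a0 * a0 * ((c1 * c1) * (s1 * c2)))) \<le> 1 * M ^ 8"
    using norm_mult_le_monomial[OF ab(1) norm_mult_le_monomial[OF aa norm_mult_le_monomial[OF cc e]]] by (simp add: numeral_eq_Suc)
  then have t6: "norm (a0 * (a0 * a0 * ((c1 * c1) * (s1 * c2)))) \<le> 1 * M ^ 6"
    by (rule monomial_weaken) (use M M0 in auto)
  have "norm (a0 * a0 * (a0 * a0 * ((c1 * c1) * ((c1 * c1) * (1/4))))) \<le> 1 * M ^ 8"
    using norm_mult_le_monomial[OF aa norm_mult_le_monomial[OF aa norm_mult_le_monomial[OF cc norm_mult_le_monomial[OF cc half(2)]]]] by (simp add: numeral_eq_Suc)
  then have t7: "norm (a0 * a0 * (a0 * a0 * ((c1 * c1) * ((c1 * c1) * (1/4))))) \<le> 1 * M ^ 6"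
    by (rule monomial_weaken) (use M M0 in auto)
  have "norm (h4 a0 a1 a2 a3 a4 - (a0 * cnj a4 - a0 * cubic3 a1 a2 a3 a4
      - a0\<^sup>2 * cnj a1 * cnj a3 - a0\<^sup>2 * (cnj a2)\<^sup>2 / 2)) \<le> (20+5+1+1+1+1+1) * M ^ 6"
    unfolding eq by (intro norm_add_le_monomial minus t1 t2 t3 t4 t5 t6 t7)
  also have "\<dots> \<le> 40 * M ^ 6" using M0 by simp
  finally show ?thesis .
qed

end

text \<open>Along a sequence this telescopes: the coefficients in each of the three lines sum to zero.
  The quartic line collects a quarter of the coefficient of each monomial for each of its factors.\<close>
definition step_telescope :: "complex \<Rightarrow> complex \<Rightarrow> complex \<Rightarrow> complex \<Rightarrow> complex \<Rightarrow> real" where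
  "step_telescope a0 a1 a2 a3 a4 =
     (5 * (norm a0)\<^sup>2 - 4 * (norm a2)\<^sup>2 - (norm a4)\<^sup>2) / 16
     + (Re (a2 * cnj a4) - Re (a0 * cnj a2)) / 4
     + (5 * norm a0 ^ 4 + 7 * norm a1 ^ 4 - 2 * norm a2 ^ 4 - 7 * norm a3 ^ 4 - 3 * norm a4 ^ 4) / 32"

text \<open>The first two terms are the expansion of
  \<open>- (3/8) * ln (1 - (norm a0)\<^sup>2)\<close> up to order four. The quadratic terms complete
  to the square of \<open>a0 - 2 * a2 + a4\<close> plus telescoping ones, and each of the nine
  quartic monomials is replaced by a mean of fourth powers.\<close>

lemma step_polynomial_estimate:
  fixes a0 a1 a2 a3 a4 :: complex and M D :: real
  assumes M: "M \<le> 1"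
    and a: "norm a0 \<le> M" "norm a1 \<le> M" "norm a2 \<le> M" "norm a3 \<le> M" "norm a4 \<le> M"
    and d: "norm (a1 - a0) \<le> D" "norm (a2 - a0) \<le> D" "norm (a3 - a0) \<le> D" "norm (a4 - a0) \<le> D"
    and DM: "D \<le> 2 * M"
  shows "\<bar>3/8 * (norm a0)\<^sup>2 + 3/16 * norm a0 ^ 4 + (Re (h4 a0 a1 a2 a3 a4) - 4 * Re (h2 a0 a1 a2)) / 8
     - (norm (a0 - 2 * a2 + a4))\<^sup>2 / 16 - step_telescope a0 a1 a2 a3 a4\<bar> \<le> 100 * (M ^ 6 + M\<^sup>2 * D\<^sup>2)"
proof -
  have M0: "0 \<le> M" using a(1) norm_ge_zero order_trans by blast
  have D0: "0 \<le> D" using d(1) norm_ge_zero order_trans by blast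
  have d0: "norm (a0 - a0) \<le> D" using D0 by simp
  note qm = quartic_mean[OF a(1) _ _ _ _ DM]
  define K where "K = M\<^sup>2 * D\<^sup>2"
  have m1: "\<bar>Re (a0 * a1 * cnj a1 * cnj a2) - (norm a0 ^ 4 + norm a1 ^ 4 + norm a1 ^ 4 + norm a2 ^ 4) / 4\<bar> \<le> 36 * K"
    unfolding K_def by (rule qm[OF d0 d(1) d(1) d(2)])
  have m2: "\<bar>Re (a0 * a0 * cnj a1 * cnj a1) - (norm a0 ^ 4 + norm a0 ^ 4 + norm a1 ^ 4 + norm a1 ^ 4) / 4\<bar> \<le> 36 * K"
    unfolding K_def by (rule qm[OF d0 d0 d(1) d(1)])
  have m3: "\<bar>Re (a0 * a1 * cnj a1 * cnj a4) - (norm a0 ^ 4 + norm a1 ^ 4 + norm a1 ^ 4 + norm a4 ^ 4) / 4\<bar> \<le> 36 * K"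
    unfolding K_def by (rule qm[OF d0 d(1) d(1) d(4)])
  have m4: "\<bar>Re (a0 * a2 * cnj a2 * cnj a4) - (norm a0 ^ 4 + norm a2 ^ 4 + norm a2 ^ 4 + norm a4 ^ 4) / 4\<bar> \<le> 36 * K"
    unfolding K_def by (rule qm[OF d0 d(2) d(2) d(4)])
  have m5: "\<bar>Re (a0 * a3 * cnj a3 * cnj a4) - (norm a0 ^ 4 + norm a3 ^ 4 + norm a3 ^ 4 + norm a4 ^ 4) / 4\<bar> \<le> 36 * K"
    unfolding K_def by (rule qm[OF d0 d(3) d(3) d(4)])
  have m6: "\<bar>Re (a0 * a2 * cnj a3 * cnj a3) - (norm a0 ^ 4 + norm a2 ^ 4 + norm a3 ^ 4 + norm a3 ^ 4) / 4\<bar> \<le> 36 * K"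
    unfolding K_def by (rule qm[OF d0 d(2) d(3) d(3)])
  have m7: "\<bar>Re (a0 * a1 * cnj a2 * cnj a3) - (norm a0 ^ 4 + norm a1 ^ 4 + norm a2 ^ 4 + norm a3 ^ 4) / 4\<bar> \<le> 36 * K"
    unfolding K_def by (rule qm[OF d0 d(1) d(2) d(3)])
  have m8: "\<bar>Re (a0 * a0 * cnj a1 * cnj a3) - (norm a0 ^ 4 + norm a0 ^ 4 + norm a1 ^ 4 + norm a3 ^ 4) / 4\<bar> \<le> 36 * K"
    unfolding K_def by (rule qm[OF d0 d0 d(1) d(3)])
  have m9: "\<bar>Re (a0 * a0 * cnj a2 * cnj a2) - (norm a0 ^ 4 + norm a0 ^ 4 + norm a2 ^ 4 + norm a2 ^ 4) / 4\<bar> \<le> 36 * K"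
    unfolding K_def by (rule qm[OF d0 d0 d(2) d(2)])
  define e where "e = Re (h4 a0 a1 a2 a3 a4 - (a0 * cnj a4 - a0 * cubic3 a1 a2 a3 a4
      - a0\<^sup>2 * cnj a1 * cnj a3 - a0\<^sup>2 * (cnj a2)\<^sup>2 / 2))"
  have e: "\<bar>e\<bar> \<le> 40 * M ^ 6"
    unfolding e_def using abs_Re_le_cmod sextic_h4[OF M a] order_trans by blast
  have H4: "Re (h4 a0 a1 a2 a3 a4) = e + Re (a0 * cnj a4) - Re (a0 * a1 * cnj a1 * cnj a4)
      - Re (a0 * a2 * cnj a2 * cnj a4) - Re (a0 * a3 * cnj a3 * cnj a4) - Re (a0 * a2 * cnj a3 * cnj a3)
      - 2 * Re (a0 * a1 * cnj a2 * cnj a3) - Re (a0 * a0 * cnj a1 * cnj a3) - Re (a0 * a0 * cnj a2 * cnj a2) / 2"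
    unfolding e_def cubic3_def by (simp add: algebra_simps power2_eq_square)
  have H2: "Re (h2 a0 a1 a2) = Re (a0 * cnj a2) - Re (a0 * a1 * cnj a1 * cnj a2) - Re (a0 * a0 * cnj a1 * cnj a1) / 2"
    unfolding h2_def b1_def by (simp add: algebra_simps power2_eq_square)
  have sq: "(norm (a0 - 2 * a2 + a4))\<^sup>2 = (norm a0)\<^sup>2 + 4 * (norm a2)\<^sup>2 + (norm a4)\<^sup>2
      - 4 * Re (a0 * cnj a2) - 4 * Re (a2 * cnj a4) + 2 * Re (a0 * cnj a4)"
    unfolding cmod_power2 by (simp add: algebra_simps power2_eq_square)
  have "M ^ 6 \<ge> 0" "K \<ge> 0" using M0 by (auto simp: K_def)
  then show ?thesis
    unfolding H4 H2 sq step_telescope_def K_def[symmetric]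
    using e m1 m2 m3 m4 m5 m6 m7 m8 m9 unfolding abs_le_iff by (simp add: field_simps)
qed

text \<open>The remainder vanishes at 0 and has derivative \<open>x\<^sup>2 / (1 - x)\<close>, which
  lies between 0 and \<open>3 * x\<^sup>2\<close> on the range considered.\<close>

lemma ln_one_minus_estimate:
  fixes t :: real
  assumes "0 \<le> t" "t \<le> 1 / 2"
  shows "\<bar>- ln (1 - t) - t - t\<^sup>2 / 2\<bar> \<le> t ^ 3"
proof -
  define g where "g x = - ln (1 - x) - x - x\<^sup>2 / 2" for x :: real
  have d: "(g has_real_derivative x\<^sup>2 / (1 - x)) (at x)" if "0 \<le> x" "x \<le> t" for x
    unfolding g_def using that assms
    by (auto intro!: derivative_eq_intros simp: field_simps power2_eq_square)
  have "g 0 \<le> g t"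
  proof (rule DERIV_nonneg_imp_nondecreasing[OF assms(1)])
    fix x assume "0 \<le> x" "x \<le> t"
    then show "\<exists>y. (g has_real_derivative y) (at x) \<and> 0 \<le> y"
      using d[of x] assms by (intro exI[of _ "x\<^sup>2 / (1 - x)"]) auto
  qed
  moreover have "t ^ 3 - g t \<ge> 0 ^ 3 - g 0"
  proof (rule DERIV_nonneg_imp_nondecreasing[OF assms(1)])
    fix x assume x: "0 \<le> x" "x \<le> t"
    have "((\<lambda>x. x ^ 3 - g x) has_real_derivative (3 * x\<^sup>2 - x\<^sup>2 / (1 - x))) (at x)"
      using d[OF x] by (auto intro!: derivative_eq_intros)
    moreover have "x\<^sup>2 / (1 - x) \<le> 3 * x\<^sup>2"
    proof -
      have "x\<^sup>2 * 1 \<le> x\<^sup>2 * (3 * (1 - x))"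
        using x assms by (intro mult_left_mono) auto
      then show ?thesis using x assms by (simp add: field_simps)
    qed
    ultimately show "\<exists>y. ((\<lambda>x. x ^ 3 - g x) has_real_derivative y) (at x) \<and> 0 \<le> y"
      by (intro exI[of _ "3 * x\<^sup>2 - x\<^sup>2 / (1 - x)"]) auto
  qed
  ultimately show ?thesis by (simp add: g_def)
qed

text \<open>If \<open>M\<^sup>2 \<le> D\<close> the product is at most \<open>D ^ 3\<close>,
  otherwise at most \<open>M ^ 6\<close>. This splits the mixed error into parts controlled by the
  two summability hypotheses.\<close>

lemma young_cube:
  fixes M D :: real
  assumes "0 \<le> M" "0 \<le> D"
  shows "M\<^sup>2 * D\<^sup>2 \<le> M ^ 6 + D ^ 3"
proof (cases "M\<^sup>2 \<le> D")
  case True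
  then have "M\<^sup>2 * D\<^sup>2 \<le> D * D\<^sup>2" by (intro mult_right_mono) auto
  then show ?thesis using assms by (simp add: power2_eq_square power3_eq_cube add_increasing)
next
  case False
  then have "M\<^sup>2 * D\<^sup>2 \<le> M\<^sup>2 * (M\<^sup>2)\<^sup>2" using assms by (intro mult_left_mono power_mono) auto
  moreover have "M\<^sup>2 * (M\<^sup>2)\<^sup>2 = M ^ 6" by (simp flip: power_mult power_add)
  ultimately show ?thesis using assms by (simp add: add_increasing2)
qed

text \<open>A difference with gap \<open>i\<close> is a sum of \<open>i\<close> differences with gap
  one, each of which telescopes to two boundary values.\<close>

lemma telescope_bounded:
  fixes u :: "nat \<Rightarrow> real"
  assumes u: "\<And>n. \<bar>u n\<bar> \<le> B"
  shows "\<bar>\<Sum>n<K. u (n + i) - u n\<bar> \<le> 2 * real i * B"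
proof (induction i)
  case (Suc i)
  have "(\<Sum>n<K. u (n + Suc i) - u n) = (\<Sum>n<K. u (n + i) - u n) + (\<Sum>n<K. u (Suc n + i) - u (n + i))"
    by (simp flip: sum.distrib)
  also have "(\<Sum>n<K. u (Suc n + i) - u (n + i)) = u (K + i) - u i"
    using sum_lessThan_telescope[of "\<lambda>n. u (n + i)" K] by simp
  finally show ?case
    using Suc.IH u[of "K + i"] u[of i] by (simp add: algebra_simps)
qed simp

text \<open>The increment of \<open>D\<close>, by \<open>D_step_value\<close>; the factor 3/8 is the
  mean of \<open>sin \<theta> ^ 4\<close>.\<close>

definition step_value :: "complex \<Rightarrow> complex \<Rightarrow> complex \<Rightarrow> complex \<Rightarrow> complex \<Rightarrow> real" where
  "step_value a0 a1 a2 a3 a4 = - (3/8) * ln (1 - (norm a0)\<^sup>2)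
     + (Re (h4 a0 a1 a2 a3 a4) - 4 * Re (h2 a0 a1 a2)) / 8"

lemma step_estimate:
  fixes a0 a1 a2 a3 a4 :: complex and M D :: real
  assumes M: "M\<^sup>2 \<le> 1 / 2"
    and a: "norm a0 \<le> M" "norm a1 \<le> M" "norm a2 \<le> M" "norm a3 \<le> M" "norm a4 \<le> M"
    and d: "norm (a1 - a0) \<le> D" "norm (a2 - a1) \<le> D" "norm (a3 - a2) \<le> D" "norm (a4 - a3) \<le> D"
  shows "\<bar>step_value a0 a1 a2 a3 a4 - (norm (a0 - 2 * a2 + a4))\<^sup>2 / 16 - step_telescope a0 a1 a2 a3 a4\<bar>
     \<le> 300 * (M ^ 6 + (4 * D) ^ 3)"
proof -
  have M0: "0 \<le> M" using a(1) norm_ge_zero order_trans by blast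
  have D0: "0 \<le> D" using d(1) norm_ge_zero order_trans by blast
  have M1: "M \<le> 1"
  proof (rule power2_le_imp_le)
    show "M\<^sup>2 \<le> 1\<^sup>2" using M by simp
  qed simp
  \<comment> \<open>The triangle inequality gives \<open>4 * D\<close>, and the cap
    \<open>2 * M\<close> provides the hypothesis \<open>D \<le> 2 * M\<close> of the polynomial
    estimate.\<close>
  define E where "E = min (4 * D) (2 * M)"
  have dd: "norm (x - y) \<le> 2 * M" if "norm x \<le> M" "norm y \<le> M" for x y :: complex
    using norm_triangle_ineq4[of x y] that by linarith
  have d1: "norm (a1 - a0) \<le> E"
    using dd[OF a(2,1)] d(1) D0 by (simp add: E_def)
  have d2: "norm (a2 - a0) \<le> E"
    using dd[OF a(3,1)] d D0 norm_triangle_ineq[of "a2 - a1" "a1 - a0"] by (simp add: E_def)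
  have d3: "norm (a3 - a0) \<le> E"
    using dd[OF a(4,1)] d D0 norm_triangle_ineq[of "a2 - a1" "a1 - a0"] norm_triangle_ineq[of "a3 - a2" "a2 - a0"] by (simp add: E_def)
  have d4: "norm (a4 - a0) \<le> E"
    using dd[OF a(5,1)] d D0 norm_triangle_ineq[of "a2 - a1" "a1 - a0"] norm_triangle_ineq[of "a3 - a2" "a2 - a0"]
      norm_triangle_ineq[of "a4 - a3" "a3 - a0"] by (simp add: E_def)
  have E0: "0 \<le> E" using M0 D0 by (simp add: E_def)
  have "E ^ 3 \<le> (4 * D) ^ 3" using E0 by (intro power_mono) (auto simp: E_def)
  define K where "K = M\<^sup>2 * E\<^sup>2"
  have y: "K \<le> M ^ 6 + (4 * D) ^ 3"
    using young_cube[OF M0 E0] \<open>E ^ 3 \<le> (4 * D) ^ 3\<close> unfolding K_def by linarith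
  have p: "\<bar>3/8 * (norm a0)\<^sup>2 + 3/16 * norm a0 ^ 4 + (Re (h4 a0 a1 a2 a3 a4) - 4 * Re (h2 a0 a1 a2)) / 8
     - (norm (a0 - 2 * a2 + a4))\<^sup>2 / 16 - step_telescope a0 a1 a2 a3 a4\<bar> \<le> 100 * (M ^ 6 + K)"
    unfolding K_def by (rule step_polynomial_estimate[OF M1 a d1 d2 d3 d4]) (simp add: E_def)
  have a2M: "(norm a0)\<^sup>2 \<le> M\<^sup>2" using a(1) by (intro power_mono) auto
  have "\<bar>- ln (1 - (norm a0)\<^sup>2) - (norm a0)\<^sup>2 - ((norm a0)\<^sup>2)\<^sup>2 / 2\<bar> \<le> ((norm a0)\<^sup>2) ^ 3"
    by (rule ln_one_minus_estimate) (use a2M M in auto)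
  also have "((norm a0)\<^sup>2) ^ 3 \<le> (M\<^sup>2) ^ 3" by (rule power_mono[OF a2M]) auto
  also have "(M\<^sup>2) ^ 3 = M ^ 6" by (simp flip: power_mult)
  finally have l: "\<bar>- ln (1 - (norm a0)\<^sup>2) - (norm a0)\<^sup>2 - norm a0 ^ 4 / 2\<bar> \<le> M ^ 6"
    by (simp flip: power_mult)
  define X Y where "X = (4 * D) ^ 3" and "Y = M ^ 6"
  have "X \<ge> 0" "Y \<ge> 0" using M0 D0 by (auto simp: X_def Y_def)
  then show ?thesis using l p y unfolding step_value_def abs_le_iff X_def[symmetric] Y_def[symmetric]
    by (simp add: field_simps)
qed

section \<open>Summation over all steps\<close>

lemma max_power_le:
  fixes x y :: real
  assumes "0 \<le> x" "0 \<le> y"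
  shows "(max x y) ^ k \<le> x ^ k + y ^ k"
  using assms by (cases "x \<le> y") (auto simp: max_def)

text \<open>The partial sums of \<open>f\<close> differ from those of the squares divided by 16 by a
  convergent error and a telescoping sum, hence by a bounded amount. As the squares are nonnegative,
  an upper bound on partial sums is the same as summability.\<close>

theorem step_sum_bounded_iff:
  fixes \<alpha> :: "nat \<Rightarrow> complex"
  assumes lt1: "\<And>n. norm (\<alpha> n) < 1"
    and s6: "summable (\<lambda>n. norm (\<alpha> n) ^ 6)"
    and s3: "summable (\<lambda>n. norm (\<alpha> (Suc n) - \<alpha> n) ^ 3)"
  defines "f \<equiv> \<lambda>n. step_value (\<alpha> (n + 4)) (\<alpha> (n + 3)) (\<alpha> (n + 2)) (\<alpha> (n + 1)) (\<alpha> n)"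
  shows "(\<exists>C. \<forall>K. (\<Sum>n<K. f n) \<le> C) \<longleftrightarrow> summable (\<lambda>n. (norm (\<alpha> (n + 4) - 2 * \<alpha> (n + 2) + \<alpha> n))\<^sup>2)"
proof -
  define \<Delta> where "\<Delta> n = (norm (\<alpha> (n + 4) - 2 * \<alpha> (n + 2) + \<alpha> n))\<^sup>2" for n
  define T where "T n = step_telescope (\<alpha> (n + 4)) (\<alpha> (n + 3)) (\<alpha> (n + 2)) (\<alpha> (n + 1)) (\<alpha> n)" for n
  define M where "M n = max (max (max (norm (\<alpha> (n + 4))) (norm (\<alpha> (n + 3)))) (max (norm (\<alpha> (n + 2))) (norm (\<alpha> (n + 1))))) (norm (\<alpha> n))" for n
  define d where "d n = norm (\<alpha> (Suc n) - \<alpha> n)" for n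
  define D where "D n = max (max (d n) (d (n + 1))) (max (d (n + 2)) (d (n + 3)))" for n
  have max4: "(max (max x y) (max u v)) ^ k \<le> x ^ k + y ^ k + u ^ k + v ^ k"
    if "0 \<le> x" "0 \<le> y" "0 \<le> u" "0 \<le> v" for x y u v :: real and k
    using max_power_le[of "max x y" "max u v" k] max_power_le[of x y k] max_power_le[of u v k] that
    by (simp add: le_max_iff_disj)
  have M6: "M n ^ 6 \<le> norm (\<alpha> (n + 4)) ^ 6 + norm (\<alpha> (n + 3)) ^ 6 + norm (\<alpha> (n + 2)) ^ 6 + norm (\<alpha> (n + 1)) ^ 6 + norm (\<alpha> n) ^ 6" for n
    unfolding M_def
    by (rule order_trans[OF max_power_le]) (auto simp: le_max_iff_disj intro: max4)
  have D3: "D n ^ 3 \<le> d n ^ 3 + d (n + 1) ^ 3 + d (n + 2) ^ 3 + d (n + 3) ^ 3" for n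
    unfolding D_def by (rule max4) (auto simp: d_def)
  have sum6: "summable (\<lambda>n. norm (\<alpha> (n + i)) ^ 6)" for i
    using s6 by (subst summable_iff_shift)
  have sum3: "summable (\<lambda>n. d (n + i) ^ 3)" for i
    using s3 unfolding d_def by (subst summable_iff_shift[where f="\<lambda>n. norm (\<alpha> (Suc n) - \<alpha> n) ^ 3"])
  have sum_g: "summable (\<lambda>n. 300 * (M n ^ 6 + (4 * D n) ^ 3))"
  proof (intro summable_mult summable_add)
    show "summable (\<lambda>n. M n ^ 6)"
    proof (rule summable_comparison_test')
      show "summable (\<lambda>n. norm (\<alpha> (n + 4)) ^ 6 + norm (\<alpha> (n + 3)) ^ 6 + norm (\<alpha> (n + 2)) ^ 6 + norm (\<alpha> (n + 1)) ^ 6 + norm (\<alpha> n) ^ 6)"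
        using s6 by (intro summable_add sum6)
      show "norm (M n ^ 6) \<le> norm (\<alpha> (n + 4)) ^ 6 + norm (\<alpha> (n + 3)) ^ 6 + norm (\<alpha> (n + 2)) ^ 6 + norm (\<alpha> (n + 1)) ^ 6 + norm (\<alpha> n) ^ 6"
        if "n \<ge> 0" for n using M6[of n] by simp
    qed
    have "summable (\<lambda>n. 64 * (D n ^ 3))"
    proof (rule summable_mult, rule summable_comparison_test')
      show "summable (\<lambda>n. d n ^ 3 + d (n + 1) ^ 3 + d (n + 2) ^ 3 + d (n + 3) ^ 3)"
        using sum3[of 0] by (intro summable_add sum3) simp
      show "norm (D n ^ 3) \<le> d n ^ 3 + d (n + 1) ^ 3 + d (n + 2) ^ 3 + d (n + 3) ^ 3"
        if "n \<ge> 0" for n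
      proof -
        have "0 \<le> D n" by (auto simp: D_def d_def le_max_iff_disj)
        then show ?thesis using D3[of n] by simp
      qed
    qed
    then show "summable (\<lambda>n. (4 * D n) ^ 3)" by (simp add: power_mult_distrib)
  qed
  define err where "err n = f n - \<Delta> n / 16 - T n" for n
  have "(\<lambda>n. M n ^ 6) \<longlonglongrightarrow> 0"
  proof (rule tendsto_sandwich[OF _ _ tendsto_const])
    have "(\<lambda>n. norm (\<alpha> (n + i)) ^ 6) \<longlonglongrightarrow> 0" for i
      using sum6 by (rule summable_LIMSEQ_zero)
    from tendsto_add[OF tendsto_add[OF tendsto_add[OF tendsto_add[OF this[of 4] this[of 3]] this[of 2]] this[of 1]] this[of 0]]
    show "(\<lambda>n. norm (\<alpha> (n + 4)) ^ 6 + norm (\<alpha> (n + 3)) ^ 6 + norm (\<alpha> (n + 2)) ^ 6 + norm (\<alpha> (n + 1)) ^ 6 + norm (\<alpha> n) ^ 6) \<longlonglongrightarrow> 0"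
      by simp
  qed (use M6 in auto)
  \<comment> \<open>The bound is the cube of 1/2, so that \<open>(M n)\<^sup>2 \<le> 1 / 2\<close>
    eventually, as the expansion of the logarithm requires. Only a tail is estimated, which suffices
    for summability.\<close>
  then have "\<forall>\<^sub>F n in sequentially. M n ^ 6 < (1/2) ^ 3"
    by (rule order_tendstoD) auto
  then have ev: "\<forall>\<^sub>F n in sequentially. norm (err n) \<le> 300 * (M n ^ 6 + (4 * D n) ^ 3)"
  proof eventually_elim
    case (elim n)
    have "((M n)\<^sup>2) ^ 3 < (1/2) ^ 3" using elim by (simp flip: power_mult)
    then have "(M n)\<^sup>2 \<le> 1/2" by (meson less_imp_le power_less_imp_less_base zero_le_divide_1_iff zero_le_numeral)
    moreover have dn: "norm (\<alpha> n - \<alpha> (Suc n)) = d n" for n by (simp add: d_def norm_minus_commute)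
    ultimately show ?case
      unfolding err_def f_def \<Delta>_def T_def real_norm_def
      using dn[of n] dn[of "n + 1"] dn[of "n + 2"] dn[of "n + 3"]
      by (intro step_estimate) (auto simp: M_def D_def le_max_iff_disj numeral_eq_Suc)
  qed
  have "summable err"
    by (rule summable_comparison_test_ev[OF ev sum_g])
  then obtain E where E: "\<And>K. \<bar>\<Sum>n<K. err n\<bar> \<le> E"
    unfolding summable_iff_convergent by (metis convergent_imp_Bseq BseqE real_norm_def)
  define B where "B = 1000 + E"
  have T: "\<bar>\<Sum>n<K. T n\<bar> \<le> 1000" for K
  proof -
    define u v w where "u n = (norm (\<alpha> n))\<^sup>2" and "v n = norm (\<alpha> n) ^ 4" and "w n = Re (\<alpha> (n + 2) * cnj (\<alpha> n))" for n
    have u: "\<bar>u n\<bar> \<le> 1" and v: "\<bar>v n\<bar> \<le> 1" and w: "\<bar>w n\<bar> \<le> 1" for n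
    proof -
      show "\<bar>u n\<bar> \<le> 1" "\<bar>v n\<bar> \<le> 1" using lt1[of n] by (auto simp: u_def v_def power_le_one)
      have "norm (\<alpha> (n + 2)) * norm (cnj (\<alpha> n)) \<le> 1 * 1"
        using lt1[of n] lt1[of "n + 2"] by (intro mult_mono) auto
      then show "\<bar>w n\<bar> \<le> 1" unfolding w_def using abs_Re_le_cmod[of "\<alpha> (n + 2) * cnj (\<alpha> n)"] by (simp add: norm_mult)
    qed
    \<comment> \<open>Every term is compared with the one at index \<open>n\<close>. No multiples of
      \<open>u n\<close>, \<open>v n\<close> or \<open>w n\<close> are left over because the
      coefficients in each line of \<open>step_telescope\<close> sum to zero.\<close>
    have Teq: "T n = 5/16 * (u (n + 4) - u n) - 4/16 * (u (n + 2) - u n) - 1/4 * (w (n + 2) - w n)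
        + 5/32 * (v (n + 4) - v n) + 7/32 * (v (n + 3) - v n) - 2/32 * (v (n + 2) - v n) - 7/32 * (v (n + 1) - v n)" for n
      unfolding T_def step_telescope_def u_def v_def w_def by (simp add: field_simps numeral_eq_Suc)
    have "(\<Sum>n<K. T n) = 5/16 * (\<Sum>n<K. u (n + 4) - u n) - 4/16 * (\<Sum>n<K. u (n + 2) - u n) - 1/4 * (\<Sum>n<K. w (n + 2) - w n)
        + 5/32 * (\<Sum>n<K. v (n + 4) - v n) + 7/32 * (\<Sum>n<K. v (n + 3) - v n) - 2/32 * (\<Sum>n<K. v (n + 2) - v n) - 7/32 * (\<Sum>n<K. v (n + 1) - v n)"
      unfolding Teq sum.distrib sum_subtractf sum_distrib_left[symmetric] by simp
    then show ?thesis
      using telescope_bounded[where u=u, OF u, where i=4 and K=K] telescope_bounded[where u=u, OF u, where i=2 and K=K] telescope_bounded[where u=w, OF w, where i=2 and K=K]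
        telescope_bounded[where u=v, OF v, where i=4 and K=K] telescope_bounded[where u=v, OF v, where i=3 and K=K] telescope_bounded[where u=v, OF v, where i=2 and K=K] telescope_bounded[where u=v, OF v, where i=1 and K=K]
      unfolding abs_le_iff by simp
  qed
  have B: "\<bar>(\<Sum>n<K. f n) - (\<Sum>n<K. \<Delta> n) / 16\<bar> \<le> B" for K
  proof -
    have "(\<Sum>n<K. f n) - (\<Sum>n<K. \<Delta> n) / 16 = (\<Sum>n<K. err n) + (\<Sum>n<K. T n)"
      by (simp add: err_def sum_subtractf sum_divide_distrib)
    then show ?thesis using T[of K] E[of K] by (simp add: B_def abs_le_iff)
  qed
  have \<Delta>0: "0 \<le> \<Delta> n" for n by (simp add: \<Delta>_def)
  show ?thesis unfolding \<Delta>_def[symmetric]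
  proof
    assume "\<exists>C. \<forall>K. (\<Sum>n<K. f n) \<le> C"
    then obtain C where C: "\<And>K. (\<Sum>n<K. f n) \<le> C" by blast
    show "summable \<Delta>"
    proof (rule summableI_nonneg_bounded[OF \<Delta>0])
      show "(\<Sum>n<K. \<Delta> n) \<le> 16 * (B + C)" for K
        using B[of K] C[of K] by (simp add: abs_le_iff)
    qed
  next
    assume s: "summable \<Delta>"
    have "(\<Sum>n<K. f n) \<le> B + suminf \<Delta> / 16" for K
      using B[of K] sum_le_suminf[OF s, of "{..<K}"] \<Delta>0 by (simp add: abs_le_iff)
    then show "\<exists>C. \<forall>K. (\<Sum>n<K. f n) \<le> C" by blast
  qed
qed

section \<open>Taylor coefficients along the recursion\<close>

text \<open>Differentiating the logarithm gives \<open>H' = H' * X - X'\<close> for the power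
  series, and comparing coefficients yields a recursion for those of \<open>H\<close>. The bound on
  \<open>x\<close> keeps \<open>1 - x\<close> in the right half plane, away from the branch
  cut.\<close>

lemma Ln_one_minus_coeffs:
  fixes x :: "complex \<Rightarrow> complex" and X H :: "complex fps"
  assumes x: "x holomorphic_on ball 0 1" "\<And>z. z \<in> ball 0 1 \<Longrightarrow> norm (x z) < 1"
    and X: "x has_fps_expansion X" "fps_nth X 0 = 0"
    and H: "(\<lambda>z. Ln (1 - x z)) has_fps_expansion H"
  shows "fps_nth H 2 = - (fps_nth X 2 + (fps_nth X 1)\<^sup>2 / 2)"
    and "fps_nth H 4 = - (fps_nth X 4 + ((fps_nth X 2)\<^sup>2 + 2 * fps_nth X 1 * fps_nth X 3) / 2
      + (fps_nth X 1)\<^sup>2 * fps_nth X 2 + (fps_nth X 1) ^ 4 / 4)"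
proof -
  have nonpos: "1 - x z \<notin> \<real>\<^sub>\<le>\<^sub>0" if "z \<in> ball 0 1" for z
  proof -
    have "Re (1 - x z) > 0" using x(2)[OF that] abs_Re_le_cmod[of "x z"] by simp
    then show ?thesis by (auto simp: complex_nonpos_Reals_iff)
  qed
  have ev: "\<forall>\<^sub>F z in nhds 0. z \<in> ball (0::complex) 1"
    by (rule eventually_nhds_in_open) auto
  have "\<forall>\<^sub>F z in nhds 0. deriv (\<lambda>z. Ln (1 - x z)) z = deriv (\<lambda>z. Ln (1 - x z)) z * x z - deriv x z"
    using ev
  proof eventually_elim
    case (elim z)
    have dx: "(x has_field_derivative deriv x z) (at z)"
      using x(1) elim by (intro holomorphic_derivI[of x "ball 0 1"]) auto
    have nz: "1 - x z \<noteq> 0" using nonpos[OF elim] by auto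
    have "((\<lambda>z. Ln (1 - x z)) has_field_derivative (- deriv x z / (1 - x z))) (at z)"
      using nonpos[OF elim] by (auto intro!: derivative_eq_intros dx simp: divide_inverse)
    then have "deriv (\<lambda>z. Ln (1 - x z)) z = - deriv x z / (1 - x z)" by (rule DERIV_imp_deriv)
    then show ?case using nz by (simp add: field_simps)
  qed
  moreover have "(\<lambda>z. deriv (\<lambda>z. Ln (1 - x z)) z * x z - deriv x z) has_fps_expansion fps_deriv H * X - fps_deriv X"
    by (intro has_fps_expansion_diff has_fps_expansion_mult has_fps_expansion_deriv H X(1))
  ultimately have "deriv (\<lambda>z. Ln (1 - x z)) has_fps_expansion fps_deriv H * X - fps_deriv X"
    by (subst has_fps_expansion_cong[OF _ refl])
  from fps_expansion_unique_complex[OF has_fps_expansion_deriv[OF H] this]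
  have eq: "fps_nth (fps_deriv H) k = fps_nth (fps_deriv H * X - fps_deriv X) k" for k by simp
  have 0: "fps_nth H 1 = - fps_nth X 1"
    using eq[of 0] X(2) by simp
  have 1: "2 * fps_nth H 2 = fps_nth H 1 * fps_nth X 1 - 2 * fps_nth X 2"
    using eq[of 1] X(2) by (simp add: fps_mult_nth numeral_eq_Suc)
  have 2: "3 * fps_nth H 3 = fps_nth H 1 * fps_nth X 2 + 2 * fps_nth H 2 * fps_nth X 1 - 3 * fps_nth X 3"
    using eq[of 2] X(2) by (simp add: fps_mult_nth numeral_eq_Suc)
  have 3: "4 * fps_nth H 4 = fps_nth H 1 * fps_nth X 3 + 2 * fps_nth H 2 * fps_nth X 2 + 3 * fps_nth H 3 * fps_nth X 1 - 4 * fps_nth X 4"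
    using eq[of 3] X(2) by (simp add: fps_mult_nth numeral_eq_Suc)
  have H2: "fps_nth H 2 = (2 * fps_nth H 2) / 2" by simp
  show "fps_nth H 2 = - (fps_nth X 2 + (fps_nth X 1)\<^sup>2 / 2)"
    by (subst H2) (simp only: 1 0, simp add: field_simps power2_eq_square)
  have H4: "fps_nth H 4 = (4 * fps_nth H 4) / 4" by simp
  show "fps_nth H 4 = - (fps_nth X 4 + ((fps_nth X 2)\<^sup>2 + 2 * fps_nth X 1 * fps_nth X 3) / 2
      + (fps_nth X 1)\<^sup>2 * fps_nth X 2 + (fps_nth X 1) ^ 4 / 4)"
    by (subst H4) (simp only: 3 2 1 0, simp add: field_simps power2_eq_square power4_eq_xxxx)
qed

text \<open>The fourth power of \<open>(z - cnj z) / (2 * \<i>)\<close> has frequencies 0, 2 and 4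
  only, which is why only Taylor coefficients of these orders occur below.\<close>

lemma sin4_cis: "complex_of_real (sin \<theta> ^ 4)
    = (6 - 4 * (cis \<theta> ^ 2 + cnj (cis \<theta> ^ 2)) + (cis \<theta> ^ 4 + cnj (cis \<theta> ^ 4))) / 16"
proof -
  define z where "z = cis \<theta>"
  have zz: "cnj z * z = 1" unfolding z_def by (simp add: cis_cnj cis_mult)
  have "complex_of_real (sin \<theta>) = (z - cnj z) / (2 * \<i>)"
    by (simp add: z_def complex_eq_iff)
  then have "complex_of_real (sin \<theta> ^ 4) = (z - cnj z) ^ 4 / 16"
    by (simp add: power_divide power_mult_distrib)
  also have "(z - cnj z) ^ 4 = z ^ 4 + cnj z ^ 4 - 4 * (cnj z * z) * (z ^ 2 + cnj z ^ 2) + 6 * (cnj z * z) ^ 2"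
    by (simp add: algebra_simps power2_eq_square power4_eq_xxxx)
  finally show ?thesis unfolding zz by (simp add: z_def algebra_simps)
qed

text \<open>For analytic \<open>G\<close> the terms with \<open>cis \<theta> ^ 2\<close> and
  \<open>cis \<theta> ^ 4\<close> integrate to zero, and their conjugates pick out Taylor
  coefficients.\<close>

lemma integral_sin4_analytic:
  assumes cont: "continuous_on (cball 0 1) G" and hol: "G holomorphic_on ball 0 1"
  shows "(\<integral>\<theta>. complex_of_real (sin \<theta> ^ 4) * G (cis \<theta>) \<partial>dtheta)
    = (6 * G 0 - 4 * fps_nth (fps_expansion G 0) 2 + fps_nth (fps_expansion G 0) 4) / 16"
proof -
  have Gc: "continuous_on UNIV (\<lambda>\<theta>. G (cis \<theta>))"
    by (rule cis_continuous_comp) (rule continuous_on_subset[OF cont], auto)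
  have i: "integrable dtheta (\<lambda>\<theta>. G (cis \<theta>))" "integrable dtheta (\<lambda>\<theta>. cis \<theta> ^ k * G (cis \<theta>))"
    "integrable dtheta (\<lambda>\<theta>. cnj (cis \<theta> ^ k) * G (cis \<theta>))" for k
    by (rule integrable_dtheta, rule Gc)
       (rule integrable_dtheta, intro continuous_intros Gc)+
  have "(\<integral>\<theta>. complex_of_real (sin \<theta> ^ 4) * G (cis \<theta>) \<partial>dtheta)
    = (\<integral>\<theta>. (6 * G (cis \<theta>) - 4 * (cis \<theta> ^ 2 * G (cis \<theta>) + cnj (cis \<theta> ^ 2) * G (cis \<theta>))
        + (cis \<theta> ^ 4 * G (cis \<theta>) + cnj (cis \<theta> ^ 4) * G (cis \<theta>))) / 16 \<partial>dtheta)"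
    unfolding sin4_cis by (rule Bochner_Integration.integral_cong[OF refl]) (simp add: algebra_simps add_divide_distrib diff_divide_distrib)
  also have "\<dots> = (6 * (\<integral>\<theta>. G (cis \<theta>) \<partial>dtheta) - 4 * ((\<integral>\<theta>. cis \<theta> ^ 2 * G (cis \<theta>) \<partial>dtheta) + (\<integral>\<theta>. cnj (cis \<theta> ^ 2) * G (cis \<theta>) \<partial>dtheta))
        + ((\<integral>\<theta>. cis \<theta> ^ 4 * G (cis \<theta>) \<partial>dtheta) + (\<integral>\<theta>. cnj (cis \<theta> ^ 4) * G (cis \<theta>) \<partial>dtheta))) / 16"
    using i(1) i(2)[of 2] i(2)[of 4] i(3)[of 2] i(3)[of 4]
    by (simp del: complex_cnj_power)
  also have "\<dots> = (6 * G 0 - 4 * (0 + (deriv ^^ 2) G 0 / fact 2) + (0 + (deriv ^^ 4) G 0 / fact 4)) / 16"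
    by (simp only: integral_cis_mean_value[OF cont hol] integral_cis_mult_power[OF cont hol, of 2] zero_less_numeral
        integral_cis_mult_power[OF cont hol, of 4] integral_cis_Cauchy[OF cont hol])
  finally show ?thesis by (simp add: fps_expansion_def)
qed

lemma integral_sin4: "(\<integral>\<theta>. sin \<theta> ^ 4 \<partial>dtheta) = 3 / 8"
proof -
  have "(\<integral>\<theta>. complex_of_real (sin \<theta> ^ 4) * (\<lambda>_. 1) (cis \<theta>) \<partial>dtheta) = (6 * (\<lambda>_. 1) 0 - 4 * fps_nth (fps_expansion (\<lambda>_. 1) 0) 2 + fps_nth (fps_expansion (\<lambda>_. 1) 0) 4) / 16"
    by (rule integral_sin4_analytic) (auto intro: holomorphic_on_const)
  also have "fps_expansion (\<lambda>_. 1) 0 = 1"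
    by (rule fps_expansion_unique_complex[of "\<lambda>_. 1"]) (rule has_fps_expansion_fps_expansion[of UNIV], auto)
  finally have "complex_of_real (\<integral>\<theta>. sin \<theta> ^ 4 \<partial>dtheta) = of_real (3 / 8)"
    unfolding integral_complex_of_real[symmetric] by simp
  then show ?thesis by (simp only: of_real_eq_iff)
qed

section \<open>The quotients \<open>Phi / Phis\<close> and the increments of
  \<open>D\<close>\<close>

context circle_measure
begin

text \<open>A finite Blaschke product: analytic on the disk and of modulus one on the circle, by
  \<open>norm_Phis_circle\<close>.\<close>

definition bfun :: "nat \<Rightarrow> complex \<Rightarrow> complex" where
  "bfun n z = poly (Phi \<alpha> n) z / poly (Phis \<alpha> n) z"

definition bser :: "nat \<Rightarrow> complex fps" where
  "bser n = fps_expansion (bfun n) 0"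

lemma bfun_continuous: "continuous_on (cball 0 1) (bfun n)"
proof -
  have "poly (Phis \<alpha> n) z \<noteq> 0" if "z \<in> cball 0 1" for z
    using Phis_disk_nz[of z] that by simp
  then show ?thesis unfolding bfun_def[abs_def]
    by (intro continuous_on_divide continuous_on_poly continuous_on_id) auto
qed

lemma bfun_holomorphic: "bfun n holomorphic_on ball 0 1"
proof -
  have nz: "poly (Phis \<alpha> n) z \<noteq> 0" if "z \<in> ball 0 1" for z
    using Phis_disk_nz[of z] that by simp
  have "poly p holomorphic_on ball 0 1" for p :: "complex poly"
    by (intro holomorphic_intros)
  then show ?thesis unfolding bfun_def[abs_def]
    using nz by (intro holomorphic_on_divide) auto
qed

lemma bfun_expansion: "bfun n has_fps_expansion bser n"
  unfolding bser_def by (rule has_fps_expansion_fps_expansion[OF _ _ bfun_holomorphic]) auto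

lemma norm_bfun: "norm z \<le> 1 \<Longrightarrow> norm (bfun n z) \<le> 1"
proof -
  assume z: "norm z \<le> 1"
  have "norm (poly (Phi \<alpha> n) z) \<le> norm (poly (Phis \<alpha> n) z)" "poly (Phis \<alpha> n) z \<noteq> 0"
    using Phi_Phis_disk[of \<alpha>, OF norm_alpha z] by blast+
  then show ?thesis unfolding bfun_def norm_divide by (simp add: divide_le_eq)
qed

lemma norm_x: "norm z \<le> 1 \<Longrightarrow> norm (\<alpha> n * z * bfun n z) < 1"
proof -
  assume z: "norm z \<le> 1"
  have "norm z * norm (bfun n z) \<le> 1 * 1" using z norm_bfun[OF z] by (intro mult_mono) auto
  then have "norm (\<alpha> n) * (norm z * norm (bfun n z)) \<le> norm (\<alpha> n) * 1" by (intro mult_left_mono) auto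
  then show ?thesis using norm_alpha[of n] by (simp add: norm_mult mult.assoc)
qed

lemma Phis_Suc_factor:
  assumes "norm z \<le> 1"
  shows "poly (Phis \<alpha> (Suc n)) z = poly (Phis \<alpha> n) z * (1 - \<alpha> n * z * bfun n z)"
  using Phis_disk_nz[OF assms, of n] by (simp add: Phis_Suc bfun_def field_simps)

text \<open>The Moebius recursion for the quotient with its denominator cleared. In this implicit
  form it passes to power series without a division.\<close>

lemma bfun_Suc:
  assumes "norm z \<le> 1"
  shows "bfun (Suc n) z = z * bfun n z - cnj (\<alpha> n) + \<alpha> n * z * bfun n z * bfun (Suc n) z"
proof -
  define p q where "p = poly (Phi \<alpha> n) z" and "q = poly (Phis \<alpha> n) z"
  have q: "q \<noteq> 0" "q - \<alpha> n * z * p \<noteq> 0"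
    using Phis_disk_nz[OF assms, of n] Phis_disk_nz[OF assms, of "Suc n"] by (simp_all add: p_def q_def Phis_Suc mult_ac)
  have b: "bfun n z = p / q" "bfun (Suc n) z = (z * p - cnj (\<alpha> n) * q) / (q - \<alpha> n * z * p)"
    by (simp_all add: bfun_def p_def q_def Phi_Suc Phis_Suc mult.assoc)
  have "bfun (Suc n) z * (1 - \<alpha> n * z * bfun n z) = z * bfun n z - cnj (\<alpha> n)"
  proof -
    have "1 - \<alpha> n * z * bfun n z = (q - \<alpha> n * z * p) / q" using q by (simp add: b field_simps)
    moreover have "z * bfun n z - cnj (\<alpha> n) = (z * p - cnj (\<alpha> n) * q) / q" using q by (simp add: b field_simps)
    ultimately show ?thesis using q by (simp add: b(2))
  qed
  then show ?thesis by (simp add: algebra_simps)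
qed

lemma bser_Suc: "bser (Suc n) = fps_X * bser n - fps_const (cnj (\<alpha> n))
    + fps_const (\<alpha> n) * fps_X * bser n * bser (Suc n)"
proof (rule fps_expansion_unique_complex[OF bfun_expansion])
  have ev: "\<forall>\<^sub>F z in nhds 0. z \<in> ball (0::complex) 1"
    by (rule eventually_nhds_in_open) auto
  have "(\<lambda>z. z * bfun n z - cnj (\<alpha> n) + \<alpha> n * z * bfun n z * bfun (Suc n) z) has_fps_expansion
    fps_X * bser n - fps_const (cnj (\<alpha> n)) + fps_const (\<alpha> n) * fps_X * bser n * bser (Suc n)"
    by (intro has_fps_expansion_add has_fps_expansion_diff has_fps_expansion_mult
        has_fps_expansion_fps_X has_fps_expansion_const bfun_expansion)
  moreover have "\<forall>\<^sub>F z in nhds 0. bfun (Suc n) z = z * bfun n z - cnj (\<alpha> n) + \<alpha> n * z * bfun n z * bfun (Suc n) z"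
    using ev by eventually_elim (rule bfun_Suc, simp)
  ultimately show "bfun (Suc n) has_fps_expansion
    fps_X * bser n - fps_const (cnj (\<alpha> n)) + fps_const (\<alpha> n) * fps_X * bser n * bser (Suc n)"
    by (subst has_fps_expansion_cong[OF _ refl])
qed

text \<open>The factor \<open>fps_X\<close> makes order \<open>Suc k\<close> depend only on orders
  up to \<open>k\<close>, so each Taylor coefficient involves only the last few Verblunsky
  coefficients.\<close>

lemma bser_nth:
  "fps_nth (bser (Suc n)) 0 = - cnj (\<alpha> n)"
  "fps_nth (bser (Suc n)) (Suc k) = fps_nth (bser n) k
     + \<alpha> n * (\<Sum>i\<le>k. fps_nth (bser n) i * fps_nth (bser (Suc n)) (k - i))"
proof -
  have *: "fps_nth (bser (Suc n)) m = fps_nth (fps_X * (bser n + fps_const (\<alpha> n) * (bser n * bser (Suc n))) - fps_const (cnj (\<alpha> n))) m" for m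
    by (subst bser_Suc) (simp add: algebra_simps)
  show "fps_nth (bser (Suc n)) 0 = - cnj (\<alpha> n)"
    using *[of 0] by simp
  show "fps_nth (bser (Suc n)) (Suc k) = fps_nth (bser n) k
     + \<alpha> n * (\<Sum>i\<le>k. fps_nth (bser n) i * fps_nth (bser (Suc n)) (k - i))"
  proof -
    have "fps_nth (bser (Suc n)) (Suc k) = fps_nth (bser n) k + \<alpha> n * fps_nth (bser n * bser (Suc n)) k"
      using *[of "Suc k"] by simp
    then show ?thesis by (simp add: fps_mult_nth atLeast0AtMost)
  qed
qed

lemma bser_coeffs:
  "fps_nth (bser (n + 1)) 0 = - cnj (\<alpha> n)"
  "fps_nth (bser (n + 2)) 1 = b1 (\<alpha> (n + 1)) (\<alpha> n)"
  "fps_nth (bser (n + 3)) 2 = b2 (\<alpha> (n + 2)) (\<alpha> (n + 1)) (\<alpha> n)"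
  "fps_nth (bser (n + 4)) 3 = b3 (\<alpha> (n + 3)) (\<alpha> (n + 2)) (\<alpha> (n + 1)) (\<alpha> n)"
proof -
  have B0: "fps_nth (bser (Suc n)) 0 = - cnj (\<alpha> n)" for n
    by (rule bser_nth(1))
  have B1: "fps_nth (bser (Suc (Suc n))) 1 = b1 (\<alpha> (Suc n)) (\<alpha> n)" for n
  proof -
    have "fps_nth (bser (Suc (Suc n))) 1 = fps_nth (bser (Suc n)) 0
        + \<alpha> (Suc n) * (fps_nth (bser (Suc n)) 0 * fps_nth (bser (Suc (Suc n))) 0)"
      using bser_nth(2)[of "Suc n" 0] by simp
    then show ?thesis unfolding B0 by (simp add: b1_def algebra_simps)
  qed
  have B2: "fps_nth (bser (Suc (Suc (Suc n)))) 2 = b2 (\<alpha> (Suc (Suc n))) (\<alpha> (Suc n)) (\<alpha> n)" for n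
  proof -
    have "fps_nth (bser (Suc (Suc (Suc n)))) 2 = fps_nth (bser (Suc (Suc n))) 1
        + \<alpha> (Suc (Suc n)) * (fps_nth (bser (Suc (Suc n))) 0 * fps_nth (bser (Suc (Suc (Suc n)))) 1
          + fps_nth (bser (Suc (Suc n))) 1 * fps_nth (bser (Suc (Suc (Suc n)))) 0)"
      using bser_nth(2)[of "Suc (Suc n)" 1] by (simp add: numeral_2_eq_2)
    then show ?thesis unfolding B0 B1 by (simp add: b2_def b1_def algebra_simps power2_eq_square)
  qed
  have "fps_nth (bser (Suc (Suc (Suc (Suc n))))) 3 = fps_nth (bser (Suc (Suc (Suc n)))) 2
      + \<alpha> (Suc (Suc (Suc n))) * (fps_nth (bser (Suc (Suc (Suc n)))) 0 * fps_nth (bser (Suc (Suc (Suc (Suc n))))) 2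
        + fps_nth (bser (Suc (Suc (Suc n)))) 1 * fps_nth (bser (Suc (Suc (Suc (Suc n))))) 1
        + fps_nth (bser (Suc (Suc (Suc n)))) 2 * fps_nth (bser (Suc (Suc (Suc (Suc n))))) 0)"
    using bser_nth(2)[of "Suc (Suc (Suc n))" 2] by (simp add: numeral_eq_Suc add.assoc)
  then have B3: "fps_nth (bser (Suc (Suc (Suc (Suc n))))) 3
      = b3 (\<alpha> (Suc (Suc (Suc n)))) (\<alpha> (Suc (Suc n))) (\<alpha> (Suc n)) (\<alpha> n)"
    unfolding B0 B1 B2 by (simp add: b3_def algebra_simps)
  show "fps_nth (bser (n + 1)) 0 = - cnj (\<alpha> n)" "fps_nth (bser (n + 2)) 1 = b1 (\<alpha> (n + 1)) (\<alpha> n)"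
    "fps_nth (bser (n + 3)) 2 = b2 (\<alpha> (n + 2)) (\<alpha> (n + 1)) (\<alpha> n)"
    using B0[of n] B1[of n] B2[of n] by (simp_all add: numeral_2_eq_2 numeral_3_eq_3)
  show "fps_nth (bser (n + 4)) 3 = b3 (\<alpha> (n + 3)) (\<alpha> (n + 2)) (\<alpha> (n + 1)) (\<alpha> n)"
    using B3 by (simp add: eval_nat_numeral)
qed

text \<open>The logarithm of \<open>Phis \<alpha> (Suc n) / Phis \<alpha> n\<close>, by
  \<open>Phis_Suc_factor\<close>.\<close>

definition logfun :: "nat \<Rightarrow> complex \<Rightarrow> complex" where
  "logfun n z = Ln (1 - \<alpha> n * z * bfun n z)"

lemma one_minus_x_nonpos:
  assumes "norm z \<le> 1"
  shows "1 - \<alpha> n * z * bfun n z \<notin> \<real>\<^sub>\<le>\<^sub>0"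
proof -
  have "Re (1 - \<alpha> n * z * bfun n z) > 0"
    using norm_x[OF assms, of n] abs_Re_le_cmod[of "\<alpha> n * z * bfun n z"] by simp
  then show ?thesis by (auto simp: complex_nonpos_Reals_iff)
qed

lemma x_holomorphic: "(\<lambda>z. \<alpha> n * z * bfun n z) holomorphic_on ball 0 1"
  by (intro holomorphic_on_mult holomorphic_on_const holomorphic_on_ident bfun_holomorphic)

lemma logfun_continuous: "continuous_on (cball 0 1) (logfun n)"
  unfolding logfun_def[abs_def]
proof (rule continuous_on_Ln')
  show "continuous_on (cball 0 1) (\<lambda>z. 1 - \<alpha> n * z * bfun n z)"
    by (intro continuous_on_diff continuous_on_mult continuous_on_const continuous_on_id bfun_continuous)
qed (rule one_minus_x_nonpos, simp)

lemma logfun_holomorphic: "logfun n holomorphic_on ball 0 1"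
  unfolding logfun_def[abs_def]
proof (rule holomorphic_on_Ln')
  show "(\<lambda>z. 1 - \<alpha> n * z * bfun n z) holomorphic_on ball 0 1"
    by (intro holomorphic_on_diff holomorphic_on_const x_holomorphic)
qed (rule one_minus_x_nonpos, simp)

text \<open>On the circle \<open>1 / wn n\<close> is the squared modulus of
  \<open>Phis \<alpha> n\<close> divided by \<open>Nrm \<alpha> n\<close>. Its logarithm grows by
  twice the real part of \<open>logfun n\<close> minus the logarithm of the new norm factor. Since
  \<open>logfun n\<close> vanishes at 0, only its coefficients of order 2 and 4 remain.\<close>

lemma D_step:
  "D (Suc n) - D n = - (3/8) * ln (1 - (norm (\<alpha> n))\<^sup>2)
     + (Re (fps_nth (fps_expansion (logfun n) 0) 4) - 4 * Re (fps_nth (fps_expansion (logfun n) 0) 2)) / 8"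
proof -
  define l where "l = ln (1 - (norm (\<alpha> n))\<^sup>2)"
  have al: "1 - (norm (\<alpha> n))\<^sup>2 > 0" using norm_alpha[of n] by (simp add: abs_square_less_1)
  have pt: "ln (1 / wn (Suc n) \<theta>) - ln (1 / wn n \<theta>) = 2 * Re (logfun n (cis \<theta>)) - l" for \<theta>
  proof -
    have lnw: "ln (1 / wn m \<theta>) = 2 * ln (norm (poly (Phis \<alpha> m) (cis \<theta>))) - ln (Nrm \<alpha> m)" for m
    proof -
      have "norm (poly (Phis \<alpha> m) (cis \<theta>)) > 0" using Phis_disk_nz[of "cis \<theta>" m] by simp
      moreover have "Nrm \<alpha> m > 0" by (rule Nrm_pos[of \<alpha>, OF norm_alpha])
      moreover have "1 / wn m \<theta> = (norm (poly (Phis \<alpha> m) (cis \<theta>)))\<^sup>2 / Nrm \<alpha> m"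
        unfolding wn_def norm_Phis_circle[OF norm_cis] by simp
      ultimately show ?thesis by (simp add: ln_div ln_realpow)
    qed
    have nz: "1 - \<alpha> n * cis \<theta> * bfun n (cis \<theta>) \<noteq> 0"
      using one_minus_x_nonpos[of "cis \<theta>" n] by auto
    have "ln (norm (poly (Phis \<alpha> (Suc n)) (cis \<theta>))) = ln (norm (poly (Phis \<alpha> n) (cis \<theta>))) + Re (logfun n (cis \<theta>))"
      using nz Phis_disk_nz[of "cis \<theta>" n]
      by (simp add: Phis_Suc_factor norm_mult ln_mult logfun_def Re_Ln)
    moreover have "ln (Nrm \<alpha> (Suc n)) = ln (Nrm \<alpha> n) + l"
    proof -
      have "Nrm \<alpha> (Suc n) = Nrm \<alpha> n * (1 - (norm (\<alpha> n))\<^sup>2)" by (simp add: Nrm_def)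
      then show ?thesis using Nrm_pos[of \<alpha> n, OF norm_alpha] al by (simp add: l_def ln_mult)
    qed
    ultimately show ?thesis unfolding lnw by simp
  qed
  have lc: "continuous_on UNIV (\<lambda>\<theta>. logfun n (cis \<theta>))"
    by (rule cis_continuous_comp) (rule continuous_on_subset[OF logfun_continuous], auto)
  have iH: "integrable dtheta (\<lambda>\<theta>. complex_of_real (sin \<theta> ^ 4) * logfun n (cis \<theta>))"
    by (intro integrable_dtheta continuous_intros lc)
  have iR: "integrable dtheta (\<lambda>\<theta>. sin \<theta> ^ 4 * Re (logfun n (cis \<theta>)))"
    by (intro integrable_dtheta continuous_intros lc)
  have i0: "integrable dtheta (\<lambda>\<theta>. sin \<theta> ^ 4)" by (intro integrable_dtheta continuous_intros)
  have "D (Suc n) - D n = (\<integral>\<theta>. sin \<theta> ^ 4 * ln (1 / wn (Suc n) \<theta>) - sin \<theta> ^ 4 * ln (1 / wn n \<theta>) \<partial>dtheta)"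
    unfolding D_def
    by (rule Bochner_Integration.integral_diff[symmetric, OF integrable_dtheta[OF continuous_ln_wn] integrable_dtheta[OF continuous_ln_wn]])
  also have "\<dots> = (\<integral>\<theta>. 2 * (sin \<theta> ^ 4 * Re (logfun n (cis \<theta>))) - l * sin \<theta> ^ 4 \<partial>dtheta)"
    unfolding right_diff_distrib[symmetric] pt by (simp add: algebra_simps)
  also have "\<dots> = 2 * (\<integral>\<theta>. sin \<theta> ^ 4 * Re (logfun n (cis \<theta>)) \<partial>dtheta) - l * (\<integral>\<theta>. sin \<theta> ^ 4 \<partial>dtheta)"
    using iR i0 by simp
  also have "(\<integral>\<theta>. sin \<theta> ^ 4 * Re (logfun n (cis \<theta>)) \<partial>dtheta) = Re (\<integral>\<theta>. complex_of_real (sin \<theta> ^ 4) * logfun n (cis \<theta>) \<partial>dtheta)"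
    using integral_Re[OF iH] by simp
  also have "(\<integral>\<theta>. complex_of_real (sin \<theta> ^ 4) * logfun n (cis \<theta>) \<partial>dtheta)
     = (6 * logfun n 0 - 4 * fps_nth (fps_expansion (logfun n) 0) 2 + fps_nth (fps_expansion (logfun n) 0) 4) / 16"
    by (rule integral_sin4_analytic[OF logfun_continuous logfun_holomorphic])
  also have "logfun n 0 = 0" by (simp add: logfun_def)
  finally show ?thesis unfolding integral_sin4 l_def by (simp add: field_simps)
qed

text \<open>The offset 4 makes all five Verblunsky coefficients that enter available.\<close>

lemma D_step_value:
  "D (n + 5) - D (n + 4) = step_value (\<alpha> (n + 4)) (\<alpha> (n + 3)) (\<alpha> (n + 2)) (\<alpha> (n + 1)) (\<alpha> n)"
proof -
  define X where "X = fps_const (\<alpha> (n + 4)) * fps_X * bser (n + 4)"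
  have X: "(\<lambda>z. \<alpha> (n + 4) * z * bfun (n + 4) z) has_fps_expansion X"
    unfolding X_def by (intro has_fps_expansion_mult has_fps_expansion_fps_X has_fps_expansion_const bfun_expansion)
  have Xn: "fps_nth X 0 = 0" "fps_nth X (Suc k) = \<alpha> (n + 4) * fps_nth (bser (n + 4)) k" for k
    by (simp_all add: X_def mult.assoc)
  have b: "fps_nth (bser (n + 4)) 0 = - cnj (\<alpha> (n + 3))"
    "fps_nth (bser (n + 4)) 1 = b1 (\<alpha> (n + 3)) (\<alpha> (n + 2))"
    "fps_nth (bser (n + 4)) 2 = b2 (\<alpha> (n + 3)) (\<alpha> (n + 2)) (\<alpha> (n + 1))"
    "fps_nth (bser (n + 4)) 3 = b3 (\<alpha> (n + 3)) (\<alpha> (n + 2)) (\<alpha> (n + 1)) (\<alpha> n)"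
    using bser_coeffs(1)[of "n + 3"] bser_coeffs(2)[of "n + 2"] bser_coeffs(3)[of "n + 1"] bser_coeffs(4)[of n]
    by (simp_all add: eval_nat_numeral)
  have X1: "fps_nth X 1 = \<alpha> (n + 4) * - cnj (\<alpha> (n + 3))"
    using Xn(2)[of 0] b(1) by simp
  have X2: "fps_nth X 2 = \<alpha> (n + 4) * b1 (\<alpha> (n + 3)) (\<alpha> (n + 2))"
    using Xn(2)[of 1] b(2) by (simp add: numeral_2_eq_2)
  have X3: "fps_nth X 3 = \<alpha> (n + 4) * b2 (\<alpha> (n + 3)) (\<alpha> (n + 2)) (\<alpha> (n + 1))"
    using Xn(2)[of 2] b(3) by (simp add: numeral_3_eq_3 numeral_2_eq_2)
  have X4: "fps_nth X 4 = \<alpha> (n + 4) * b3 (\<alpha> (n + 3)) (\<alpha> (n + 2)) (\<alpha> (n + 1)) (\<alpha> n)"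
    using Xn(2)[of 3] b(4) by (simp add: eval_nat_numeral)
  have lt: "norm (\<alpha> (n + 4) * z * bfun (n + 4) z) < 1" if "z \<in> ball 0 1" for z
    by (rule norm_x) (use that in simp)
  have "logfun (n + 4) has_fps_expansion fps_expansion (logfun (n + 4)) 0"
    by (rule has_fps_expansion_fps_expansion[OF _ _ logfun_holomorphic]) auto
  then have H: "(\<lambda>z. Ln (1 - \<alpha> (n + 4) * z * bfun (n + 4) z)) has_fps_expansion fps_expansion (logfun (n + 4)) 0"
    by (simp add: logfun_def[abs_def])
  have coeff2: "fps_nth (fps_expansion (logfun (n + 4)) 0) 2 = - (fps_nth X 2 + (fps_nth X 1)\<^sup>2 / 2)"
    by (rule Ln_one_minus_coeffs(1)[OF x_holomorphic lt X Xn(1) H])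
  have coeff4: "fps_nth (fps_expansion (logfun (n + 4)) 0) 4 = - (fps_nth X 4 + ((fps_nth X 2)\<^sup>2 + 2 * fps_nth X 1 * fps_nth X 3) / 2
      + (fps_nth X 1)\<^sup>2 * fps_nth X 2 + (fps_nth X 1) ^ 4 / 4)"
    by (rule Ln_one_minus_coeffs(2)[OF x_holomorphic lt X Xn(1) H])
  have c2: "fps_nth (fps_expansion (logfun (n + 4)) 0) 2 = h2 (\<alpha> (n + 4)) (\<alpha> (n + 3)) (\<alpha> (n + 2))"
    unfolding coeff2 X1 X2 h2_def by (simp add: power_mult_distrib)
  have c4: "fps_nth (fps_expansion (logfun (n + 4)) 0) 4 = h4 (\<alpha> (n + 4)) (\<alpha> (n + 3)) (\<alpha> (n + 2)) (\<alpha> (n + 1)) (\<alpha> n)"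
    unfolding coeff4 X1 X2 X3 X4 h4_def by (simp add: field_simps power2_eq_square power3_eq_cube power4_eq_xxxx)
  have "D (n + 5) - D (n + 4) = D (Suc (n + 4)) - D (n + 4)" by (simp add: eval_nat_numeral)
  then show ?thesis unfolding D_step c2 c4 step_value_def .
qed

lemma D_bounded_iff:
  "(\<exists>C. \<forall>n. D n \<le> C) \<longleftrightarrow>
   (\<exists>C. \<forall>K. (\<Sum>n<K. step_value (\<alpha> (n + 4)) (\<alpha> (n + 3)) (\<alpha> (n + 2)) (\<alpha> (n + 1)) (\<alpha> n)) \<le> C)"
proof -
  have sum: "(\<Sum>n<K. step_value (\<alpha> (n + 4)) (\<alpha> (n + 3)) (\<alpha> (n + 2)) (\<alpha> (n + 1)) (\<alpha> n)) = D (K + 4) - D 4" for K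
    unfolding D_step_value[symmetric]
    using sum_lessThan_telescope[of "\<lambda>n. D (n + 4)" K] by (simp add: eval_nat_numeral)
  show ?thesis unfolding sum
  proof
    assume "\<exists>C. \<forall>n. D n \<le> C"
    then obtain C where "\<And>n. D n \<le> C" by blast
    then show "\<exists>C. \<forall>K. D (K + 4) - D 4 \<le> C"
      by (intro exI[of _ "C - D 4"]) simp
  next
    assume "\<exists>C. \<forall>K. D (K + 4) - D 4 \<le> C"
    then obtain C where C: "\<And>K. D (K + 4) - D 4 \<le> C" by blast
    \<comment> \<open>The telescoped sums start at \<open>D 4\<close>, so the first four values are
      bounded separately.\<close>
    define B where "B = max (C + D 4) (Max (D ` {..<4}))"
    have "D n \<le> B" for n
    proof (cases "n < 4")
      case True
      then have "D n \<le> Max (D ` {..<4})" by (intro Max_ge) auto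
      then show ?thesis by (simp add: B_def)
    next
      case False
      then show ?thesis using C[of "n - 4"] by (simp add: B_def)
    qed
    then show "\<exists>C. \<forall>n. D n \<le> C" by blast
  qed
qed

end

theorem theorem4p52:
  fixes \<mu> \<mu>s :: "complex measure" and w :: "real \<Rightarrow> real" and \<alpha> :: "nat \<Rightarrow> complex"
  assumes "prob_space \<mu>"
    and "sets \<mu> = sets circle_borel"
    and "infinite (msupport \<mu>)"
    and "lebesgue_decomposition \<mu> w \<mu>s"
    and "\<alpha> = verblunsky \<mu>"
    and "\<alpha> \<in> lp_seq 6"
    and "minus_id lshift \<alpha> \<in> lp_seq 3"
  shows "ext_integral dtheta
           (\<lambda>\<theta>. ereal ((1 - cos \<theta>)\<^sup>2 * (1 + cos \<theta>)\<^sup>2) * ext_ln (w \<theta>)) > -\<infinity>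
         \<longleftrightarrow> (minus_id (lshift ^^ 2) ^^ 2) \<alpha> \<in> lp_seq 2"
proof -
  interpret decomposed_measure \<mu> w \<mu>s
    by (intro decomposed_measure.intro circle_measure.intro circle_measure_axioms.intro decomposed_measure_axioms.intro assms(1-4))
  have s6: "summable (\<lambda>n. norm (\<alpha> n) ^ 6)"
    using assms(6) by (simp add: lp_seq_def)
  have s3: "summable (\<lambda>n. norm (\<alpha> (Suc n) - \<alpha> n) ^ 3)"
    using assms(7) by (simp add: lp_seq_def minus_id_def lshift_def)
  \<comment> \<open>Expanding the square of \<open>S\<^sup>2 - 1\<close> gives the coefficients 1,
    -2, 1 at shifts 4, 2, 0.\<close>
  have "(minus_id (lshift ^^ 2) ^^ 2) \<alpha> n = \<alpha> (n + 4) - 2 * \<alpha> (n + 2) + \<alpha> n" for n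
    by (simp add: minus_id_def lshift_def eval_nat_numeral)
  then have "(minus_id (lshift ^^ 2) ^^ 2) \<alpha> \<in> lp_seq 2
      \<longleftrightarrow> summable (\<lambda>n. (norm (\<alpha> (n + 4) - 2 * \<alpha> (n + 2) + \<alpha> n))\<^sup>2)"
    by (simp add: lp_seq_def)
  also have "\<dots> \<longleftrightarrow> (\<exists>C. \<forall>K. (\<Sum>n<K. step_value (\<alpha> (n + 4)) (\<alpha> (n + 3)) (\<alpha> (n + 2)) (\<alpha> (n + 1)) (\<alpha> n)) \<le> C)"
    using step_sum_bounded_iff[of \<alpha>, OF _ s6 s3] norm_alpha by (simp add: assms(5))
  also have "\<dots> \<longleftrightarrow> (\<exists>C. \<forall>n. D n \<le> C)"
    unfolding assms(5) by (rule D_bounded_iff[symmetric])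
  finally show ?thesis unfolding entropy_finite_iff ..
qed

end
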